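(* A $\mathrm{Dend}_\infty$-algebra structure on a graded vector space $A$ is equivalent to a degree $-1$ coderivation $D\in\mathrm{Coder}^{-1}(\mathrm{Diass}^c(V))$ with $D\circ D=0$, where $V=sA$.
   Context: $\mathbb{K}$ is a field of characteristic $0$. $C_n=\{[1],\ldots,[n]\}$ is a set of $n$ symbols, $\mathbb{K}[C_n]$ the vector space with basis $C_n$. For $1\le \lambda\le j$, $i\ge 1$: $R_0^{j,i,\lambda}:C_{i+j-1}\to C_j$ sends $[r]$ to $[r]$ if $r\le\lambda-1$, to $[\lambda]$ if $\lambda\le r\le\lambda+i-1$, to $[r-i+1]$ if $r\ge\lambda+i$; $R^{j,i,\lambda}:C_{i+j-1}\to\mathbb{K}[C_i]$ sends $[r]$ to $[r-\lambda+1]$ if $\lambda\le r\le\lambda+i-1$ and to $[1]+\cdots+[i]$ otherwise. The notation $\mu_{k,x}$ is extended linearly to $x\in\mathbb{K}[C_k]$. A $\mathrm{Dend}_\infty$-algebra structure on a graded vector space $A=\oplus A_i$ is a collection of multilinear maps $\mu_{k,[r]}:A^{\otimes k}\to A$ ($[r]\in C_k$, $1\le k<\infty$) of degree $k-2$ such that for all $n\ge1$, $[r]\in C_n$ and $a_1,\ldots,a_n\in A$ (homogeneous, with $|a|$ the degree of $a$), $$\sum_{i+j=n+1}\sum_{\lambda=1}^j(-1)^{\lambda(i+1)+i(|a_1|+\cdots+|a_{\lambda-1}|)}\mu_{j,R_0^{j,i,\lambda}[r]}\big(a_1,\ldots,a_{\lambda-1},\mu_{i,R^{j,i,\lambda}[r]}(a_\lambda,\ldots,a_{\lambda+i-1}),a_{\lambda+i},\ldots,a_n\big)=0.$$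 Suspension: $sA$ is the graded vector space with $(sA)_i=A_{i-1}$. A graded diassociative coalgebra is a graded vector space $C$ with degree $0$ linear maps $\triangle_1,\triangle_2:C\to C\otimes C$ satisfying $(\mathrm{id}\otimes\triangle_1)\triangle_1=(\triangle_1\otimes\mathrm{id})\triangle_1=(\mathrm{id}\otimes\triangle_2)\triangle_1$; $(\triangle_2\otimes\mathrm{id})\triangle_1=(\mathrm{id}\otimes\triangle_1)\triangle_2$; $(\triangle_1\otimes\mathrm{id})\triangle_2=(\mathrm{id}\otimes\triangle_2)\triangle_2=(\triangle_2\otimes\mathrm{id})\triangle_2$. A coderivation on $C$ is a linear map $d:C\to C$ with $\triangle_q\circ d=(\mathrm{id}\otimes d+d\otimes\mathrm{id})\circ\triangle_q$ for $q=1,2$ (tensor products of graded maps being evaluated with the Koszul sign convention); $\mathrm{Coder}^{-1}(C)$ is the set of coderivations of degree $-1$. For a graded vector space $V$, $\mathrm{Diass}^c(V)=TV\otimes V\otimes TV$ ($TV$ the tensor space of $V$, including the empty word $1$) is the free diassociative coalgebra over $V$, with coproducts $\triangle_1(v_1\cdots v_n\otimes v\otimes w_1\cdots w_m)=\sum_{i,j\ge0,\,i+j+1\le m}(v_1\cdots v_n\otimes v\otimes w_1\cdots w_i)\otimes(w_{i+1}\cdots w_{i+j}\otimes w_{i+j+1}\otimes w_{i+j+2}\cdots w_m)$, $\triangle_2(v_1\cdots v_n\otimes v\otimes w_1\cdots w_m)=\sum_{i,j\ge0,\,i+j+1\le n}(v_1\cdots v_i\otimes v_{i+1}\otimes v_{i+2}\cdots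 v_{i+j+1})\otimes(v_{i+j+2}\cdots v_n\otimes v\otimes w_1\cdots w_m)$. *)

theory Defs
  imports Complex_Main "HOL-Library.Function_Algebras" "HOL-Library.FuncSet"
begin

section \<open>Graded vector spaces\<close>

text \<open>
  A graded vector space is given by its homogeneous components, which are linearly independent
  subspaces of an ambient vector space (a whole type with a scalar multiplication); the graded
  vector space itself is their internal direct sum \<open>carr V\<close>.  It need not fill the ambient type.
\<close>

record ('k, 'v) gspace =
  smul :: "'k \<Rightarrow> 'v \<Rightarrow> 'v"
  gr :: "int \<Rightarrow> 'v set"

definition carr :: "('k::field, 'v::ab_group_add) gspace \<Rightarrow> 'v set" where
  "carr V = module.span (smul V) (\<Union>i. gr V i)"

definition graded_vector_space :: "('k::field, 'v::ab_group_add) gspace \<Rightarrow> bool" where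
  "graded_vector_space V \<longleftrightarrow>
     vector_space (smul V) \<and> (\<forall>i. module.subspace (smul V) (gr V i)) \<and>
     (\<forall>I x. finite I \<longrightarrow> (\<forall>i\<in>I. x i \<in> gr V i) \<longrightarrow> (\<Sum>i\<in>I. x i) = 0 \<longrightarrow> (\<forall>i\<in>I. x i = 0))"

definition ground :: "('k::field, 'k) gspace" where
  "ground = \<lparr>smul = (*), gr = (\<lambda>i. if i = 0 then UNIV else {0})\<rparr>"

definition sgnp :: "int \<Rightarrow> 'k::field" where
  "sgnp e = (-1) powi e"

text \<open>Maps between graded spaces are pinned to \<open>undefined\<close> off their domain, so that
  equality of maps is equality of functions.\<close>

definition lin :: "('k::field, 'v::ab_group_add) gspace \<Rightarrow> ('k, 'w::ab_group_add) gspace \<Rightarrow> ('v \<Rightarrow> 'w) set" where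
  "lin V W = {f \<in> extensional (carr V) \<inter> (carr V \<rightarrow> carr W).
     (\<forall>x\<in>carr V. \<forall>y\<in>carr V. f (x + y) = f x + f y) \<and>
     (\<forall>c. \<forall>x\<in>carr V. f (smul V c x) = smul W c (f x))}"

definition lin_deg :: "int \<Rightarrow> ('k::field, 'v::ab_group_add) gspace \<Rightarrow> ('k, 'w::ab_group_add) gspace \<Rightarrow> ('v \<Rightarrow> 'w) set" where
  "lin_deg p V W = {f \<in> lin V W. \<forall>i. \<forall>x\<in>gr V i. f x \<in> gr W (i + p)}"

definition homog :: "('k, 'v) gspace \<Rightarrow> 'v list \<Rightarrow> int list \<Rightarrow> bool" where
  "homog V vs ds \<longleftrightarrow> list_all2 (\<lambda>v d. v \<in> gr V d) vs ds"

text \<open>The suspension does not change elements: \<open>s\<close> is the identity of the ambient space,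
  regarded as a map of degree 1 from \<open>V\<close> to \<open>susp V\<close>.\<close>

definition susp :: "('k, 'v) gspace \<Rightarrow> ('k, 'v) gspace" where
  "susp V = \<lparr>smul = smul V, gr = (\<lambda>i. gr V (i - 1))\<rparr>"


section \<open>Tensor products\<close>

text \<open>
  Over a field, \<open>V \<otimes> W\<close> embeds into the linear functionals on the space of bilinear forms on
  \<open>V \<times> W\<close>, a pure tensor \<open>x \<otimes> y\<close> becoming the evaluation at \<open>(x, y)\<close>; it is realised here as
  the span of these evaluations.  The tensor space \<open>TV\<close> is realised in the same way,
  by the evaluations at words of those functions on words that are multilinear in
  each length.  The universal properties are proved at the end.
\<close>

definition fscale :: "'k::field \<Rightarrow> ('x \<Rightarrow> 'k) \<Rightarrow> 'x \<Rightarrow> 'k" where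
  "fscale c f = (\<lambda>x. c * f x)"

definition bilinear_map :: "('k::field, 'v::ab_group_add) gspace \<Rightarrow> ('k, 'w::ab_group_add) gspace \<Rightarrow>
    ('k, 'z::ab_group_add) gspace \<Rightarrow> ('v \<Rightarrow> 'w \<Rightarrow> 'z) \<Rightarrow> bool" where
  "bilinear_map V W Z f \<longleftrightarrow>
     (\<forall>x\<in>carr V. \<forall>y\<in>carr W. f x y \<in> carr Z) \<and>
     (\<forall>x\<in>carr V. \<forall>x'\<in>carr V. \<forall>y\<in>carr W. f (x + x') y = f x y + f x' y) \<and>
     (\<forall>c. \<forall>x\<in>carr V. \<forall>y\<in>carr W. f (smul V c x) y = smul Z c (f x y)) \<and>
     (\<forall>x\<in>carr V. \<forall>y\<in>carr W. \<forall>y'\<in>carr W. f x (y + y') = f x y + f x y') \<and>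
     (\<forall>c. \<forall>x\<in>carr V. \<forall>y\<in>carr W. f x (smul W c y) = smul Z c (f x y))"

definition multilinear_map :: "nat \<Rightarrow> ('k::field, 'v::ab_group_add) gspace \<Rightarrow>
    ('k, 'z::ab_group_add) gspace \<Rightarrow> ('v list \<Rightarrow> 'z) \<Rightarrow> bool" where
  "multilinear_map k V Z f \<longleftrightarrow>
     (\<forall>vs\<in>lists (carr V). length vs = k \<longrightarrow> f vs \<in> carr Z) \<and>
     (\<forall>us\<in>lists (carr V). \<forall>ws\<in>lists (carr V). length us + 1 + length ws = k \<longrightarrow>
        (\<forall>x\<in>carr V. \<forall>y\<in>carr V. f (us @ [x + y] @ ws) = f (us @ [x] @ ws) + f (us @ [y] @ ws)) \<and>
        (\<forall>c. \<forall>x\<in>carr V. f (us @ [smul V c x] @ ws) = smul Z c (f (us @ [x] @ ws))))"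

type_synonym ('k, 'v, 'w) tens = "('v \<Rightarrow> 'w \<Rightarrow> 'k) \<Rightarrow> 'k"
type_synonym ('k, 'v) talg = "('v list \<Rightarrow> 'k) \<Rightarrow> 'k"

definition tns :: "('k::field, 'v::ab_group_add) gspace \<Rightarrow> ('k, 'w::ab_group_add) gspace \<Rightarrow>
    'v \<Rightarrow> 'w \<Rightarrow> ('k, 'v, 'w) tens" where
  "tns V W x y = (\<lambda>\<phi>. if bilinear_map V W ground \<phi> then \<phi> x y else 0)"

definition tensor :: "('k::field, 'v::ab_group_add) gspace \<Rightarrow> ('k, 'w::ab_group_add) gspace \<Rightarrow>
    ('k, ('k, 'v, 'w) tens) gspace" where
  "tensor V W = \<lparr>smul = fscale,
     gr = (\<lambda>d. module.span fscale {tns V W x y |x y i j. x \<in> gr V i \<and> y \<in> gr W j \<and> i + j = d})\<rparr>"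

definition word :: "('k::field, 'v::ab_group_add) gspace \<Rightarrow> 'v list \<Rightarrow> ('k, 'v) talg" where
  "word V vs = (\<lambda>\<phi>. if \<forall>k. multilinear_map k V ground \<phi> then \<phi> vs else 0)"

definition tensor_space :: "('k::field, 'v::ab_group_add) gspace \<Rightarrow> ('k, ('k, 'v) talg) gspace" where
  "tensor_space V = \<lparr>smul = fscale,
     gr = (\<lambda>d. module.span fscale {word V vs |vs ds. homog V vs ds \<and> sum_list ds = d})\<rparr>"

text \<open>\<open>f \<otimes> g\<close> with the Koszul sign, for \<open>g\<close> of degree \<open>q\<close>.  The degree is an explicit
  argument because a map does not determine its degree if it is zero.\<close>

definition tensor_map :: "('k::field, 'v::ab_group_add) gspace \<Rightarrow> ('k, 'w::ab_group_add) gspace \<Rightarrow>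
    ('k, 'v'::ab_group_add) gspace \<Rightarrow> ('k, 'w'::ab_group_add) gspace \<Rightarrow>
    ('v \<Rightarrow> 'v') \<Rightarrow> int \<Rightarrow> ('w \<Rightarrow> 'w') \<Rightarrow> ('k, 'v, 'w) tens \<Rightarrow> ('k, 'v', 'w') tens" where
  "tensor_map V W V' W' f q g = (THE T. T \<in> lin (tensor V W) (tensor V' W') \<and>
     (\<forall>i. \<forall>x\<in>gr V i. \<forall>y\<in>carr W. T (tns V W x y) = fscale (sgnp (q * i)) (tns V' W' (f x) (g y))))"


section \<open>Coderivations and the free diassociative coalgebra\<close>

definition Coder :: "int \<Rightarrow> ('k::field, 'c::ab_group_add) gspace \<Rightarrow>
    ('c \<Rightarrow> ('k, 'c, 'c) tens) \<Rightarrow> ('c \<Rightarrow> ('k, 'c, 'c) tens) \<Rightarrow> ('c \<Rightarrow> 'c) set" where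
  "Coder p C \<Delta>1 \<Delta>2 = {d \<in> lin_deg p C C. \<forall>\<Delta>\<in>{\<Delta>1, \<Delta>2}. \<forall>x\<in>carr C.
     \<Delta> (d x) = tensor_map C C C C (\<lambda>z. z) p d (\<Delta> x) + tensor_map C C C C d 0 (\<lambda>z. z) (\<Delta> x)}"

type_synonym ('k, 'v) diass = "('k, ('k, 'v) talg, ('k, 'v, ('k, 'v) talg) tens) tens"

definition Diass :: "('k::field, 'v::ab_group_add) gspace \<Rightarrow> ('k, ('k, 'v) diass) gspace" where
  "Diass V = tensor (tensor_space V) (tensor V (tensor_space V))"

definition mword :: "('k::field, 'v::ab_group_add) gspace \<Rightarrow> 'v list \<Rightarrow> 'v \<Rightarrow> 'v list \<Rightarrow> ('k, 'v) diass" where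
  "mword V vs v ws =
     tns (tensor_space V) (tensor V (tensor_space V)) (word V vs) (tns V (tensor_space V) v (word V ws))"

definition coprod1 :: "('k::field, 'v::ab_group_add) gspace \<Rightarrow>
    ('k, 'v) diass \<Rightarrow> ('k, ('k, 'v) diass, ('k, 'v) diass) tens" where
  "coprod1 V = (THE f. f \<in> lin (Diass V) (tensor (Diass V) (Diass V)) \<and>
     (\<forall>vs\<in>lists (carr V). \<forall>v\<in>carr V. \<forall>ws\<in>lists (carr V). f (mword V vs v ws) =
        (\<Sum>(i, j)\<in>{(i, j). i + j + 1 \<le> length ws}.
           tns (Diass V) (Diass V) (mword V vs v (take i ws))
             (mword V (take j (drop i ws)) (ws ! (i + j)) (drop (i + j + 1) ws)))))"

definition coprod2 :: "('k::field, 'v::ab_group_add) gspace \<Rightarrow>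
    ('k, 'v) diass \<Rightarrow> ('k, ('k, 'v) diass, ('k, 'v) diass) tens" where
  "coprod2 V = (THE f. f \<in> lin (Diass V) (tensor (Diass V) (Diass V)) \<and>
     (\<forall>vs\<in>lists (carr V). \<forall>v\<in>carr V. \<forall>ws\<in>lists (carr V). f (mword V vs v ws) =
        (\<Sum>(i, j)\<in>{(i, j). i + j + 1 \<le> length vs}.
           tns (Diass V) (Diass V) (mword V (take i vs) (vs ! i) (take j (drop (i + 1) vs)))
             (mword V (drop (i + j + 1) vs) v ws))))"

text \<open>The projection onto the cogenerators \<open>V = 1 \<otimes> V \<otimes> 1\<close>.\<close>

definition proj :: "('k::field, 'v::ab_group_add) gspace \<Rightarrow> ('k, 'v) diass \<Rightarrow> 'v" where
  "proj V = (THE f. f \<in> lin (Diass V) V \<and>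
     (\<forall>vs\<in>lists (carr V). \<forall>v\<in>carr V. \<forall>ws\<in>lists (carr V).
        f (mword V vs v ws) = (if vs = [] \<and> ws = [] then v else 0)))"


section \<open>\<open>Dend\<^sub>\<infinity>\<close>-algebras\<close>

text \<open>The symbol \<open>[r] \<in> C\<^sub>n\<close> is the number \<open>r \<in> {1..n}\<close>; an element of the vector space on
  \<open>C\<^sub>n\<close> is its coefficient function.\<close>

definition R0 :: "nat \<Rightarrow> nat \<Rightarrow> nat \<Rightarrow> nat \<Rightarrow> nat" where
  "R0 j i l r = (if r \<le> l - 1 then r else if r \<le> l + i - 1 then l else r - i + 1)"

definition symb :: "nat \<Rightarrow> nat \<Rightarrow> 'k::field" where
  "symb r = (\<lambda>t. if t = r then 1 else 0)"

definition R :: "nat \<Rightarrow> nat \<Rightarrow> nat \<Rightarrow> nat \<Rightarrow> nat \<Rightarrow> 'k::field" where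
  "R j i l r = (if l \<le> r \<and> r \<le> l + i - 1 then symb (r - l + 1) else (\<Sum>t=1..i. symb t))"

definition extend_lin :: "('k::field, 'a::ab_group_add) gspace \<Rightarrow> (nat \<Rightarrow> nat \<Rightarrow> 'a list \<Rightarrow> 'a) \<Rightarrow>
    nat \<Rightarrow> (nat \<Rightarrow> 'k) \<Rightarrow> 'a list \<Rightarrow> 'a" where
  "extend_lin A \<mu> k x as = (\<Sum>r=1..k. smul A (x r) (\<mu> k r as))"

text \<open>
  \<open>\<mu> k r\<close> is the operation indexed by \<open>[r] \<in> C\<^sub>k\<close>, on words of length \<open>k\<close>.  The first condition
  only fixes the value \<open>undefined\<close> at irrelevant arguments.
\<close>

definition Dend_infinity :: "('k::field, 'a::ab_group_add) gspace \<Rightarrow> (nat \<Rightarrow> nat \<Rightarrow> 'a list \<Rightarrow> 'a) \<Rightarrow> bool" where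
  "Dend_infinity A \<mu> \<longleftrightarrow>
     (\<forall>k r. \<mu> k r \<in> extensional {as \<in> lists (carr A). r \<in> {1..k} \<and> length as = k}) \<and>
     (\<forall>k\<ge>1. \<forall>r\<in>{1..k}. multilinear_map k A A (\<mu> k r) \<and>
        (\<forall>as ds. length as = k \<and> homog A as ds \<longrightarrow> \<mu> k r as \<in> gr A (sum_list ds + int k - 2))) \<and>
     (\<forall>n\<ge>1. \<forall>r\<in>{1..n}. \<forall>as ds. length as = n \<and> homog A as ds \<longrightarrow>
        (\<Sum>(i, j)\<in>{(i, j). 1 \<le> i \<and> 1 \<le> j \<and> i + j = n + 1}. \<Sum>l=1..j.
           smul A (sgnp (int l * (int i + 1) + int i * sum_list (take (l - 1) ds)))
             (\<mu> j (R0 j i l r)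
                (take (l - 1) as @
                 [extend_lin A \<mu> i (R j i l r) (take i (drop (l - 1) as))] @
                 drop (l + i - 1) as))) = 0)"

text \<open>
  \<open>D\<close> and \<open>\<mu>\<close> correspond to each other if the component of \<open>D\<close> in the cogenerators,
  restricted to words of length \<open>k\<close> with distinguished letter number \<open>r\<close>, is
  \<open>s \<circ> \<mu> k r \<circ> (s\<inverse>)\<^bsup>\<otimes>k\<^esup>\<close>.  The Koszul rule gives \<open>(s\<inverse>)\<^bsup>\<otimes>k\<^esup> (s a\<^sub>1 \<cdots> s a\<^sub>k) = \<plusminus> a\<^sub>1 \<cdots> a\<^sub>k\<close>,
  where the exponent of the sign is the sum of \<open>(k - p) (|a\<^sub>p| + 1)\<close> over \<open>p = 1..k\<close>; in the
  definition, \<open>p\<close> counts from 0.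
\<close>

definition corresponds :: "('k::field, 'a::ab_group_add) gspace \<Rightarrow> (nat \<Rightarrow> nat \<Rightarrow> 'a list \<Rightarrow> 'a) \<Rightarrow>
    (('k, 'a) diass \<Rightarrow> ('k, 'a) diass) \<Rightarrow> bool" where
  "corresponds A \<mu> D \<longleftrightarrow> (\<forall>k\<ge>1. \<forall>r\<in>{1..k}. \<forall>as ds. length as = k \<and> homog A as ds \<longrightarrow>
     proj (susp A) (D (mword (susp A) (take (r - 1) as) (as ! (r - 1)) (drop r as))) =
     smul A (sgnp (\<Sum>p<k. int (k - 1 - p) * (ds ! p + 1))) (\<mu> k r as))"

section \<open>Universal properties of the tensor constructions\<close>

lemma vector_space_fscale: "vector_space (fscale :: 'k::field \<Rightarrow> ('x \<Rightarrow> 'k) \<Rightarrow> _)"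
  by unfold_locales (auto simp: fscale_def fun_eq_iff algebra_simps)

lemma vector_space_ground: "vector_space ((*) :: 'k::field \<Rightarrow> 'k \<Rightarrow> 'k)"
  by unfold_locales (auto simp: algebra_simps)

lemma smul_tensor [simp]: "smul (tensor V W) = fscale"
  by (simp add: tensor_def)

lemma smul_tensor_space [simp]: "smul (tensor_space V) = fscale"
  by (simp add: tensor_space_def)

lemma smul_ground [simp]: "smul ground = (*)"
  by (simp add: ground_def)

lemma carr_ground [simp]: "carr (ground :: ('k::field, 'k) gspace) = UNIV"
proof -
  interpret vector_space "(*) :: 'k \<Rightarrow> 'k \<Rightarrow> 'k" by (rule vector_space_ground)
  have "(\<Union>i::int. if i = 0 then UNIV else {0}) = (UNIV :: 'k set)" by auto
  then show ?thesis by (simp add: carr_def ground_def span_UNIV)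
qed

lemma separating_functional:
  fixes s :: "'k::field \<Rightarrow> 'z::ab_group_add \<Rightarrow> 'z"
  assumes "vector_space s" and eq: "\<And>g. Vector_Spaces.linear s (*) g \<Longrightarrow> g z = g z'"
  shows "z = z'"
proof (rule ccontr)
  assume "z \<noteq> z'"
  interpret vector_space_pair s "(*) :: 'k \<Rightarrow> 'k \<Rightarrow> 'k"
    using assms(1) vector_space_ground by (simp add: vector_space_pair_def)
  have "vs1.independent {z - z'}" using \<open>z \<noteq> z'\<close> by simp
  then obtain g where g: "Vector_Spaces.linear s (*) g" "g (z - z') = (1::'k)"
    using linear_independent_extend[of "{z - z'}" "\<lambda>_. 1"] by auto
  interpret g: Vector_Spaces.linear s "(*)" g by (rule g(1))
  show False using g eq[OF g(1)] by (simp add: g.diff)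
qed

lemma linear_on_evaluations:
  fixes E :: "'x \<Rightarrow> 'p \<Rightarrow> 'k::field" and f :: "'x \<Rightarrow> 'z::ab_group_add"
  assumes s: "vector_space s"
    and P: "\<And>g. Vector_Spaces.linear s (*) g \<Longrightarrow> \<exists>p. \<forall>x\<in>X. E x p = g (f x)"
  shows "\<exists>T. Vector_Spaces.linear fscale s T \<and> (\<forall>x\<in>X. T (E x) = f x)"
proof -
  interpret vector_space_pair "fscale :: 'k \<Rightarrow> ('p \<Rightarrow> 'k) \<Rightarrow> _" s
    using s vector_space_fscale by (simp add: vector_space_pair_def)
  obtain B where B: "B \<subseteq> E ` X" "vs1.independent B" "E ` X \<subseteq> vs1.span B"
    using vs1.maximal_independent_subset by blast
  define c where "c = (\<lambda>b. SOME x. x \<in> X \<and> E x = b)"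
  have c: "c b \<in> X \<and> E (c b) = b" if "b \<in> B" for b
    unfolding c_def by (rule someI_ex) (use that B(1) in auto)
  obtain T where T: "Vector_Spaces.linear fscale s T" "\<forall>b\<in>B. T b = f (c b)"
    using linear_independent_extend[OF B(2), of "\<lambda>b. f (c b)"] by blast
  interpret T: Vector_Spaces.linear fscale s T by (rule T(1))
  have "T (E x) = f x" if x: "x \<in> X" for x
  proof (rule separating_functional[OF s])
    fix g assume g: "Vector_Spaces.linear s (*) g"
    interpret g: Vector_Spaces.linear s "(*)" g by (rule g)
    obtain p where p: "\<And>x. x \<in> X \<Longrightarrow> E x p = g (f x)" using P[OF g] by blast
    have "g (T t) = t p" if "t \<in> vs1.span B" for t
      using that
    proof (induction rule: vs1.span_induct_alt)
      case base
      show ?case by (subst T.zero, subst g.zero) simp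
    next
      case (step a b t)
      have "g (T b) = b p" using c[OF step(1)] p[of "c b"] T(2) step(1) by simp
      then have "g (T (fscale a b + t)) = a * b p + t p"
        using step by (simp only: T.add T.scale g.add g.scale)
      then show ?case by (simp add: fscale_def plus_fun_def)
    qed
    then show "g (T (E x)) = g (f x)" using B(3) x p by auto
  qed
  then show ?thesis using T(1) by blast
qed

lemma lin_eqI:
  assumes V: "vector_space (smul V)" and W: "vector_space (smul W)"
    and f: "f \<in> lin V W" and g: "g \<in> lin V W"
    and car: "carr V = module.span (smul V) S" and eq: "\<And>x. x \<in> S \<Longrightarrow> f x = g x"
  shows "f = g"
proof (rule extensionalityI)
  interpret V: vector_space "smul V" by (rule V)
  interpret W: vector_space "smul W" by (rule W)
  show "f \<in> extensional (carr V)" "g \<in> extensional (carr V)" using f g by (auto simp: lin_def)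
  fix x assume "x \<in> carr V"
  have z: "h 0 = 0" if "h \<in> lin V W" for h
  proof -
    have "0 \<in> carr V" by (simp add: car V.span_zero)
    then have "h (smul V 0 0) = smul W 0 (h 0)" using that unfolding lin_def by blast
    then show ?thesis by simp
  qed
  have "x \<in> V.span S" using \<open>x \<in> carr V\<close> car by simp
  then have "x \<in> carr V \<and> f x = g x"
  proof (induction rule: V.span_induct_alt)
    case base
    show ?case using z[OF f] z[OF g] by (simp add: car V.span_zero)
  next
    case (step c x y)
    have m: "x \<in> carr V" "y \<in> carr V" "smul V c x \<in> carr V" "smul V c x + y \<in> carr V"
      using step by (auto simp: car V.span_base V.span_scale V.span_add)
    have "h (smul V c x + y) = smul W c (h x) + h y" if "h \<in> lin V W" for h
      using that m unfolding lin_def by simp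
    from this[OF f] this[OF g] show ?case using eq[OF step(1)] step(2) m(4) by metis
  qed
  then show "f x = g x" by blast
qed

lemma lin_restrictI:
  assumes V: "vector_space (smul V)" and W: "vector_space (smul W)"
    and T: "Vector_Spaces.linear (smul V) (smul W) T"
    and car: "carr V = module.span (smul V) S" and S: "\<And>x. x \<in> S \<Longrightarrow> T x \<in> carr W"
  shows "restrict T (carr V) \<in> lin V W"
proof -
  interpret V: vector_space "smul V" by (rule V)
  interpret W: vector_space "smul W" by (rule W)
  interpret T: Vector_Spaces.linear "smul V" "smul W" T by (rule T)
  have W': "W.subspace (carr W)" by (simp add: carr_def)
  have V': "V.subspace (carr V)" by (simp add: carr_def)
  have "T x \<in> carr W" if "x \<in> V.span S" for x
    using that by (induction rule: V.span_induct_alt)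
      (auto simp: T.zero T.add T.scale S W.subspace_0[OF W'] W.subspace_add[OF W'] W.subspace_scale[OF W'])
  then show ?thesis
    by (auto simp: lin_def car[symmetric] T.add T.scale V.subspace_add[OF V'] V.subspace_scale[OF V'])
qed

lemma tns_bilinear:
  assumes "x \<in> carr V" "x' \<in> carr V" "y \<in> carr W" "y' \<in> carr W"
  shows "tns V W (x + x') y = tns V W x y + tns V W x' y"
    "tns V W x (y + y') = tns V W x y + tns V W x y'"
    "tns V W (smul V c x) y = fscale c (tns V W x y)"
    "tns V W x (smul W c y) = fscale c (tns V W x y)"
  using assms by (auto simp: tns_def bilinear_map_def fscale_def fun_eq_iff)

lemma tns_in_carr:
  assumes V: "vector_space (smul V)" and W: "vector_space (smul W)"
    and x: "x \<in> carr V" and y: "y \<in> carr W"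
  shows "tns V W x y \<in> carr (tensor V W)"
proof -
  interpret V: vector_space "smul V" by (rule V)
  interpret W: vector_space "smul W" by (rule W)
  interpret F: vector_space "fscale :: _ \<Rightarrow> (('b \<Rightarrow> 'c \<Rightarrow> 'a) \<Rightarrow> 'a) \<Rightarrow> _" by (rule vector_space_fscale)
  let ?C = "carr (tensor V W)"
  have C: "F.subspace ?C" by (simp add: carr_def)
  have z: "tns V W 0 y' \<in> ?C" if "y' \<in> carr W" for y'
  proof -
    have "0 \<in> carr V" by (simp add: carr_def V.span_zero)
    then have "tns V W 0 y' = 0"
      using tns_bilinear(1)[of 0 V 0 y' W y'] that by simp
    then show ?thesis using F.subspace_0[OF C] by metis
  qed
  have z': "tns V W x' 0 \<in> ?C" if "x' \<in> carr V" for x'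
  proof -
    have "0 \<in> carr W" by (simp add: carr_def W.span_zero)
    then have "tns V W x' 0 = 0"
      using tns_bilinear(2)[of x' V x' 0 W 0] that by simp
    then show ?thesis using F.subspace_0[OF C] by metis
  qed
  have grV: "a \<in> carr V" if "a \<in> gr V i" for a i
    using that by (auto simp: carr_def intro: V.span_base)
  have grW: "a \<in> carr W" if "a \<in> gr W i" for a i
    using that by (auto simp: carr_def intro: W.span_base)
  have h: "tns V W a b \<in> ?C" if "a \<in> gr V i" "b \<in> gr W j" for a b i j
    unfolding carr_def smul_tensor
    by (rule F.span_base, rule UN_I[of "i + j"])
      (use that in \<open>auto simp: tensor_def intro!: F.span_base\<close>)
  have 1: "tns V W a y \<in> ?C" if a: "a \<in> gr V i" for a i
  proof -
    have "y \<in> W.span (\<Union>i. gr W i)" using y by (simp add: carr_def)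
    then have "y \<in> carr W \<and> tns V W a y \<in> ?C"
    proof (induction rule: W.span_induct_alt)
      case base
      show ?case using z' grV a by (auto simp: carr_def W.span_zero)
    next
      case (step c b t)
      then have m: "b \<in> carr W" "t \<in> carr W" "smul W c b \<in> carr W" "smul W c b + t \<in> carr W"
        by (auto simp: carr_def intro!: W.span_add W.span_scale intro: W.span_base)
      obtain j where "b \<in> gr W j" using step by blast
      then show ?case
        using step h[OF a] m grV[OF a]
        by (simp only: tns_bilinear F.subspace_add[OF C] F.subspace_scale[OF C])
    qed
    then show ?thesis by blast
  qed
  have "x \<in> V.span (\<Union>i. gr V i)" using x by (simp add: carr_def)
  then have "x \<in> carr V \<and> tns V W x y \<in> ?C"
  proof (induction rule: V.span_induct_alt)
    case base
    show ?case using z y by (auto simp: carr_def V.span_zero)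
  next
    case (step c a t)
    then have m: "a \<in> carr V" "t \<in> carr V" "smul V c a \<in> carr V" "smul V c a + t \<in> carr V"
      by (auto simp: carr_def intro!: V.span_add V.span_scale intro: V.span_base)
    obtain i where "a \<in> gr V i" using step by blast
    then show ?case
      using step 1[of a i] m y
      by (simp only: tns_bilinear F.subspace_add[OF C] F.subspace_scale[OF C])
  qed
  then show ?thesis by blast
qed

lemma carr_tensor:
  assumes V: "vector_space (smul V)" and W: "vector_space (smul W)"
  shows "carr (tensor V W) = module.span fscale ((\<lambda>(x, y). tns V W x y) ` (carr V \<times> carr W))"
    (is "_ = module.span fscale ?S")
proof -
  interpret V: vector_space "smul V" by (rule V)
  interpret W: vector_space "smul W" by (rule W)
  interpret F: vector_space "fscale :: _ \<Rightarrow> (('b \<Rightarrow> 'c \<Rightarrow> 'a) \<Rightarrow> 'a) \<Rightarrow> _" by (rule vector_space_fscale)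
  have grV: "a \<in> carr V" if "a \<in> gr V i" for a i
    using that by (auto simp: carr_def intro: V.span_base)
  have grW: "a \<in> carr W" if "a \<in> gr W i" for a i
    using that by (auto simp: carr_def intro: W.span_base)
  have "gr (tensor V W) d \<subseteq> F.span ?S" for d
    unfolding tensor_def gspace.simps
    by (rule F.span_mono) (use grV grW in force)
  then have "carr (tensor V W) \<subseteq> F.span ?S"
    unfolding carr_def smul_tensor by (intro F.span_minimal) auto
  moreover have "F.span ?S \<subseteq> carr (tensor V W)"
    by (rule F.span_minimal) (use tns_in_carr[OF V W] in \<open>auto simp: carr_def\<close>)
  ultimately show ?thesis by blast
qed

theorem tensor_universal:
  fixes f :: "'v::ab_group_add \<Rightarrow> 'w::ab_group_add \<Rightarrow> 'z::ab_group_add"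
    and V :: "('k::field, 'v) gspace"
  assumes V: "vector_space (smul V)" and W: "vector_space (smul W)" and Z: "vector_space (smul Z)"
    and f: "bilinear_map V W Z f"
  shows "\<exists>!T. T \<in> lin (tensor V W) Z \<and> (\<forall>x\<in>carr V. \<forall>y\<in>carr W. T (tns V W x y) = f x y)"
proof -
  have "\<exists>p. \<forall>z\<in>carr V \<times> carr W. (case z of (x, y) \<Rightarrow> tns V W x y) p = g (case z of (x, y) \<Rightarrow> f x y)"
    if g: "Vector_Spaces.linear (smul Z) (*) g" for g
  proof -
    interpret g: Vector_Spaces.linear "smul Z" "(*)" g by (rule g)
    have "bilinear_map V W ground (\<lambda>x y. g (f x y))"
      using f by (simp add: bilinear_map_def g.add g.scale)
    then show ?thesis by (intro exI[of _ "\<lambda>x y. g (f x y)"]) (auto simp: tns_def)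
  qed
  from linear_on_evaluations[OF Z, OF this] obtain T where
    T: "Vector_Spaces.linear fscale (smul Z) T" "\<forall>x\<in>carr V. \<forall>y\<in>carr W. T (tns V W x y) = f x y"
    by fastforce
  have F: "vector_space (smul (tensor V W))" by (simp add: vector_space_fscale)
  have car: "carr (tensor V W) =
      module.span (smul (tensor V W)) ((\<lambda>(x, y). tns V W x y) ` (carr V \<times> carr W))"
    by (simp add: carr_tensor[OF V W])
  show ?thesis
  proof (rule ex1I[of _ "restrict T (carr (tensor V W))"])
    have "restrict T (carr (tensor V W)) \<in> lin (tensor V W) Z"
      by (rule lin_restrictI[OF F Z _ car]) (use T f in \<open>auto simp: bilinear_map_def\<close>)
    then show "restrict T (carr (tensor V W)) \<in> lin (tensor V W) Z \<and>
        (\<forall>x\<in>carr V. \<forall>y\<in>carr W. restrict T (carr (tensor V W)) (tns V W x y) = f x y)"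
      using T(2) tns_in_carr[OF V W] by auto
    fix T' assume T': "T' \<in> lin (tensor V W) Z \<and> (\<forall>x\<in>carr V. \<forall>y\<in>carr W. T' (tns V W x y) = f x y)"
    show "T' = restrict T (carr (tensor V W))"
      by (rule lin_eqI[OF F Z _ _ car])
        (use T' \<open>restrict T (carr (tensor V W)) \<in> _\<close> T(2) tns_in_carr[OF V W] in auto)
  qed
qed

lemma word_multilinear:
  assumes "us \<in> lists (carr V)" "ws \<in> lists (carr V)" "x \<in> carr V" "y \<in> carr V"
  shows "word V (us @ [x + y] @ ws) = word V (us @ [x] @ ws) + word V (us @ [y] @ ws)"
    "word V (us @ [smul V c x] @ ws) = fscale c (word V (us @ [x] @ ws))"
proof -
  have "\<phi> (us @ [x + y] @ ws) = \<phi> (us @ [x] @ ws) + \<phi> (us @ [y] @ ws) \<and>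
      \<phi> (us @ [smul V c x] @ ws) = c * \<phi> (us @ [x] @ ws)"
    if "\<forall>k. multilinear_map k V ground \<phi>" for \<phi>
    using spec[OF that, of "length us + 1 + length ws"] assms unfolding multilinear_map_def by simp
  then show "word V (us @ [x + y] @ ws) = word V (us @ [x] @ ws) + word V (us @ [y] @ ws)"
    "word V (us @ [smul V c x] @ ws) = fscale c (word V (us @ [x] @ ws))"
    by (auto simp: word_def fscale_def fun_eq_iff)
qed

lemma word_in_carr:
  assumes V: "vector_space (smul V)" and vs: "vs \<in> lists (carr V)"
  shows "word V vs \<in> carr (tensor_space V)"
proof -
  interpret V: vector_space "smul V" by (rule V)
  interpret F: vector_space "fscale :: _ \<Rightarrow> (('b list \<Rightarrow> 'a) \<Rightarrow> 'a) \<Rightarrow> _" by (rule vector_space_fscale)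
  let ?C = "carr (tensor_space V)"
  have C: "F.subspace ?C" by (simp add: carr_def)
  have grV: "a \<in> carr V" if "a \<in> gr V i" for a i
    using that by (auto simp: carr_def intro: V.span_base)
  have homC: "us \<in> lists (carr V)" if "homog V us ds" for us ds
    using that grV unfolding homog_def by (induction rule: list_all2_induct) auto
  have "word V (us @ ws) \<in> ?C" if "ws \<in> lists (carr V)" "homog V us ds" for us ws ds
    using that
  proof (induction ws arbitrary: us ds)
    case Nil
    then show ?case
      unfolding carr_def smul_tensor_space
      by (intro F.span_base UN_I[of "sum_list ds"]) (auto simp: tensor_space_def intro!: F.span_base)
  next
    case (Cons w ws)
    have us: "us \<in> lists (carr V)"
      using Cons.prems homC by blast
    have ws: "ws \<in> lists (carr V)" using Cons by auto
    have "w \<in> V.span (\<Union>i. gr V i)" using Cons by (simp add: carr_def)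
    then have "w \<in> carr V \<and> word V (us @ [w] @ ws) \<in> ?C"
    proof (induction rule: V.span_induct_alt)
      case base
      have "0 \<in> carr V" by (simp add: carr_def V.span_zero)
      then have "word V (us @ [0] @ ws) = 0"
        using word_multilinear(1)[OF us ws, of 0 0] by simp
      then show ?case using F.subspace_0[OF C] \<open>0 \<in> carr V\<close> by metis
    next
      case (step c a t)
      then have m: "a \<in> carr V" "t \<in> carr V" "smul V c a \<in> carr V" "smul V c a + t \<in> carr V"
        by (auto simp: carr_def intro!: V.span_add V.span_scale intro: V.span_base)
      obtain i where "a \<in> gr V i" using step by blast
      then have "homog V (us @ [a]) (ds @ [i])"
        using Cons.prems unfolding homog_def by (simp add: list_all2_appendI)
      from Cons.IH[OF this] have "word V (us @ [a] @ ws) \<in> ?C" by simp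
      then show ?case
        using step(2) us ws m
        by (simp only: word_multilinear F.subspace_add[OF C] F.subspace_scale[OF C])
    qed
    then show ?case by simp
  qed
  from this[OF vs, of "[]" "[]"] show ?thesis by (simp add: homog_def)
qed

lemma carr_tensor_space:
  assumes V: "vector_space (smul V)"
  shows "carr (tensor_space V) = module.span fscale (word V ` lists (carr V))"
proof -
  interpret V: vector_space "smul V" by (rule V)
  interpret F: vector_space "fscale :: _ \<Rightarrow> (('b list \<Rightarrow> 'a) \<Rightarrow> 'a) \<Rightarrow> _" by (rule vector_space_fscale)
  have grV: "a \<in> carr V" if "a \<in> gr V i" for a i
    using that by (auto simp: carr_def intro: V.span_base)
  have "vs \<in> lists (carr V)" if "homog V vs ds" for vs ds
    using that grV unfolding homog_def by (induction rule: list_all2_induct) auto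
  then have "gr (tensor_space V) d \<subseteq> F.span (word V ` lists (carr V))" for d
    unfolding tensor_space_def gspace.simps by (intro F.span_mono) auto
  then have "carr (tensor_space V) \<subseteq> F.span (word V ` lists (carr V))"
    unfolding carr_def smul_tensor_space by (intro F.span_minimal) auto
  moreover have "F.span (word V ` lists (carr V)) \<subseteq> carr (tensor_space V)"
    by (rule F.span_minimal) (use word_in_carr[OF V] in \<open>auto simp: carr_def\<close>)
  ultimately show ?thesis by blast
qed

theorem tensor_space_universal:
  fixes f :: "'v::ab_group_add list \<Rightarrow> 'z::ab_group_add" and V :: "('k::field, 'v) gspace"
  assumes V: "vector_space (smul V)" and Z: "vector_space (smul Z)"
    and f: "\<And>k. multilinear_map k V Z f"
  shows "\<exists>!T. T \<in> lin (tensor_space V) Z \<and> (\<forall>vs\<in>lists (carr V). T (word V vs) = f vs)"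
proof -
  have "\<exists>p. \<forall>vs\<in>lists (carr V). word V vs p = g (f vs)"
    if g: "Vector_Spaces.linear (smul Z) (*) g" for g
  proof -
    interpret g: Vector_Spaces.linear "smul Z" "(*)" g by (rule g)
    have "multilinear_map k V ground (\<lambda>vs. g (f vs))" for k
      using f[of k] unfolding multilinear_map_def by (simp add: g.add g.scale)
    then show ?thesis by (intro exI[of _ "\<lambda>vs. g (f vs)"]) (auto simp: word_def)
  qed
  from linear_on_evaluations[where E = "word V" and f = f, OF Z this] obtain T where
    T: "Vector_Spaces.linear fscale (smul Z) T" "\<forall>vs\<in>lists (carr V). T (word V vs) = f vs"
    by blast
  have F: "vector_space (smul (tensor_space V))" by (simp add: vector_space_fscale)
  have car: "carr (tensor_space V) = module.span (smul (tensor_space V)) (word V ` lists (carr V))"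
    by (simp add: carr_tensor_space[OF V])
  have fZ: "f vs \<in> carr Z" if "vs \<in> lists (carr V)" for vs
    using f[of "length vs"] that unfolding multilinear_map_def by blast
  show ?thesis
  proof (rule ex1I[of _ "restrict T (carr (tensor_space V))"])
    have *: "restrict T (carr (tensor_space V)) \<in> lin (tensor_space V) Z"
    proof (rule lin_restrictI[OF F Z _ car])
      show "Vector_Spaces.linear (smul (tensor_space V)) (smul Z) T" using T(1) by simp
      show "T x \<in> carr Z" if "x \<in> word V ` lists (carr V)" for x using that T(2) fZ by force
    qed
    then show "restrict T (carr (tensor_space V)) \<in> lin (tensor_space V) Z \<and>
        (\<forall>vs\<in>lists (carr V). restrict T (carr (tensor_space V)) (word V vs) = f vs)"
      using T(2) word_in_carr[OF V] by auto
    fix T' assume T': "T' \<in> lin (tensor_space V) Z \<and> (\<forall>vs\<in>lists (carr V). T' (word V vs) = f vs)"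
    show "T' = restrict T (carr (tensor_space V))"
    proof (rule lin_eqI[OF F Z _ * car])
      show "T' x = restrict T (carr (tensor_space V)) x" if "x \<in> word V ` lists (carr V)" for x
        using that T' T(2) word_in_carr[OF V] by force
    qed (use T' in blast)
  qed
qed

end

theory Submission
  imports Defs
begin

text \<open>A marked word \<open>(vs, v, ws)\<close> is the word \<open>vs v ws\<close> with its letter \<open>v\<close> distinguished.  The marked words
  \<open>mword V vs v ws\<close> span the free diassociative coalgebra, and maps out of it are given by functions of
  marked words that are linear in every letter (\<open>Diass_universal\<close>).  Write \<open>M w\<close> for the sum of all marked
  words with underlying word \<open>w\<close>.  Then the coproducts become deconcatenations: \<open>coprod1\<close> sends
  \<open>(vs, v, ws)\<close> to the sum of \<open>(vs, v, p) \<otimes> M q\<close> over \<open>ws = pq\<close>, and \<open>coprod2\<close> sends it to the sum of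
  \<open>M p \<otimes> (q, v, ws)\<close> over \<open>vs = pq\<close>.

  An element that is killed by both coproducts and by the projection to the cogenerators is zero
  (\<open>coprod_kernel\<close>), and the coproducts of a marked word involve shorter words only.  So a coderivation is
  determined by its projection to the cogenerators (\<open>coderivation_unique\<close>).  Conversely, let \<open>b\<close> be any
  multilinear function of marked words of degree \<open>-1\<close>.  The map \<open>coder_of b\<close>, which replaces a subword \<open>y\<close> of a marked word by one letter and sums
  over all \<open>y\<close>, is a coderivation with projection \<open>b\<close>: the new letter is the marked letter \<open>b y\<close> if \<open>y\<close> contains the mark, and
  it is the sum \<open>letters b y\<close> of \<open>b\<close> over all marks of \<open>y\<close> otherwise.  These two cases are those in the
  definition of \<open>R\<close>, and the new position of the mark is \<open>R0\<close>.

  The square of a coderivation of degree \<open>-1\<close> satisfies the coderivation identity without signs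
  (\<open>coderivation_square\<close>), so it vanishes if and only if its projection does.  This projection is a sum over
  all subwords of the word (\<open>square_proj\<close>), and it is, up to one sign for each word, the sum in the
  definition of a \<open>Dend\<^sub>\<infinity>\<close>-algebra (\<open>square_proj_sign\<close>).

  Signs are kept implicit as long as possible.  The linear map \<open>parity\<close>, which is \<open>(-1)\<^sup>d\<close> in degree \<open>d\<close>,
  turns each Koszul sign into a linear operation on the letters, so that all identities can be stated and
  proved for arbitrary instead of homogeneous letters.  Explicit exponents only appear in the comparison
  with the signs in the definitions of a \<open>Dend\<^sub>\<infinity>\<close>-algebra and of the correspondence.\<close>

section \<open>Linear and multilinear maps on graded spaces\<close>

text \<open>Linearity on the carrier, without the condition that fixes the values outside it.\<close>

definition linear_on :: "('k::field, 'v::ab_group_add) gspace \<Rightarrow> ('k, 'z::ab_group_add) gspace \<Rightarrow>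
    ('v \<Rightarrow> 'z) \<Rightarrow> bool" where
  "linear_on V Z h \<longleftrightarrow> (\<forall>x\<in>carr V. h x \<in> carr Z) \<and>
     (\<forall>x\<in>carr V. \<forall>y\<in>carr V. h (x + y) = h x + h y) \<and>
     (\<forall>c. \<forall>x\<in>carr V. h (smul V c x) = smul Z c (h x))"

lemma linear_onI:
  assumes "\<And>x. x \<in> carr V \<Longrightarrow> h x \<in> carr Z"
    and "\<And>x y. x \<in> carr V \<Longrightarrow> y \<in> carr V \<Longrightarrow> h (x + y) = h x + h y"
    and "\<And>c x. x \<in> carr V \<Longrightarrow> h (smul V c x) = smul Z c (h x)"
  shows "linear_on V Z h"
  using assms by (simp add: linear_on_def)

lemma linear_onD:
  assumes "linear_on V Z h"
  shows "x \<in> carr V \<Longrightarrow> h x \<in> carr Z"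
    "x \<in> carr V \<Longrightarrow> y \<in> carr V \<Longrightarrow> h (x + y) = h x + h y"
    "x \<in> carr V \<Longrightarrow> h (smul V c x) = smul Z c (h x)"
  using assms by (auto simp: linear_on_def)

lemma lin_iff: "f \<in> lin V Z \<longleftrightarrow> f \<in> extensional (carr V) \<and> linear_on V Z f"
  by (auto simp: lin_def linear_on_def)

lemma lin_linear_on: "f \<in> lin V Z \<Longrightarrow> linear_on V Z f"
  by (simp add: lin_iff)

lemma linear_on_cong:
  assumes "\<And>x. x \<in> carr V \<Longrightarrow> f x = g x" and "vector_space (smul V)"
  shows "linear_on V Z f \<longleftrightarrow> linear_on V Z g"
proof -
  interpret vector_space "smul V" by fact
  have c: "subspace (carr V)" by (simp add: carr_def)
  show ?thesis
    unfolding linear_on_def using assms(1) subspace_add[OF c] subspace_scale[OF c] by auto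
qed

lemma carr_closed:
  assumes "vector_space (smul V)"
  shows "0 \<in> carr V" "x \<in> carr V \<Longrightarrow> y \<in> carr V \<Longrightarrow> x + y \<in> carr V"
    "x \<in> carr V \<Longrightarrow> smul V c x \<in> carr V" "x \<in> carr V \<Longrightarrow> - x \<in> carr V"
    "(\<And>i. i \<in> I \<Longrightarrow> f i \<in> carr V) \<Longrightarrow> sum f I \<in> carr V"
    "z \<in> gr V d \<Longrightarrow> z \<in> carr V"
proof -
  interpret vector_space "smul V" by fact
  have c: "subspace (carr V)" by (simp add: carr_def)
  show "0 \<in> carr V" "x \<in> carr V \<Longrightarrow> y \<in> carr V \<Longrightarrow> x + y \<in> carr V"
    "x \<in> carr V \<Longrightarrow> smul V c x \<in> carr V" "x \<in> carr V \<Longrightarrow> - x \<in> carr V"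
    "(\<And>i. i \<in> I \<Longrightarrow> f i \<in> carr V) \<Longrightarrow> sum f I \<in> carr V"
    using subspace_0[OF c] subspace_add[OF c] subspace_scale[OF c] subspace_neg[OF c]
      subspace_sum[OF c] by blast+
  show "z \<in> gr V d \<Longrightarrow> z \<in> carr V" by (auto simp: carr_def intro: span_base)
qed

lemma linear_on_0:
  assumes "vector_space (smul V)" "vector_space (smul Z)" "linear_on V Z h"
  shows "h 0 = 0"
proof -
  interpret V: vector_space "smul V" by fact
  interpret Z: vector_space "smul Z" by fact
  show ?thesis
    using linear_onD(3)[OF assms(3) carr_closed(1)[OF assms(1)], of 0] by simp
qed

lemma linear_on_sum:
  assumes "vector_space (smul V)" "vector_space (smul Z)" "linear_on V Z h"
    and "\<And>i. i \<in> I \<Longrightarrow> f i \<in> carr V"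
  shows "h (sum f I) = (\<Sum>i\<in>I. h (f i))"
  using assms(4)
proof (induction I rule: infinite_finite_induct)
  case (insert i I)
  then have "h (f i + sum f I) = h (f i) + h (sum f I)"
    by (intro linear_onD(2)[OF assms(3)] carr_closed(5)[OF assms(1)]) auto
  then show ?case using insert by simp
qed (simp_all add: linear_on_0[OF assms(1-3)])

lemma linear_on_uminus:
  assumes "vector_space (smul V)" "vector_space (smul Z)" "linear_on V Z h" "x \<in> carr V"
  shows "h (- x) = - h x"
proof -
  have "h (x + - x) = h x + h (- x)"
    by (intro linear_onD(2)[OF assms(3)] carr_closed(4)[OF assms(1)] assms(4))
  then show ?thesis by (simp add: linear_on_0[OF assms(1-3)] eq_neg_iff_add_eq_0 add.commute)
qed

lemma linear_on_id: "linear_on V V (\<lambda>x. x)"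
  by (simp add: linear_on_def)

lemma linear_on_zero:
  assumes "vector_space (smul Z)" shows "linear_on V Z (\<lambda>x. 0)"
proof -
  interpret vector_space "smul Z" by fact
  show ?thesis by (simp add: linear_on_def carr_closed(1)[OF assms])
qed

lemma linear_on_compose: "linear_on V W g \<Longrightarrow> linear_on W Z f \<Longrightarrow> linear_on V Z (\<lambda>x. f (g x))"
  by (simp add: linear_on_def)

lemma linear_on_add:
  assumes "vector_space (smul Z)" "linear_on V Z f" "linear_on V Z g"
  shows "linear_on V Z (\<lambda>x. f x + g x)"
proof -
  interpret vector_space "smul Z" by fact
  show ?thesis
    using assms(2,3) by (auto simp: linear_on_def algebra_simps carr_closed[OF assms(1)])
qed

lemma linear_on_sum_fun:
  assumes "vector_space (smul Z)" "\<And>i. i \<in> I \<Longrightarrow> linear_on V Z (f i)"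
  shows "linear_on V Z (\<lambda>x. \<Sum>i\<in>I. f i x)"
  using assms(2)
  by (induction I rule: infinite_finite_induct)
    (auto intro!: linear_on_add linear_on_zero assms(1))

lemma linear_on_eq_span:
  assumes "vector_space (smul V)" "vector_space (smul Z)" "linear_on V Z f" "linear_on V Z g"
    and "carr V = module.span (smul V) S" "\<And>x. x \<in> S \<Longrightarrow> f x = g x" "x \<in> carr V"
  shows "f x = g x"
proof -
  have "h \<in> lin V Z" if "linear_on V Z h'" "h = restrict h' (carr V)" for h h'
    using that linear_on_cong[of V h h' Z] assms(1) by (simp add: lin_iff)
  then have "restrict f (carr V) = restrict g (carr V)"
    using assms by (intro lin_eqI[OF assms(1,2) _ _ assms(5)]) (auto simp: restrict_def)
  then show ?thesis using assms(7) by (metis restrict_apply')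
qed

lemma linear_on_span_subset:
  assumes V: "vector_space (smul V)" and Z: "vector_space (smul Z)" and "linear_on V Z f"
    and "module.subspace (smul Z) U" "S \<subseteq> carr V" "\<And>x. x \<in> S \<Longrightarrow> f x \<in> U"
    and "x \<in> module.span (smul V) S"
  shows "f x \<in> U"
proof -
  interpret V: vector_space "smul V" by (rule V)
  interpret Z: vector_space "smul Z" by (rule Z)
  have c: "x \<in> carr V \<and> f x \<in> U"
    using assms(7)
  proof (induction rule: V.span_induct_alt)
    case base
    then show ?case
      using Z.subspace_0[OF assms(4)] linear_on_0[OF V Z assms(3)] carr_closed(1)[OF V] by simp
  next
    case (step c x y)
    then have "x \<in> carr V" "smul V c x \<in> carr V" using assms(5) carr_closed(3)[OF V] by auto
    then show ?case
      using step assms(6) carr_closed(2)[OF V] Z.subspace_add[OF assms(4)]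
        Z.subspace_scale[OF assms(4)]
      by (simp add: linear_onD[OF assms(3)])
  qed
  then show ?thesis by blast
qed

text \<open>A word that depends linearly on a parameter, through exactly one of its letters.\<close>

definition linear_word :: "('k::field, 'v::ab_group_add) gspace \<Rightarrow> ('v \<Rightarrow> 'v list) \<Rightarrow> bool" where
  "linear_word V L \<longleftrightarrow> (\<exists>us\<in>lists (carr V). \<exists>ws\<in>lists (carr V). \<exists>h. linear_on V V h \<and>
     (\<forall>a. L a = us @ h a # ws))"

lemma linear_wordI:
  "us \<in> lists (carr V) \<Longrightarrow> ws \<in> lists (carr V) \<Longrightarrow> linear_on V V h \<Longrightarrow> (\<And>a. L a = us @ h a # ws) \<Longrightarrow>
    linear_word V L"
  unfolding linear_word_def by blast

lemma linear_word_letter: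
  "linear_on V V h \<Longrightarrow> ws \<in> lists (carr V) \<Longrightarrow> linear_word V (\<lambda>a. h a # ws)"
  by (rule linear_wordI[of "[]" V ws h]) auto

lemma linear_word_Cons:
  assumes "c \<in> carr V" "linear_word V L" shows "linear_word V (\<lambda>a. c # L a)"
proof -
  obtain us ws h where "us \<in> lists (carr V)" "ws \<in> lists (carr V)" "linear_on V V h"
    "\<And>a. L a = us @ h a # ws" using assms(2) unfolding linear_word_def by blast
  then show ?thesis using assms(1) by (intro linear_wordI[of "c # us" V ws h]) auto
qed

lemma linear_word_append_left:
  "us \<in> lists (carr V) \<Longrightarrow> linear_word V L \<Longrightarrow> linear_word V (\<lambda>a. us @ L a)"
proof (induction us)
  case (Cons c us)
  then show ?case using linear_word_Cons[of c V "\<lambda>a. us @ L a"] by simp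
qed simp

lemma linear_word_append_right:
  assumes "ws' \<in> lists (carr V)" "linear_word V L" shows "linear_word V (\<lambda>a. L a @ ws')"
proof -
  obtain us ws h where "us \<in> lists (carr V)" "ws \<in> lists (carr V)" "linear_on V V h"
    "\<And>a. L a = us @ h a # ws" using assms(2) unfolding linear_word_def by blast
  then show ?thesis using assms(1) by (intro linear_wordI[of us V "ws @ ws'" h]) auto
qed

lemma linear_word_map:
  assumes "linear_on V V t" "linear_word V L" shows "linear_word V (\<lambda>a. map t (L a))"
proof -
  obtain us ws h where "us \<in> lists (carr V)" "ws \<in> lists (carr V)" "linear_on V V h"
    "\<And>a. L a = us @ h a # ws" using assms(2) unfolding linear_word_def by blast
  then show ?thesis using linear_onD(1)[OF assms(1)] linear_on_compose[of V V h V t] assms(1)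
    by (intro linear_wordI[of "map t us" V "map t ws" "\<lambda>a. t (h a)"]) auto
qed

lemmas linear_word_intros = linear_word_letter linear_word_Cons linear_word_append_left
  linear_word_append_right linear_on_id

text \<open>Functions of marked words \<open>(vs, v, ws)\<close> that are linear in every letter.\<close>

definition marked_multilinear :: "('k::field, 'v::ab_group_add) gspace \<Rightarrow>
    ('k, 'z::ab_group_add) gspace \<Rightarrow> ('v list \<Rightarrow> 'v \<Rightarrow> 'v list \<Rightarrow> 'z) \<Rightarrow> bool" where
  "marked_multilinear V Z F \<longleftrightarrow>
     (\<forall>vs\<in>lists (carr V). \<forall>ws\<in>lists (carr V). linear_on V Z (\<lambda>a. F vs a ws)) \<and>
     (\<forall>us\<in>lists (carr V). \<forall>us'\<in>lists (carr V). \<forall>v\<in>carr V. \<forall>ws\<in>lists (carr V).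
        linear_on V Z (\<lambda>a. F (us @ a # us') v ws) \<and> linear_on V Z (\<lambda>a. F ws v (us @ a # us')))"

lemma marked_multilinearI:
  assumes "\<And>vs ws. vs \<in> lists (carr V) \<Longrightarrow> ws \<in> lists (carr V) \<Longrightarrow> linear_on V Z (\<lambda>a. F vs a ws)"
    and "\<And>us us' v ws. us \<in> lists (carr V) \<Longrightarrow> us' \<in> lists (carr V) \<Longrightarrow> v \<in> carr V \<Longrightarrow>
      ws \<in> lists (carr V) \<Longrightarrow> linear_on V Z (\<lambda>a. F (us @ a # us') v ws)"
    and "\<And>us us' v ws. us \<in> lists (carr V) \<Longrightarrow> us' \<in> lists (carr V) \<Longrightarrow> v \<in> carr V \<Longrightarrow>
      ws \<in> lists (carr V) \<Longrightarrow> linear_on V Z (\<lambda>a. F ws v (us @ a # us'))"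
  shows "marked_multilinear V Z F"
  unfolding marked_multilinear_def by (intro conjI ballI assms)

lemma marked_multilinear_carr:
  assumes "marked_multilinear V Z F" "vs \<in> lists (carr V)" "v \<in> carr V" "ws \<in> lists (carr V)"
  shows "F vs v ws \<in> carr Z"
  using assms linear_onD(1)[of V Z "\<lambda>a. F vs a ws" v] by (simp add: marked_multilinear_def)

lemma marked_multilinearD:
  assumes F: "marked_multilinear V Z F"
  shows "linear_on V V h \<Longrightarrow> vs \<in> lists (carr V) \<Longrightarrow> ws \<in> lists (carr V) \<Longrightarrow>
      linear_on V Z (\<lambda>a. F vs (h a) ws)"
    "linear_word V L \<Longrightarrow> v \<in> carr V \<Longrightarrow> ws \<in> lists (carr V) \<Longrightarrow> linear_on V Z (\<lambda>a. F (L a) v ws)"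
    "linear_word V L \<Longrightarrow> v \<in> carr V \<Longrightarrow> ws \<in> lists (carr V) \<Longrightarrow> linear_on V Z (\<lambda>a. F ws v (L a))"
proof -
  show "linear_on V V h \<Longrightarrow> vs \<in> lists (carr V) \<Longrightarrow> ws \<in> lists (carr V) \<Longrightarrow>
      linear_on V Z (\<lambda>a. F vs (h a) ws)"
    using F linear_on_compose[of V V h Z "\<lambda>a. F vs a ws"] by (simp add: marked_multilinear_def)
next
  assume "linear_word V L" and vw: "v \<in> carr V" "ws \<in> lists (carr V)"
  then obtain us us' h where L: "us \<in> lists (carr V)" "us' \<in> lists (carr V)" "linear_on V V h"
    "\<And>a. L a = us @ h a # us'" unfolding linear_word_def by blast
  have "linear_on V Z (\<lambda>a. F (us @ a # us') v ws)" "linear_on V Z (\<lambda>a. F ws v (us @ a # us'))"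
    using F L(1,2) vw by (simp_all add: marked_multilinear_def)
  from linear_on_compose[OF L(3) this(1)] linear_on_compose[OF L(3) this(2)]
  show "linear_on V Z (\<lambda>a. F (L a) v ws)" "linear_on V Z (\<lambda>a. F ws v (L a))"
    by (simp_all add: L(4))
qed

section \<open>Sums over decompositions of a word\<close>

text \<open>The sum over all \<open>x\<close>, \<open>y\<close> with \<open>w = xy\<close>, and the sum over all \<open>x\<close>, \<open>a\<close>, \<open>y\<close> with
  \<open>w = xay\<close>, where \<open>a\<close> is a letter.\<close>

definition cuts :: "('a list \<Rightarrow> 'a list \<Rightarrow> 'z::comm_monoid_add) \<Rightarrow> 'a list \<Rightarrow> 'z" where
  "cuts F w = (\<Sum>k\<le>length w. F (take k w) (drop k w))"

definition letters :: "('a list \<Rightarrow> 'a \<Rightarrow> 'a list \<Rightarrow> 'z::comm_monoid_add) \<Rightarrow> 'a list \<Rightarrow> 'z" where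
  "letters F w = (\<Sum>k<length w. F (take k w) (w ! k) (drop (Suc k) w))"

lemma cuts_Nil [simp]: "cuts F [] = F [] []"
  by (simp add: cuts_def)

lemma cuts_Cons: "cuts F (a # w) = F [] (a # w) + cuts (\<lambda>x. F (a # x)) w"
  by (simp add: cuts_def sum.atMost_Suc_shift del: sum.atMost_Suc)

lemma letters_Nil [simp]: "letters F [] = 0"
  by (simp add: letters_def)

lemma letters_Cons: "letters F (a # w) = F [] a w + letters (\<lambda>x. F (a # x)) w"
  by (simp add: letters_def sum.lessThan_Suc_shift del: sum.lessThan_Suc)

lemma take_drop_in_lists:
  assumes "w \<in> lists X"
  shows "take k w \<in> lists X" "drop k w \<in> lists X" "k < length w \<Longrightarrow> w ! k \<in> X"
  using assms by (auto dest: in_set_takeD in_set_dropD)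

lemma cuts_cong_lists:
  assumes "w \<in> lists X" "\<And>x y. x \<in> lists X \<Longrightarrow> y \<in> lists X \<Longrightarrow> F x y = G x y"
  shows "cuts F w = cuts G w"
  unfolding cuts_def by (intro sum.cong refl assms(2)) (simp_all add: take_drop_in_lists assms(1))

lemma letters_cong_lists:
  assumes "w \<in> lists X" "\<And>x a y. x \<in> lists X \<Longrightarrow> a \<in> X \<Longrightarrow> y \<in> lists X \<Longrightarrow> F x a y = G x a y"
  shows "letters F w = letters G w"
  unfolding letters_def by (intro sum.cong refl assms(2)) (simp_all add: take_drop_in_lists assms(1))

lemma cuts_add: "cuts (\<lambda>x y. F x y + G x y) w = cuts F w + cuts G w"
  by (simp add: cuts_def sum.distrib)

lemma letters_add: "letters (\<lambda>x a y. F x a y + G x a y) w = letters F w + letters G w"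
  by (simp add: letters_def sum.distrib)

lemma cuts_swap:
  "cuts (\<lambda>x y. cuts (\<lambda>x' y'. F x y x' y') w') w = cuts (\<lambda>x' y'. cuts (\<lambda>x y. F x y x' y') w) w'"
  unfolding cuts_def by (rule sum.swap)

lemma cuts_map: "cuts F (map f w) = cuts (\<lambda>x y. F (map f x) (map f y)) w"
  by (simp add: cuts_def take_map drop_map)

lemma letters_map: "letters F (map f w) = letters (\<lambda>x a y. F (map f x) (f a) (map f y)) w"
  by (simp add: letters_def take_map drop_map)

lemma cuts_append_Cons: "cuts F (u @ a # v) = cuts (\<lambda>x y. F x (y @ a # v)) u + cuts (\<lambda>x. F (u @ a # x)) v"
  by (induction u arbitrary: F) (auto simp: cuts_Cons add.assoc)

lemma letters_append: "letters F (u @ v) = letters (\<lambda>x a y. F x a (y @ v)) u + letters (\<lambda>x. F (u @ x)) v"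
  by (induction u arbitrary: F) (auto simp: letters_Cons add.assoc)

lemma cuts_assoc: "cuts (\<lambda>x u. cuts (\<lambda>y z. F x y z) u) w = cuts (\<lambda>u z. cuts (\<lambda>x y. F x y z) u) w"
proof (induction w arbitrary: F)
  case (Cons a w)
  show ?case
    by (simp only: cuts_Cons cuts_Nil cuts_add Cons.IH[of "\<lambda>x. F (a # x)"] add.assoc)
qed simp

lemma letters_cuts_left: "letters (\<lambda>u a z. cuts (\<lambda>x y. F x y a z) u) w = cuts (\<lambda>x v. letters (F x) v) w"
proof (induction w arbitrary: F)
  case (Cons a w)
  show ?case
    by (simp only: cuts_Cons letters_Cons cuts_Nil letters_add Cons.IH[of "\<lambda>x. F (a # x)"] add.assoc)
qed simp

lemma letters_cuts_right:
  "letters (\<lambda>p a u. cuts (\<lambda>x y. F p a x y) u) w = cuts (\<lambda>v y. letters (\<lambda>p a x. F p a x y) v) w"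
proof (induction w arbitrary: F)
  case (Cons a w)
  show ?case
    by (simp only: cuts_Cons letters_Cons letters_Nil cuts_add Cons.IH[of "\<lambda>p. F (a # p)"] add_0)
qed simp

text \<open>The sum over all \<open>x\<close>, \<open>y\<close>, \<open>z\<close> with \<open>w = xyz\<close>.\<close>

definition cuts3 :: "('a list \<Rightarrow> 'a list \<Rightarrow> 'a list \<Rightarrow> 'z::comm_monoid_add) \<Rightarrow> 'a list \<Rightarrow> 'z" where
  "cuts3 F w = cuts (\<lambda>x u. cuts (F x) u) w"

lemma cuts3_append_Cons:
  "cuts3 F (u @ a # v) = cuts3 (\<lambda>x y z. F x y (z @ a # v)) u +
     cuts (\<lambda>x y. cuts (\<lambda>y' z. F x (y @ a # y') z) v) u + cuts3 (\<lambda>x. F (u @ a # x)) v"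
  by (simp add: cuts3_def cuts_append_Cons cuts_add)

lemma cuts3_cong_lists:
  assumes "w \<in> lists X"
    "\<And>x y z. x \<in> lists X \<Longrightarrow> y \<in> lists X \<Longrightarrow> z \<in> lists X \<Longrightarrow> F x y z = G x y z"
  shows "cuts3 F w = cuts3 G w"
  unfolding cuts3_def using assms by (auto intro!: cuts_cong_lists[where X = X])

lemma cuts3_add: "cuts3 (\<lambda>x y z. F x y z + G x y z) w = cuts3 F w + cuts3 G w"
  by (simp add: cuts3_def cuts_add)

section \<open>The universal property and the grading of the free diassociative coalgebra\<close>

text \<open>Membership of words is reasoned about in the form \<open>w \<in> lists X\<close>, not letter by letter.\<close>

declare vector_space_fscale [simp] in_listsD [rule del] in_listsI [rule del]

lemma multilinear_mapI:
  assumes "\<And>w. w \<in> lists (carr V) \<Longrightarrow> f w \<in> carr Z"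
    and "\<And>us ws. us \<in> lists (carr V) \<Longrightarrow> ws \<in> lists (carr V) \<Longrightarrow> linear_on V Z (\<lambda>a. f (us @ a # ws))"
  shows "multilinear_map k V Z f"
  using assms(1) linear_onD(2,3)[OF assms(2)] unfolding multilinear_map_def by simp

lemma linear_on_scale:
  assumes "vector_space (smul Z)" "linear_on V Z f"
  shows "linear_on V Z (\<lambda>x. smul Z c (f x))"
proof -
  interpret vector_space "smul Z" by fact
  show ?thesis
    using assms(2) by (auto simp: linear_on_def scale_right_distrib mult.commute carr_closed[OF assms(1)])
qed

lemma linear_on_minus:
  assumes "vector_space (smul Z)" "linear_on V Z f"
  shows "linear_on V Z (\<lambda>x. - f x)"
proof -
  interpret vector_space "smul Z" by fact
  show ?thesis using linear_on_scale[OF assms, of "- 1"] by simp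
qed

lemma linear_on_diff:
  assumes "vector_space (smul Z)" "linear_on V Z f" "linear_on V Z g"
  shows "linear_on V Z (\<lambda>x. f x - g x)"
  using linear_on_add[OF assms(1,2) linear_on_minus[OF assms(1,3)]] by simp

text \<open>Linearity in a parameter can be checked on a spanning set of the argument space.\<close>

lemma linear_on_parameter:
  assumes W: "vector_space (smul W)" and Z: "vector_space (smul Z)"
    and T: "\<And>a. a \<in> carr V \<Longrightarrow> linear_on W Z (T a)"
    and S: "carr W = module.span (smul W) S" "\<And>s. s \<in> S \<Longrightarrow> linear_on V Z (\<lambda>a. T a s)"
    and V: "vector_space (smul V)" and w: "w \<in> carr W"
  shows "linear_on V Z (\<lambda>a. T a w)"
proof (rule linear_onI)
  fix x y c assume x: "x \<in> carr V"
  show "T x w \<in> carr Z" using T[OF x] w by (rule linear_onD)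
  have "linear_on W Z (T (smul V c x))" "linear_on W Z (\<lambda>w. smul Z c (T x w))"
    using T[OF carr_closed(3)[OF V x]] T[OF x] by (auto intro: linear_on_scale[OF Z])
  from linear_on_eq_span[OF W Z this S(1) _ w]
  show "T (smul V c x) w = smul Z c (T x w)" using linear_onD(3)[OF S(2) x] by blast
  assume y: "y \<in> carr V"
  have "linear_on W Z (T (x + y))" "linear_on W Z (\<lambda>w. T x w + T y w)"
    using T[OF carr_closed(2)[OF V x y]] T[OF x] T[OF y] by (auto intro: linear_on_add[OF Z])
  from linear_on_eq_span[OF W Z this S(1) _ w]
  show "T (x + y) w = T x w + T y w" using linear_onD(2)[OF S(2) x y] by blast
qed

lemma bilinear_mapI:
  assumes "\<And>y. y \<in> carr W \<Longrightarrow> linear_on V Z (\<lambda>x. f x y)" "\<And>x. x \<in> carr V \<Longrightarrow> linear_on W Z (f x)"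
  shows "bilinear_map V W Z f"
  using linear_onD[OF assms(1)] linear_onD[OF assms(2)] unfolding bilinear_map_def by simp

lemma linear_on_tns:
  assumes "vector_space (smul V)" "vector_space (smul W)"
  shows "y \<in> carr W \<Longrightarrow> linear_on V (tensor V W) (\<lambda>x. tns V W x y)"
    "x \<in> carr V \<Longrightarrow> linear_on W (tensor V W) (tns V W x)"
  by (auto intro!: linear_onI tns_in_carr assms tns_bilinear)

lemma linear_on_word:
  assumes "vector_space (smul V)" "us \<in> lists (carr V)" "ws \<in> lists (carr V)"
  shows "linear_on V (tensor_space V) (\<lambda>a. word V (us @ a # ws))"
  using assms word_multilinear[of us V ws]
  by (intro linear_onI word_in_carr) auto

lemma vector_space_smul_tensors [simp]:
  "vector_space (smul (tensor V W))" "vector_space (smul (tensor_space V))"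
  "vector_space (smul (Diass V))"
  by (simp_all add: Diass_def)

lemma smul_Diass [simp]: "smul (Diass V) = fscale"
  by (simp add: Diass_def)

lemma mword_multilinear:
  assumes V: "vector_space (smul V)"
  shows "marked_multilinear V (Diass V) (mword V)"
proof (rule marked_multilinearI)
  have U: "linear_on V (tensor V (tensor_space V)) (\<lambda>a. tns V (tensor_space V) a (word V ws))"
      "linear_on V (tensor V (tensor_space V)) (\<lambda>a. tns V (tensor_space V) v (word V (us @ a # us')))"
      "tns V (tensor_space V) v (word V ws) \<in> carr (tensor V (tensor_space V))"
    if "us \<in> lists (carr V)" "us' \<in> lists (carr V)" "v \<in> carr V" "ws \<in> lists (carr V)" for us us' v ws
  proof -
    have ws: "word V ws \<in> carr (tensor_space V)" using that(4) by (rule word_in_carr[OF V])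
    show "linear_on V (tensor V (tensor_space V)) (\<lambda>a. tns V (tensor_space V) a (word V ws))"
      by (rule linear_on_tns(1)[OF V _ ws]) simp
    show "linear_on V (tensor V (tensor_space V)) (\<lambda>a. tns V (tensor_space V) v (word V (us @ a # us')))"
      by (rule linear_on_compose[OF linear_on_word[OF V that(1,2)] linear_on_tns(2)[OF V _ that(3)]]) simp
    show "tns V (tensor_space V) v (word V ws) \<in> carr (tensor V (tensor_space V))"
      by (rule tns_in_carr[OF V _ that(3) ws]) simp
  qed
  fix vs ws us us' v assume [simp]: "ws \<in> lists (carr V)"
  show "linear_on V (Diass V) (\<lambda>a. mword V vs a ws)" if "vs \<in> lists (carr V)"
    unfolding mword_def Diass_def
    by (rule linear_on_compose[OF U(1)[of "[]" "[]" 0] linear_on_tns(2)])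
      (use that V in \<open>auto simp: word_in_carr carr_closed\<close>)
  assume [simp]: "us \<in> lists (carr V)" "us' \<in> lists (carr V)" "v \<in> carr V"
  show "linear_on V (Diass V) (\<lambda>a. mword V (us @ a # us') v ws)"
    unfolding mword_def Diass_def
    by (rule linear_on_compose[OF linear_on_word[OF V] linear_on_tns(1)])
      (simp_all add: U(3)[of "[]" "[]"])
  show "linear_on V (Diass V) (\<lambda>a. mword V ws v (us @ a # us'))"
    unfolding mword_def Diass_def
    by (rule linear_on_compose[OF U(2)[of _ _ _ "[]"] linear_on_tns(2)]) (simp_all add: V word_in_carr)
qed

lemmas linear_on_mword = marked_multilinearD[OF mword_multilinear]
lemmas mword_in_carr [simp] = marked_multilinear_carr[OF mword_multilinear]

text \<open>The tensors of the elements of two spanning sets span.\<close>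

lemma tns_span:
  assumes V: "vector_space (smul V)" and W: "vector_space (smul W)"
    and S: "S \<subseteq> carr V" "S' \<subseteq> carr W" and t: "t \<in> module.span (smul V) S"
    and u: "u \<in> module.span (smul W) S'"
  shows "tns V W t u \<in> module.span fscale {tns V W s s' |s s'. s \<in> S \<and> s' \<in> S'}" (is "_ \<in> ?U")
proof -
  interpret V: vector_space "smul V" by (rule V)
  interpret W: vector_space "smul W" by (rule W)
  interpret F: vector_space "fscale :: _ \<Rightarrow> (('b \<Rightarrow> 'c \<Rightarrow> 'a) \<Rightarrow> 'a) \<Rightarrow> _" by (rule vector_space_fscale)
  have "W.span S' \<subseteq> carr W"
    by (rule W.span_minimal[OF S(2)]) (simp add: carr_def)
  then have uc: "u \<in> carr W" using u by blast
  have U: "module.subspace (smul (tensor V W)) ?U" by simp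
  have "tns V W s u \<in> ?U" if s: "s \<in> S" for s
    by (rule linear_on_span_subset[OF W _ linear_on_tns(2)[OF V W] U S(2) _ u])
      (use s S(1) in \<open>auto intro!: F.span_base\<close>)
  from linear_on_span_subset[OF V _ linear_on_tns(1)[OF V W uc] U S(1) this t] show ?thesis by simp
qed

lemma homog_lists:
  assumes V: "vector_space (smul V)" and "homog V vs ds" shows "vs \<in> lists (carr V)"
  using assms(2) carr_closed(6)[OF V] unfolding homog_def by (induction rule: list_all2_induct) auto

text \<open>The homogeneous marked words of total degree \<open>d\<close> span the component of degree \<open>d\<close>.\<close>

lemma gr_Diass:
  assumes V: "vector_space (smul V)"
  shows "gr (Diass V) d =
    module.span fscale {mword V vs v ws |vs v ws ds. homog V (vs @ v # ws) ds \<and> sum_list ds = d}"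
    (is "_ = module.span fscale (?M d)")
proof -
  interpret V: vector_space "smul V" by (rule V)
  let ?T = "tensor_space V" and ?U = "tensor V (tensor_space V)"
  interpret T: vector_space "fscale :: _ \<Rightarrow> (('b list \<Rightarrow> 'a) \<Rightarrow> 'a) \<Rightarrow> _" by (rule vector_space_fscale)
  interpret U: vector_space "fscale :: _ \<Rightarrow> (('b \<Rightarrow> (('b list \<Rightarrow> 'a) \<Rightarrow> 'a) \<Rightarrow> 'a) \<Rightarrow> 'a) \<Rightarrow> _"
    by (rule vector_space_fscale)
  interpret D: vector_space "fscale :: 'a \<Rightarrow> ('a, 'b) diass \<Rightarrow> _" by (rule vector_space_fscale)
  define SW where "SW = (\<lambda>i. {word V vs |vs ds. homog V vs ds \<and> sum_list ds = i})"
  define SU where "SU = (\<lambda>j. {tns V ?T v (word V ws) |v ws i ds.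
    v \<in> gr V i \<and> homog V ws ds \<and> i + sum_list ds = j})"
  have grT: "gr ?T i = T.span (SW i)" for i by (simp add: tensor_space_def SW_def)
  have SWc: "SW i \<subseteq> carr ?T" for i
    using homog_lists[OF V] word_in_carr[OF V] by (auto simp: SW_def)
  have SUc: "SU i \<subseteq> carr ?U" for i
    unfolding SU_def using homog_lists[OF V] carr_closed(6)[OF V]
    by (fastforce intro: tns_in_carr V word_in_carr)
  have grU: "gr ?U j \<subseteq> U.span (SU j)" for j
  proof -
    have "tns V ?T v s \<in> U.span (SU (i + k))" if v: "v \<in> gr V i" and s: "s \<in> gr ?T k" for v s i k
    proof -
      have "tns V ?T v s \<in> U.span {tns V ?T a b |a b. a \<in> {v} \<and> b \<in> SW k}"
        using s unfolding grT
        by (intro tns_span V SWc) (use v in \<open>auto intro: carr_closed(6)[OF V] V.span_base\<close>)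
      also have "\<dots> \<subseteq> U.span (SU (i + k))"
        by (rule U.span_mono) (use v in \<open>auto simp: SU_def SW_def\<close>)
      finally show ?thesis .
    qed
    then show ?thesis unfolding tensor_def[of V] gspace.simps by (intro U.span_minimal) auto
  qed
  have "tns ?T ?U t u \<in> D.span (?M (i + j))" if t: "t \<in> gr ?T i" and u: "u \<in> gr ?U j" for t u i j
  proof -
    have "tns ?T ?U t u \<in> D.span {tns ?T ?U a b |a b. a \<in> SW i \<and> b \<in> SU j}"
      by (rule tns_span[OF _ _ SWc SUc]) (use t grT u grU in auto)
    also have "\<dots> \<subseteq> D.span (?M (i + j))"
    proof (rule D.span_mono, safe)
      fix a b assume "a \<in> SW i" "b \<in> SU j"
      then obtain vs ds v ws e es where *: "a = word V vs" "homog V vs ds" "sum_list ds = i"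
        "b = tns V ?T v (word V ws)" "v \<in> gr V e" "homog V ws es" "e + sum_list es = j"
        unfolding SW_def SU_def by blast
      then have "homog V (vs @ v # ws) (ds @ e # es)" "sum_list (ds @ e # es) = i + j"
        by (auto simp: homog_def list_all2_appendI)
      then show "\<exists>vs v ws ds. tns ?T ?U a b = mword V vs v ws \<and> homog V (vs @ v # ws) ds \<and> sum_list ds = i + j"
        using *(1,4) unfolding mword_def by blast
    qed
    finally show ?thesis .
  qed
  then have 1: "gr (Diass V) d \<subseteq> D.span (?M d)"
    unfolding Diass_def tensor_def[of ?T] gspace.simps by (intro D.span_minimal) auto
  have "mword V vs v ws \<in> gr (Diass V) d" if "homog V (vs @ v # ws) ds" "sum_list ds = d" for vs v ws ds
  proof -
    have len: "length vs < length ds"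
      using list_all2_lengthD[OF that(1)[unfolded homog_def]] by simp
    define as e es where "as = take (length vs) ds" "e = ds ! length vs" "es = drop (Suc (length vs)) ds"
    then have ds: "ds = as @ e # es" and l: "length as = length vs"
      using id_take_nth_drop[OF len] len by simp_all
    have *: "homog V vs as" "v \<in> gr V e" "homog V ws es"
      using that(1) l unfolding ds homog_def by (simp_all add: list_all2_append)
    have w: "word V us \<in> gr ?T (sum_list bs)" if "homog V us bs" for us bs
      unfolding grT using that by (auto simp: SW_def intro!: T.span_base)
    have "tns V ?T v (word V ws) \<in> gr ?U (e + sum_list es)"
      unfolding tensor_def[of V] gspace.simps
      by (intro U.span_base) (use w *(2,3) in blast)
    then show ?thesis
      unfolding Diass_def tensor_def[of ?T] gspace.simps mword_def
      using w[OF *(1)] that(2) unfolding ds by (intro D.span_base) auto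
  qed
  then have "D.span (?M d) \<subseteq> D.span (gr (Diass V) d)" by (intro D.span_mono) auto
  moreover have "D.span (gr (Diass V) d) = gr (Diass V) d"
    unfolding Diass_def tensor_def[of ?T] gspace.simps by simp
  ultimately show ?thesis using 1 by blast
qed

lemma carr_Diass:
  assumes V: "vector_space (smul V)"
  shows "carr (Diass V) = module.span (smul (Diass V))
    {mword V vs v ws |vs v ws. vs \<in> lists (carr V) \<and> v \<in> carr V \<and> ws \<in> lists (carr V)}"
    (is "_ = module.span _ ?S")
proof -
  interpret D: vector_space "fscale :: 'a \<Rightarrow> ('a, 'b) diass \<Rightarrow> _" by (rule vector_space_fscale)
  have "gr (Diass V) d \<subseteq> D.span ?S" for d
    unfolding gr_Diass[OF V] by (rule D.span_mono) (use homog_lists[OF V] in fastforce)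
  then have "carr (Diass V) \<subseteq> D.span ?S"
    unfolding carr_def smul_Diass by (intro D.span_minimal) auto
  moreover have "D.span ?S \<subseteq> carr (Diass V)"
  proof (rule D.span_minimal)
    show "?S \<subseteq> carr (Diass V)" using V by auto
    show "D.subspace (carr (Diass V))" by (simp add: carr_def)
  qed
  ultimately show ?thesis by simp
qed

lemma Diass_eqI:
  assumes V: "vector_space (smul V)" and Z: "vector_space (smul Z)"
    and "linear_on (Diass V) Z f" "linear_on (Diass V) Z g"
    and "\<And>vs v ws. vs \<in> lists (carr V) \<Longrightarrow> v \<in> carr V \<Longrightarrow> ws \<in> lists (carr V) \<Longrightarrow>
      f (mword V vs v ws) = g (mword V vs v ws)"
    and "x \<in> carr (Diass V)"
  shows "f x = g x"
  by (rule linear_on_eq_span[OF _ Z assms(3,4) carr_Diass[OF V] _ assms(6)]) (use assms(5) in auto)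

lemma word_lift:
  assumes V: "vector_space (smul V)" and Z: "vector_space (smul Z)"
    and "\<And>w. w \<in> lists (carr V) \<Longrightarrow> f w \<in> carr Z"
    and "\<And>us ws. us \<in> lists (carr V) \<Longrightarrow> ws \<in> lists (carr V) \<Longrightarrow> linear_on V Z (\<lambda>a. f (us @ a # ws))"
  shows "\<exists>T. linear_on (tensor_space V) Z T \<and> (\<forall>w\<in>lists (carr V). T (word V w) = f w)"
  using tensor_space_universal[OF V Z multilinear_mapI[OF assms(3,4)]] lin_linear_on by blast

text \<open>The universal properties of the three tensor products are applied one after the other: first to the
  letters on the right of the mark, then to the marked letter, and then to the letters on its left.  At
  each stage, linearity in the remaining letters passes from the generators to the whole space by
  \<open>linear_on_parameter\<close>.\<close>

theorem Diass_universal: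
  fixes F :: "'v::ab_group_add list \<Rightarrow> 'v \<Rightarrow> 'v list \<Rightarrow> 'z::ab_group_add" and V :: "('k::field, 'v) gspace"
  assumes V: "vector_space (smul V)" and Z: "vector_space (smul Z)" and F: "marked_multilinear V Z F"
  shows "\<exists>!T. T \<in> lin (Diass V) Z \<and>
    (\<forall>vs\<in>lists (carr V). \<forall>v\<in>carr V. \<forall>ws\<in>lists (carr V). T (mword V vs v ws) = F vs v ws)"
proof -
  let ?L = "lists (carr V)" and ?T = "tensor_space V" and ?U = "tensor V (tensor_space V)"
  have carU: "carr ?U = module.span (smul ?U) ((\<lambda>(x, y). tns V ?T x y) ` (carr V \<times> carr ?T))"
    using carr_tensor[OF V, of ?T] by simp
  have carT: "carr ?T = module.span (smul ?T) (word V ` ?L)"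
    using carr_tensor_space[OF V] by simp
  have Fws: "F vs v ws \<in> carr Z" "linear_on V Z (\<lambda>a. F vs v (us @ a # us'))"
      "linear_on V Z (\<lambda>a. F (us @ a # us') v ws)" "linear_on V Z (\<lambda>a. F vs a ws)"
    if "vs \<in> ?L" "v \<in> carr V" "ws \<in> ?L" "us \<in> ?L" "us' \<in> ?L" for vs v ws us us'
    using that F marked_multilinear_carr[OF F] by (auto simp: marked_multilinear_def)
  have "\<exists>T. linear_on ?T Z T \<and> (\<forall>ws\<in>?L. T (word V ws) = F vs v ws)" if "vs \<in> ?L" "v \<in> carr V" for vs v
    by (rule word_lift[OF V Z]) (use that Fws in auto)
  then obtain T where T: "linear_on ?T Z (T vs v)" "ws \<in> ?L \<Longrightarrow> T vs v (word V ws) = F vs v ws"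
    if "vs \<in> ?L" "v \<in> carr V" for vs v ws by metis
  have Tv: "linear_on V Z (\<lambda>v. T vs v t)" if vs: "vs \<in> ?L" and t: "t \<in> carr ?T" for vs t
  proof (rule linear_on_parameter[OF _ Z _ carT _ V t])
    fix s assume "s \<in> word V ` ?L"
    then obtain ws where ws: "ws \<in> ?L" "s = word V ws" by blast
    have "linear_on V Z (\<lambda>a. F vs a ws)" using Fws(4)[OF vs _ ws(1)] carr_closed(1)[OF V] by auto
    then show "linear_on V Z (\<lambda>a. T vs a s)"
      by (subst linear_on_cong[where g = "\<lambda>a. F vs a ws"]) (simp_all add: T vs ws V)
  qed (simp_all add: T vs)
  have Tu: "linear_on V Z (\<lambda>a. T (us @ a # us') v t)"
    if us: "us \<in> ?L" "us' \<in> ?L" "v \<in> carr V" and t: "t \<in> carr ?T" for us us' v t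
  proof (rule linear_on_parameter[OF _ Z _ carT _ V t])
    fix s assume "s \<in> word V ` ?L"
    then obtain ws where ws: "ws \<in> ?L" "s = word V ws" by blast
    have "linear_on V Z (\<lambda>a. F (us @ a # us') v ws)" using Fws(3) us ws by blast
    then show "linear_on V Z (\<lambda>a. T (us @ a # us') v s)"
      by (subst linear_on_cong[where g = "\<lambda>a. F (us @ a # us') v ws"]) (simp_all add: T us ws V)
  qed (simp_all add: T us)
  have "\<exists>S. linear_on ?U Z S \<and> (\<forall>v\<in>carr V. \<forall>t\<in>carr ?T. S (tns V ?T v t) = T vs v t)" if "vs \<in> ?L" for vs
  proof -
    have "bilinear_map V ?T Z (T vs)"
      by (rule bilinear_mapI) (use that T Tv in auto)
    from tensor_universal[OF V _ Z this] show ?thesis using lin_linear_on by auto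
  qed
  then obtain S where S: "linear_on ?U Z (S vs)"
    "v \<in> carr V \<Longrightarrow> t \<in> carr ?T \<Longrightarrow> S vs (tns V ?T v t) = T vs v t" if "vs \<in> ?L" for vs v t by metis
  have Su: "linear_on V Z (\<lambda>a. S (us @ a # us') u)"
    if us: "us \<in> ?L" "us' \<in> ?L" and u: "u \<in> carr ?U" for us us' u
  proof (rule linear_on_parameter[OF _ Z _ carU _ V u])
    fix s assume "s \<in> (\<lambda>(x, y). tns V ?T x y) ` (carr V \<times> carr ?T)"
    then obtain v t where s: "v \<in> carr V" "t \<in> carr ?T" "s = tns V ?T v t" by auto
    show "linear_on V Z (\<lambda>a. S (us @ a # us') s)"
      using Tu[OF us s(1,2)]
      by (subst linear_on_cong[where g = "\<lambda>a. T (us @ a # us') v t"]) (simp_all add: S us s V)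
  qed (simp_all add: S us)
  have "\<exists>R. linear_on ?T Z R \<and> (\<forall>vs\<in>?L. R (word V vs) = S vs u)" if "u \<in> carr ?U" for u
    by (rule word_lift[OF V Z linear_onD(1)[OF S(1) that] Su[OF _ _ that]])
  then obtain R where R: "linear_on ?T Z (R u)" "vs \<in> ?L \<Longrightarrow> R u (word V vs) = S vs u"
    if "u \<in> carr ?U" for u vs by metis
  have Ru: "linear_on ?U Z (\<lambda>u. R u t)" if t: "t \<in> carr ?T" for t
  proof (rule linear_on_parameter[OF _ Z _ carT _ _ t])
    fix s assume "s \<in> word V ` ?L"
    then obtain vs where vs: "vs \<in> ?L" "s = word V vs" by blast
    show "linear_on ?U Z (\<lambda>u. R u s)"
      using S(1)[OF vs(1)] by (subst linear_on_cong[where g = "S vs"]) (simp_all add: R vs)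
  qed (simp_all add: R)
  have "bilinear_map ?T ?U Z (\<lambda>t u. R u t)"
    by (rule bilinear_mapI) (use R Ru in auto)
  from tensor_universal[OF _ _ Z this] obtain Q where Q: "Q \<in> lin (tensor ?T ?U) Z"
    "\<And>t u. t \<in> carr ?T \<Longrightarrow> u \<in> carr ?U \<Longrightarrow> Q (tns ?T ?U t u) = R u t" by auto
  show ?thesis
  proof (rule ex1I[of _ Q])
    show "Q \<in> lin (Diass V) Z \<and> (\<forall>vs\<in>?L. \<forall>v\<in>carr V. \<forall>ws\<in>?L. Q (mword V vs v ws) = F vs v ws)"
      using Q by (simp add: Diass_def mword_def word_in_carr tns_in_carr V R S T)
    fix Q' assume Q': "Q' \<in> lin (Diass V) Z \<and>
      (\<forall>vs\<in>?L. \<forall>v\<in>carr V. \<forall>ws\<in>?L. Q' (mword V vs v ws) = F vs v ws)"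
    show "Q' = Q"
      by (rule lin_eqI[OF _ Z _ _ carr_Diass[OF V]])
        (use Q' \<open>Q \<in> lin (Diass V) Z \<and> _\<close> in auto)
  qed
qed

section \<open>Linearity of sums over decompositions\<close>

lemma linear_on_cuts_fun:
  assumes "vector_space (smul Z)" "w \<in> lists X"
    and "\<And>x y. x \<in> lists X \<Longrightarrow> y \<in> lists X \<Longrightarrow> linear_on V Z (\<lambda>a. F a x y)"
  shows "linear_on V Z (\<lambda>a. cuts (F a) w)"
  unfolding cuts_def
  by (intro linear_on_sum_fun assms(1,3)) (simp_all add: take_drop_in_lists assms(2))

lemma linear_on_letters_fun:
  assumes "vector_space (smul Z)" "w \<in> lists X"
    and "\<And>x b y. x \<in> lists X \<Longrightarrow> b \<in> X \<Longrightarrow> y \<in> lists X \<Longrightarrow> linear_on V Z (\<lambda>a. F a x b y)"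
  shows "linear_on V Z (\<lambda>a. letters (F a) w)"
  unfolding letters_def
  by (intro linear_on_sum_fun assms(1,3)) (simp_all add: take_drop_in_lists assms(2))

lemma cuts_in_carr:
  assumes "vector_space (smul Z)" "w \<in> lists X"
    and "\<And>x y. x \<in> lists X \<Longrightarrow> y \<in> lists X \<Longrightarrow> F x y \<in> carr Z"
  shows "cuts F w \<in> carr Z"
  unfolding cuts_def
  by (intro carr_closed(5) assms(1,3)) (simp_all add: take_drop_in_lists assms(2))

lemma letters_in_carr:
  assumes "vector_space (smul Z)" "w \<in> lists X"
    and "\<And>x b y. x \<in> lists X \<Longrightarrow> b \<in> X \<Longrightarrow> y \<in> lists X \<Longrightarrow> F x b y \<in> carr Z"
  shows "letters F w \<in> carr Z"
  unfolding letters_def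
  by (intro carr_closed(5) assms(1,3)) (simp_all add: take_drop_in_lists assms(2))

lemma linear_on_cuts:
  assumes "vector_space (smul W)" "vector_space (smul Z)" "linear_on W Z h" "w \<in> lists X"
    and "\<And>x y. x \<in> lists X \<Longrightarrow> y \<in> lists X \<Longrightarrow> F x y \<in> carr W"
  shows "h (cuts F w) = cuts (\<lambda>x y. h (F x y)) w"
  unfolding cuts_def
  by (intro linear_on_sum[OF assms(1-3)] assms(5))
    (simp_all add: take_drop_in_lists assms(4))

lemma linear_on_letters:
  assumes "vector_space (smul W)" "vector_space (smul Z)" "linear_on W Z h" "w \<in> lists X"
    and "\<And>x b y. x \<in> lists X \<Longrightarrow> b \<in> X \<Longrightarrow> y \<in> lists X \<Longrightarrow> F x b y \<in> carr W"
  shows "h (letters F w) = letters (\<lambda>x b y. h (F x b y)) w"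
  unfolding letters_def
  by (intro linear_on_sum[OF assms(1-3)] assms(5))
    (simp_all add: take_drop_in_lists assms(4))

lemma cuts_zero: "cuts (\<lambda>x y. 0) w = 0"
  by (simp add: cuts_def)

lemma letters_zero: "letters (\<lambda>x a y. 0) w = 0"
  by (simp add: letters_def)

lemma cuts_right_empty: "cuts (\<lambda>x y. if y = [] then G x else 0) w = G w"
  by (induction w arbitrary: G) (simp_all add: cuts_Cons)

lemma cuts_left_empty: "cuts (\<lambda>x y. if x = [] then G y else 0) w = G w"
  by (cases w) (simp_all add: cuts_Cons cuts_zero)

lemma cuts_letters_sum:
  "cuts (\<lambda>p q. letters (F p) q) w = (\<Sum>(i, j)\<in>{(i, j). i + j + 1 \<le> length w}.
     F (take i w) (take j (drop i w)) (w ! (i + j)) (drop (i + j + 1) w))"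
proof -
  have "{(i, j). i + j + 1 \<le> length w} = Sigma {..length w} (\<lambda>i. {..<length w - i})" by auto
  then show ?thesis
    by (simp add: cuts_def letters_def sum.Sigma[symmetric] add.commute)
qed

lemma letters_cuts_sum:
  "cuts (\<lambda>p q. letters (\<lambda>x a y. F x a y q) p) w = (\<Sum>(i, j)\<in>{(i, j). i + j + 1 \<le> length w}.
     F (take i w) (w ! i) (take j (drop (i + 1) w)) (drop (i + j + 1) w))"
proof -
  have "{(i, j). i + j + 1 \<le> length w} = Sigma {..<length w} (\<lambda>i. {..length w - Suc i})" by auto
  moreover have "cuts (\<lambda>p q. letters (\<lambda>x a y. F x a y q) p) w =
      letters (\<lambda>x a u. cuts (\<lambda>y q. F x a y q) u) w"
    by (rule letters_cuts_right[symmetric])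
  ultimately show ?thesis
    by (simp add: cuts_def letters_def sum.Sigma[symmetric] add.commute)
qed

section \<open>Maps of tensor products\<close>

text \<open>The Koszul sign is implemented by a linear map \<open>s\<close> on the first factor, which is \<open>(-1)\<^sup>q\<^sup>i\<close> in degree \<open>i\<close>; so
  the value on pure tensors is given without a condition of homogeneity.\<close>

lemma tensor_map:
  fixes V :: "('k::field, 'v::ab_group_add) gspace"
  assumes V: "vector_space (smul V)" and W: "vector_space (smul W)"
    and V': "vector_space (smul V')" and W': "vector_space (smul W')"
    and f: "linear_on V V' f" and g: "linear_on W W' g" and s: "linear_on V V s"
    and sq: "\<And>i x. x \<in> gr V i \<Longrightarrow> s x = smul V (sgnp (q * i)) x"
  shows "linear_on (tensor V W) (tensor V' W') (tensor_map V W V' W' f q g)" (is "linear_on _ _ ?M")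
    "x \<in> carr V \<Longrightarrow> y \<in> carr W \<Longrightarrow>
      tensor_map V W V' W' f q g (tns V W x y) = tns V' W' (f (s x)) (g y)"
proof -
  note fs = linear_on_compose[OF s f]
  have fsc: "f (s x) \<in> carr V'" if "x \<in> carr V" for x using linear_onD(1)[OF fs that] .
  have gc: "g y \<in> carr W'" if "y \<in> carr W" for y using linear_onD(1)[OF g that] .
  have "bilinear_map V W (tensor V' W') (\<lambda>x y. tns V' W' (f (s x)) (g y))"
    using linear_on_compose[OF fs linear_on_tns(1)[OF V' W']]
      linear_on_compose[OF g linear_on_tns(2)[OF V' W']] fsc gc
    by (intro bilinear_mapI) simp_all
  from tensor_universal[OF V W _ this] obtain T where T: "T \<in> lin (tensor V W) (tensor V' W')"
    "\<And>x y. x \<in> carr V \<Longrightarrow> y \<in> carr W \<Longrightarrow> T (tns V W x y) = tns V' W' (f (s x)) (g y)" by auto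
  have T_gr: "T (tns V W x y) = fscale (sgnp (q * i)) (tns V' W' (f x) (g y))"
    if "x \<in> gr V i" "y \<in> carr W" for x y i
    using that carr_closed(6)[OF V that(1)] linear_onD[OF f]
    by (simp add: T sq tns_bilinear(3)[where x' = 0 and y' = 0] gc carr_closed(1)[OF V'] carr_closed(1)[OF W'])
  have "?M = T"
    unfolding tensor_map_def
  proof (rule the_equality)
    fix T' assume T': "T' \<in> lin (tensor V W) (tensor V' W') \<and> (\<forall>i. \<forall>x\<in>gr V i. \<forall>y\<in>carr W.
      T' (tns V W x y) = fscale (sgnp (q * i)) (tns V' W' (f x) (g y)))"
    have "T' (tns V W x y) = T (tns V W x y)" if x: "x \<in> carr V" and y: "y \<in> carr W" for x y
    proof (rule linear_on_eq_span[where S = "\<Union>i. gr V i", OF V _ _ _ _ _ x])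
      show "linear_on V (tensor V' W') (\<lambda>x. T' (tns V W x y))" "linear_on V (tensor V' W') (\<lambda>x. T (tns V W x y))"
        using linear_on_compose[OF linear_on_tns(1)[OF V W y]] T' T(1) lin_linear_on by blast+
    qed (use T' T_gr y in \<open>auto simp: carr_def\<close>)
    then show "T' = T"
      using T' T(1) carr_tensor[OF V W]
      by (intro lin_eqI[where S = "(\<lambda>(x, y). tns V W x y) ` (carr V \<times> carr W)"]) auto
  qed (use T(1) T_gr in blast)
  then show "linear_on (tensor V W) (tensor V' W') ?M"
    "x \<in> carr V \<Longrightarrow> y \<in> carr W \<Longrightarrow> ?M (tns V W x y) = tns V' W' (f (s x)) (g y)"
    using T lin_linear_on by auto
qed

lemma tensor_map_0:
  assumes "vector_space (smul V)" "vector_space (smul W)" "vector_space (smul V')" "vector_space (smul W')"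
    and "linear_on V V' f" "linear_on W W' g"
  shows "linear_on (tensor V W) (tensor V' W') (tensor_map V W V' W' f 0 g)"
    "x \<in> carr V \<Longrightarrow> y \<in> carr W \<Longrightarrow> tensor_map V W V' W' f 0 g (tns V W x y) = tns V' W' (f x) (g y)"
proof -
  interpret vector_space "smul V" by fact
  show "linear_on (tensor V W) (tensor V' W') (tensor_map V W V' W' f 0 g)"
    "x \<in> carr V \<Longrightarrow> y \<in> carr W \<Longrightarrow> tensor_map V W V' W' f 0 g (tns V W x y) = tns V' W' (f x) (g y)"
    using tensor_map[OF assms linear_on_id, of 0] by (simp_all add: sgnp_def)
qed

lemma tensor_eqI:
  assumes "vector_space (smul V)" "vector_space (smul W)" "vector_space (smul Z)"
    and "linear_on (tensor V W) Z f" "linear_on (tensor V W) Z g"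
    and "\<And>x y. x \<in> carr V \<Longrightarrow> y \<in> carr W \<Longrightarrow> f (tns V W x y) = g (tns V W x y)"
    and "t \<in> carr (tensor V W)"
  shows "f t = g t"
proof (rule linear_on_eq_span[OF _ assms(3-5) _ _ assms(7)])
  show "carr (tensor V W) =
      module.span (smul (tensor V W)) ((\<lambda>(x, y). tns V W x y) ` (carr V \<times> carr W))"
    by (simp add: carr_tensor[OF assms(1,2)])
qed (use assms(6) in auto)

lemma linear_on_tns_word:
  assumes "linear_on V (Diass V) f" "y \<in> carr (Diass V)"
  shows "linear_on V (tensor (Diass V) (Diass V)) (\<lambda>a. tns (Diass V) (Diass V) (f a) y)"
    "linear_on V (tensor (Diass V) (Diass V)) (\<lambda>a. tns (Diass V) (Diass V) y (f a))"
  using linear_on_compose[OF assms(1) linear_on_tns(1)[OF _ _ assms(2)]]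
    linear_on_compose[OF assms(1) linear_on_tns(2)[OF _ _ assms(2)]] by simp_all

lemma tns_zero:
  assumes "vector_space (smul V)" "vector_space (smul W)" "x \<in> carr V" "y \<in> carr W"
  shows "tns V W x 0 = 0" "tns V W 0 y = 0"
  using linear_on_0[OF assms(2) _ linear_on_tns(2)[OF assms(1-3)]]
    linear_on_0[OF assms(1) _ linear_on_tns(1)[OF assms(1,2,4)]] by simp_all

section \<open>The coproducts and the cogenerators\<close>

text \<open>The linear map on the free diassociative coalgebra with prescribed values \<open>F\<close> on marked words.  It is
  meaningful if \<open>F\<close> is linear in every letter.\<close>

definition Diass_lift :: "('k::field, 'v::ab_group_add) gspace \<Rightarrow> ('k, 'z::ab_group_add) gspace \<Rightarrow>
    ('v list \<Rightarrow> 'v \<Rightarrow> 'v list \<Rightarrow> 'z) \<Rightarrow> ('k, 'v) diass \<Rightarrow> 'z" where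
  "Diass_lift V Z F = (THE T. T \<in> lin (Diass V) Z \<and>
     (\<forall>vs\<in>lists (carr V). \<forall>v\<in>carr V. \<forall>ws\<in>lists (carr V). T (mword V vs v ws) = F vs v ws))"

lemma Diass_lift:
  assumes "vector_space (smul V)" "vector_space (smul Z)" "marked_multilinear V Z F"
  shows "Diass_lift V Z F \<in> lin (Diass V) Z"
    "vs \<in> lists (carr V) \<Longrightarrow> v \<in> carr V \<Longrightarrow> ws \<in> lists (carr V) \<Longrightarrow>
      Diass_lift V Z F (mword V vs v ws) = F vs v ws"
  using theI'[OF Diass_universal[OF assms]] unfolding Diass_lift_def by blast+

lemma Diass_lift_cong:
  assumes "\<And>vs v ws. vs \<in> lists (carr V) \<Longrightarrow> v \<in> carr V \<Longrightarrow> ws \<in> lists (carr V) \<Longrightarrow> F vs v ws = G vs v ws"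
  shows "Diass_lift V Z F = Diass_lift V Z G"
  unfolding Diass_lift_def using assms by (simp cong: conj_cong)

text \<open>The sum of all marked words with underlying word \<open>w\<close>.\<close>

definition mark_sum :: "('k::field, 'v::ab_group_add) gspace \<Rightarrow> 'v list \<Rightarrow> ('k, 'v) diass" where
  "mark_sum V w = letters (mword V) w"

text \<open>The coalgebra structure uses only that the ambient type of \<open>V\<close> is a vector space; independence of the
  homogeneous components is needed later, for the parity operator.\<close>

locale vector_gspace =
  fixes V :: "('k::field, 'v::ab_group_add) gspace"
  assumes V: "vector_space (smul V)"
begin

abbreviation (input) "words \<equiv> lists (carr V)"

abbreviation (input) "C \<equiv> Diass V"
abbreviation (input) "CC \<equiv> tensor (Diass V) (Diass V)"
abbreviation (input) "tn \<equiv> tns (Diass V) (Diass V)"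
abbreviation (input) "tmap f g \<equiv> tensor_map (Diass V) (Diass V) (Diass V) (Diass V) f 0 g"

lemma mark_sum_in_carr: "w \<in> words \<Longrightarrow> mark_sum V w \<in> carr C"
  unfolding mark_sum_def by (rule letters_in_carr[where X = "carr V"]) (simp_all add: V)

lemma linear_on_letters_word:
  assumes Z: "vector_space (smul Z)" and F: "marked_multilinear V Z F" and "linear_word V L"
  shows "linear_on V Z (\<lambda>a. letters F (L a))"
proof -
  obtain us ws h where L: "us \<in> words" "ws \<in> words" "linear_on V V h"
    "\<And>a. L a = us @ h a # ws" using assms(3) unfolding linear_word_def by blast
  show ?thesis
    unfolding L(4) letters_append letters_Cons append_Nil2
    using L(1-3)
    by (intro linear_on_add linear_on_letters_fun[where X = "carr V"] marked_multilinearD[OF F] Z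
        linear_word_intros) simp_all
qed

lemma linear_on_mark_sum:
  "linear_word V L \<Longrightarrow> linear_on V C (\<lambda>a. mark_sum V (L a))"
  unfolding mark_sum_def by (rule linear_on_letters_word[OF _ mword_multilinear[OF V]]) simp

lemma coprod1_multilinear:
  "marked_multilinear V CC (\<lambda>vs v ws. cuts (\<lambda>p q. tn (mword V vs v p) (mark_sum V q)) ws)"
  by (rule marked_multilinearI; (unfold cuts_append_Cons)?)
    (intro linear_on_add linear_on_cuts_fun[where X = "carr V"] linear_on_tns_word linear_on_mword
      linear_on_mark_sum linear_word_intros mark_sum_in_carr mword_in_carr V | simp)+

lemma coprod2_multilinear:
  "marked_multilinear V CC (\<lambda>vs v ws. cuts (\<lambda>p q. tn (mark_sum V p) (mword V q v ws)) vs)"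
  by (rule marked_multilinearI; (unfold cuts_append_Cons)?)
    (intro linear_on_add linear_on_cuts_fun[where X = "carr V"] linear_on_tns_word linear_on_mword
      linear_on_mark_sum linear_word_intros mark_sum_in_carr mword_in_carr V | simp)+

lemma tns_mark_sum:
  assumes "x \<in> carr C" "w \<in> words"
  shows "tn x (mark_sum V w) = letters (\<lambda>p a q. tn x (mword V p a q)) w"
    "tn (mark_sum V w) x = letters (\<lambda>p a q. tn (mword V p a q) x) w"
  unfolding mark_sum_def
  by (rule linear_on_letters[OF _ _ linear_on_tns(2)[OF _ _ assms(1)] assms(2)]; simp add: V)
    (rule linear_on_letters[OF _ _ linear_on_tns(1)[OF _ _ assms(1)] assms(2)]; simp add: V)

lemma coprod1_eq:
  "coprod1 V = Diass_lift V CC (\<lambda>vs v ws. cuts (\<lambda>p q. tn (mword V vs v p) (mark_sum V q)) ws)"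
proof -
  have "coprod1 V = Diass_lift V CC (\<lambda>vs v ws. \<Sum>(i, j)\<in>{(i, j). i + j + 1 \<le> length ws}.
           tns (Diass V) (Diass V) (mword V vs v (take i ws))
             (mword V (take j (drop i ws)) (ws ! (i + j)) (drop (i + j + 1) ws)))"
    unfolding coprod1_def Diass_lift_def ..
  also have "\<dots> = Diass_lift V CC (\<lambda>vs v ws. cuts (\<lambda>p q. tn (mword V vs v p) (mark_sum V q)) ws)"
  proof (rule Diass_lift_cong)
    fix vs v ws assume *: "vs \<in> words" "v \<in> carr V" "ws \<in> words"
    have "cuts (\<lambda>p q. tn (mword V vs v p) (mark_sum V q)) ws =
        cuts (\<lambda>p q. letters (\<lambda>x a y. tn (mword V vs v p) (mword V x a y)) q) ws"
      by (rule cuts_cong_lists[OF *(3)]) (simp add: tns_mark_sum V *)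
    then show "(\<Sum>(i, j)\<in>{(i, j). i + j + 1 \<le> length ws}.
           tns (Diass V) (Diass V) (mword V vs v (take i ws))
             (mword V (take j (drop i ws)) (ws ! (i + j)) (drop (i + j + 1) ws))) =
        cuts (\<lambda>p q. tn (mword V vs v p) (mark_sum V q)) ws"
      by (simp add: cuts_letters_sum)
  qed
  finally show ?thesis .
qed

lemma coprod2_eq:
  "coprod2 V = Diass_lift V CC (\<lambda>vs v ws. cuts (\<lambda>p q. tn (mark_sum V p) (mword V q v ws)) vs)"
proof -
  have "coprod2 V = Diass_lift V CC (\<lambda>vs v ws. \<Sum>(i, j)\<in>{(i, j). i + j + 1 \<le> length vs}.
           tns (Diass V) (Diass V) (mword V (take i vs) (vs ! i) (take j (drop (i + 1) vs)))
             (mword V (drop (i + j + 1) vs) v ws))"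
    unfolding coprod2_def Diass_lift_def ..
  also have "\<dots> = Diass_lift V CC (\<lambda>vs v ws. cuts (\<lambda>p q. tn (mark_sum V p) (mword V q v ws)) vs)"
  proof (rule Diass_lift_cong)
    fix vs v ws assume *: "vs \<in> words" "v \<in> carr V" "ws \<in> words"
    have "cuts (\<lambda>p q. tn (mark_sum V p) (mword V q v ws)) vs =
        cuts (\<lambda>p q. letters (\<lambda>x a y. tn (mword V x a y) (mword V q v ws)) p) vs"
      by (rule cuts_cong_lists[OF *(1)]) (simp add: tns_mark_sum V *)
    then show "(\<Sum>(i, j)\<in>{(i, j). i + j + 1 \<le> length vs}.
           tns (Diass V) (Diass V) (mword V (take i vs) (vs ! i) (take j (drop (i + 1) vs)))
             (mword V (drop (i + j + 1) vs) v ws)) =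
        cuts (\<lambda>p q. tn (mark_sum V p) (mword V q v ws)) vs"
      by (simp add: letters_cuts_sum)
  qed
  finally show ?thesis .
qed

lemma coprod1:
  "linear_on C CC (coprod1 V)"
  "vs \<in> words \<Longrightarrow> v \<in> carr V \<Longrightarrow> ws \<in> words \<Longrightarrow>
    coprod1 V (mword V vs v ws) = cuts (\<lambda>p q. tn (mword V vs v p) (mark_sum V q)) ws"
  using Diass_lift[OF V _ coprod1_multilinear] by (simp_all add: coprod1_eq lin_linear_on)

lemma coprod2:
  "linear_on C CC (coprod2 V)"
  "vs \<in> words \<Longrightarrow> v \<in> carr V \<Longrightarrow> ws \<in> words \<Longrightarrow>
    coprod2 V (mword V vs v ws) = cuts (\<lambda>p q. tn (mark_sum V p) (mword V q v ws)) vs"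
  using Diass_lift[OF V _ coprod2_multilinear] by (simp_all add: coprod2_eq lin_linear_on)

lemma proj_multilinear:
  "marked_multilinear V V (\<lambda>vs v ws. if vs = [] \<and> ws = [] then v else 0)"
proof (rule marked_multilinearI)
  show "linear_on V V (\<lambda>a. if vs = [] \<and> ws = [] then a else 0)" for vs ws
    by (cases "vs = [] \<and> ws = []") (auto simp: linear_on_id linear_on_zero V)
qed (simp_all add: linear_on_zero V)

lemma proj:
  "linear_on C V (proj V)"
  "vs \<in> words \<Longrightarrow> v \<in> carr V \<Longrightarrow> ws \<in> words \<Longrightarrow>
    proj V (mword V vs v ws) = (if vs = [] \<and> ws = [] then v else 0)"
  using Diass_lift[OF V V proj_multilinear] by (simp_all add: Diass_lift_def proj_def lin_linear_on)

lemma proj_mark_sum: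
  assumes "w \<in> words"
  shows "proj V (mark_sum V w) = (case w of [a] \<Rightarrow> a | _ \<Rightarrow> 0)"
proof -
  have "proj V (mark_sum V w) = letters (\<lambda>x a y. proj V (mword V x a y)) w"
    unfolding mark_sum_def by (rule linear_on_letters[OF _ V proj(1) assms]) (simp_all add: V)
  also have "\<dots> = letters (\<lambda>x a y. if x = [] \<and> y = [] then a else 0) w"
    by (rule letters_cong_lists[OF assms]) (simp add: proj)
  also have "\<dots> = (case w of [a] \<Rightarrow> a | _ \<Rightarrow> 0)"
    by (auto simp: letters_Cons letters_zero split: list.split)
  finally show ?thesis .
qed


text \<open>The two coproducts together recover a marked word of length at least two: if the marked letter
  is not the last one, cutting off the last letter by \<open>coprod1\<close> can be undone, and otherwise
  cutting off the first letter by \<open>coprod2\<close> can be undone.\<close>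

lemma coprod_kernel:
  assumes x: "x \<in> carr C" and "coprod1 V x = 0" "coprod2 V x = 0" "proj V x = 0"
  shows "x = 0"
proof -
  have snoc: "marked_multilinear V C (\<lambda>vs v ws. mword V vs v (ws @ [a]))" if "a \<in> carr V" for a
    by (rule marked_multilinearI)
      (use that in \<open>intro linear_on_mword V linear_word_intros; simp; fail\<close>)+
  \<comment> \<open>\<open>S a\<close> appends the letter \<open>a\<close> to a marked word.\<close>
  define S where "S a = Diass_lift V C (\<lambda>vs v ws. mword V vs v (ws @ [a]))" for a
  note S = Diass_lift[OF V _ snoc, folded S_def]
  have cons: "marked_multilinear V C (\<lambda>vs v ws. if ws = [] then mword V (a # vs) v [] else 0)"
    if a: "a \<in> carr V" for a
  proof (rule marked_multilinearI)
    fix vs ws assume "vs \<in> words" "ws \<in> words"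
    then have "linear_on V C (\<lambda>b. mword V (a # vs) b [])"
      using a by (intro linear_on_mword V linear_word_intros) simp_all
    then show "linear_on V C (\<lambda>b. if ws = [] then mword V (a # vs) b [] else 0)"
      by (cases ws) (simp_all add: linear_on_zero)
  next
    fix us us' v ws assume "us \<in> words" "us' \<in> words" "v \<in> carr V" "ws \<in> words"
    then have "linear_on V C (\<lambda>b. mword V (a # us @ b # us') v [])"
      using a by (intro linear_on_mword V linear_word_intros) simp_all
    then show "linear_on V C (\<lambda>b. if ws = [] then mword V (a # us @ b # us') v [] else 0)"
      by (cases ws) (simp_all add: linear_on_zero)
  qed (simp_all add: linear_on_zero)
  \<comment> \<open>\<open>P a\<close> prepends the letter \<open>a\<close> to the marked words that end in the marked letter, and kills the others.\<close>
  define P where "P a = Diass_lift V C (\<lambda>vs v ws. if ws = [] then mword V (a # vs) v [] else 0)" for a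
  note P = Diass_lift[OF V _ cons, folded P_def]
  have Sa: "linear_on V C (\<lambda>a. S a y)" and Pa: "linear_on V C (\<lambda>a. P a y)" if y: "y \<in> carr C" for y
  proof -
    show "linear_on V C (\<lambda>a. S a y)"
    proof (rule linear_on_parameter[OF _ _ _ carr_Diass[OF V] _ V y])
      fix s assume "s \<in> {mword V vs v ws |vs v ws. vs \<in> words \<and> v \<in> carr V \<and> ws \<in> words}"
      then obtain vs v ws where s: "s = mword V vs v ws"
        "vs \<in> words" "v \<in> carr V" "ws \<in> words" by blast
      then have "linear_on V C (\<lambda>a. mword V vs v (ws @ [a]))"
        by (intro linear_on_mword V linear_word_intros) simp_all
      then show "linear_on V C (\<lambda>a. S a s)"
        by (subst linear_on_cong[where g = "\<lambda>a. mword V vs v (ws @ [a])"]) (simp_all add: S s V)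
    qed (simp_all add: S lin_linear_on)
    show "linear_on V C (\<lambda>a. P a y)"
    proof (rule linear_on_parameter[OF _ _ _ carr_Diass[OF V] _ V y])
      fix s assume "s \<in> {mword V vs v ws |vs v ws. vs \<in> words \<and> v \<in> carr V \<and> ws \<in> words}"
      then obtain vs v ws where s: "s = mword V vs v ws"
        "vs \<in> words" "v \<in> carr V" "ws \<in> words" by blast
      then have "linear_on V C (\<lambda>a. mword V (a # vs) v [])"
        by (intro linear_on_mword V linear_word_intros) simp_all
      then have "linear_on V C (\<lambda>a. if ws = [] then mword V (a # vs) v [] else 0)"
        by (cases ws) (simp_all add: linear_on_zero)
      then show "linear_on V C (\<lambda>a. P a s)"
        by (subst linear_on_cong[where g = "\<lambda>a. if ws = [] then mword V (a # vs) v [] else 0"])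
          (simp_all add: P s V)
    qed (simp_all add: P lin_linear_on)
  qed
  have S0: "S 0 y = 0" and P0: "P 0 y = 0" if "y \<in> carr C" for y
    using linear_on_0[OF V _ Sa[OF that]] linear_on_0[OF V _ Pa[OF that]] by simp_all
  have prc: "proj V y \<in> carr V" if "y \<in> carr C" for y using linear_onD(1)[OF proj(1) that] .
  have "bilinear_map C C C (\<lambda>x y. S (proj V y) x)"
    by (rule bilinear_mapI)
      (simp_all add: S prc lin_linear_on linear_on_compose[OF proj(1) Sa])
  \<comment> \<open>The projection kills \<open>mark_sum V q\<close> unless \<open>q\<close> is a single letter, so only one cut contributes.\<close>
  from tensor_universal[OF _ _ _ this] obtain L1 where L1: "L1 \<in> lin CC C"
    "\<And>x y. x \<in> carr C \<Longrightarrow> y \<in> carr C \<Longrightarrow> L1 (tn x y) = S (proj V y) x" by auto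
  have "bilinear_map C C C (\<lambda>x y. P (proj V x) y)"
    by (rule bilinear_mapI)
      (simp_all add: P prc lin_linear_on linear_on_compose[OF proj(1) Pa])
  from tensor_universal[OF _ _ _ this] obtain L2 where L2: "L2 \<in> lin CC C"
    "\<And>x y. x \<in> carr C \<Longrightarrow> y \<in> carr C \<Longrightarrow> L2 (tn x y) = P (proj V x) y" by auto
  note lin = lin_linear_on[OF L1(1)] lin_linear_on[OF L2(1)]
  have L1': "L1 (coprod1 V (mword V vs v ws)) = (if ws = [] then 0 else mword V vs v ws)"
    if w: "vs \<in> words" "v \<in> carr V" "ws \<in> words" for vs v ws
  proof -
    have "L1 (coprod1 V (mword V vs v ws)) = cuts (\<lambda>p q. L1 (tn (mword V vs v p) (mark_sum V q))) ws"
      unfolding coprod1(2)[OF w]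
      by (rule linear_on_cuts[OF _ _ lin(1) w(3)])
        (simp_all add: V w mark_sum_in_carr tns_in_carr)
    also have "\<dots> = cuts (\<lambda>p q. case q of [a] \<Rightarrow> mword V vs v (p @ [a]) | _ \<Rightarrow> 0) ws"
      by (rule cuts_cong_lists[OF w(3)])
        (auto simp: L1 V w mark_sum_in_carr proj_mark_sum S S0 split: list.split)
    also have "\<dots> = (if ws = [] then 0 else mword V vs v ws)"
    proof (cases ws rule: rev_exhaust)
      case (snoc us a)
      have "cuts (\<lambda>p q. case q @ [a] of [a] \<Rightarrow> mword V vs v (p @ [a]) | _ \<Rightarrow> 0) us =
          cuts (\<lambda>p q. if q = [] then mword V vs v (p @ [a]) else 0) us"
        by (intro arg_cong[where f = "\<lambda>F. cuts F us"] ext) (auto split: list.split)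
      then show ?thesis by (simp add: snoc cuts_append_Cons cuts_right_empty)
    qed simp
    finally show ?thesis .
  qed
  have L2': "L2 (coprod2 V (mword V vs v ws)) = (if vs \<noteq> [] \<and> ws = [] then mword V vs v ws else 0)"
    if w: "vs \<in> words" "v \<in> carr V" "ws \<in> words" for vs v ws
  proof -
    have "L2 (coprod2 V (mword V vs v ws)) = cuts (\<lambda>p q. L2 (tn (mark_sum V p) (mword V q v ws))) vs"
      unfolding coprod2(2)[OF w]
      by (rule linear_on_cuts[OF _ _ lin(2) w(1)])
        (simp_all add: V w mark_sum_in_carr tns_in_carr)
    also have "\<dots> = cuts (\<lambda>p q. case p of [a] \<Rightarrow> if ws = [] then mword V (a # q) v [] else 0 | _ \<Rightarrow> 0) vs"
      by (rule cuts_cong_lists[OF w(1)])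
        (auto simp: L2 V w mark_sum_in_carr proj_mark_sum P P0 split: list.split)
    also have "\<dots> = (if vs \<noteq> [] \<and> ws = [] then mword V vs v ws else 0)"
    proof (cases vs)
      case (Cons a us)
      have "cuts (\<lambda>p q. case a # p of [a] \<Rightarrow> if ws = [] then mword V (a # q) v [] else 0 | _ \<Rightarrow> 0) us =
          cuts (\<lambda>p q. if p = [] then if ws = [] then mword V (a # q) v [] else 0 else 0) us"
        by (intro arg_cong[where f = "\<lambda>F. cuts F us"] ext) (auto split: list.split)
      then show ?thesis
        by (simp add: Cons cuts_Cons cuts_left_empty[of "\<lambda>q. if ws = [] then mword V (a # q) v [] else 0"])
    qed simp
    finally show ?thesis .
  qed
  have "x = L1 (coprod1 V x) + L2 (coprod2 V x) + mword V [] (proj V x) []"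
  proof (rule Diass_eqI[where f = "\<lambda>x. x" and
        g = "\<lambda>x. L1 (coprod1 V x) + L2 (coprod2 V x) + mword V [] (proj V x) []", OF V _ linear_on_id _ _ x])
    show "linear_on C C (\<lambda>x. L1 (coprod1 V x) + L2 (coprod2 V x) + mword V [] (proj V x) [])"
      by (intro linear_on_add linear_on_compose[OF coprod1(1) lin(1)]
          linear_on_compose[OF coprod2(1) lin(2)] linear_on_compose[OF proj(1)]
          linear_on_mword V linear_word_intros) simp_all
    have "mword V [] 0 [] = 0"
      by (rule linear_on_0[OF V _ linear_on_mword(1)[OF V linear_on_id]]) simp_all
    then show "mword V vs v ws = L1 (coprod1 V (mword V vs v ws)) + L2 (coprod2 V (mword V vs v ws)) +
        mword V [] (proj V (mword V vs v ws)) []"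
      if w: "vs \<in> words" "v \<in> carr V" "ws \<in> words" for vs v ws
      by (simp add: L1'[OF w] L2'[OF w] proj(2)[OF w])
  qed simp
  also have "mword V [] 0 [] = 0"
    by (rule linear_on_0[OF V _ linear_on_mword(1)[OF V linear_on_id]]) simp_all
  then have "L1 (coprod1 V x) + L2 (coprod2 V x) + mword V [] (proj V x) [] = 0"
    by (simp add: assms(2-4) linear_on_0[OF _ _ lin(1)] linear_on_0[OF _ _ lin(2)])
  finally show ?thesis .
qed

lemma tmap:
  assumes "linear_on C C f" "linear_on C C g"
  shows "linear_on CC CC (tmap f g)"
    "x \<in> carr C \<Longrightarrow> y \<in> carr C \<Longrightarrow> tmap f g (tn x y) = tn (f x) (g y)"
  using tensor_map_0[OF _ _ _ _ assms] by simp_all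

lemma tmap_coprod:
  assumes f: "linear_on C C f" and g: "linear_on C C g"
    and w: "vs \<in> words" "v \<in> carr V" "ws \<in> words"
  shows "tmap f g (coprod1 V (mword V vs v ws)) =
      cuts (\<lambda>p q. tn (f (mword V vs v p)) (g (mark_sum V q))) ws"
    "tmap f g (coprod2 V (mword V vs v ws)) =
      cuts (\<lambda>p q. tn (f (mark_sum V p)) (g (mword V q v ws))) vs"
proof -
  have "tmap f g (coprod1 V (mword V vs v ws)) =
      cuts (\<lambda>p q. tmap f g (tn (mword V vs v p) (mark_sum V q))) ws"
    unfolding coprod1(2)[OF w]
    by (rule linear_on_cuts[OF _ _ tmap(1)[OF f g] w(3)])
      (simp_all add: V w mark_sum_in_carr tns_in_carr)
  also have "\<dots> = cuts (\<lambda>p q. tn (f (mword V vs v p)) (g (mark_sum V q))) ws"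
    by (rule cuts_cong_lists[OF w(3)]) (simp add: V w mark_sum_in_carr tmap(2)[OF f g])
  finally show "tmap f g (coprod1 V (mword V vs v ws)) =
      cuts (\<lambda>p q. tn (f (mword V vs v p)) (g (mark_sum V q))) ws" .
  have "tmap f g (coprod2 V (mword V vs v ws)) =
      cuts (\<lambda>p q. tmap f g (tn (mark_sum V p) (mword V q v ws))) vs"
    unfolding coprod2(2)[OF w]
    by (rule linear_on_cuts[OF _ _ tmap(1)[OF f g] w(1)])
      (simp_all add: V w mark_sum_in_carr tns_in_carr)
  also have "\<dots> = cuts (\<lambda>p q. tn (f (mark_sum V p)) (g (mword V q v ws))) vs"
    by (rule cuts_cong_lists[OF w(1)]) (simp add: V w mark_sum_in_carr tmap(2)[OF f g])
  finally show "tmap f g (coprod2 V (mword V vs v ws)) =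
      cuts (\<lambda>p q. tn (f (mark_sum V p)) (g (mword V q v ws))) vs" .
qed

lemma cuts_zero_strict:
  assumes "w \<in> lists X"
    and "\<And>x y. x \<in> lists X \<Longrightarrow> y \<in> lists X \<Longrightarrow> w = x @ y \<Longrightarrow> F x y = 0"
  shows "cuts F w = 0"
  unfolding cuts_def using assms(1)
  by (intro sum.neutral ballI assms(2)) (auto simp: in_lists_conv_set dest: in_set_takeD in_set_dropD)

lemma letters_zero_strict:
  assumes "w \<in> lists X"
    and "\<And>x a y. x \<in> lists X \<Longrightarrow> a \<in> X \<Longrightarrow> y \<in> lists X \<Longrightarrow> w = x @ a # y \<Longrightarrow> F x a y = 0"
  shows "letters F w = 0"
  unfolding letters_def using assms(1)
  by (intro sum.neutral ballI assms(2))
    (auto simp: in_lists_conv_set id_take_nth_drop[symmetric] dest: in_set_takeD in_set_dropD)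

text \<open>The induction is on the length of the word: both coproducts of a marked word are sums of tensors of shorter
  words, since \<open>mark_sum V []\<close> is zero.  The map \<open>\<rho>\<close> on the first factor is arbitrary; it
  is the parity operator for coderivations of odd degree and the identity for their squares.\<close>

lemma coderivation_unique:
  assumes E: "linear_on C C E" and \<rho>: "linear_on C C \<rho>"
    and co1: "\<And>x. x \<in> carr C \<Longrightarrow>
      coprod1 V (E x) = tmap \<rho> E (coprod1 V x) + tmap E (\<lambda>x. x) (coprod1 V x)"
    and co2: "\<And>x. x \<in> carr C \<Longrightarrow>
      coprod2 V (E x) = tmap \<rho> E (coprod2 V x) + tmap E (\<lambda>x. x) (coprod2 V x)"
    and pr: "\<And>vs v ws. vs \<in> words \<Longrightarrow> v \<in> carr V \<Longrightarrow> ws \<in> words \<Longrightarrow>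
      proj V (E (mword V vs v ws)) = 0"
    and x: "x \<in> carr C"
  shows "E x = 0"
proof -
  have *: "E (mword V vs v ws) = 0"
    if "vs \<in> words" "v \<in> carr V" "ws \<in> words" for vs v ws
    using that
  proof (induction "length vs + length ws" arbitrary: vs v ws rule: less_induct)
    case less
    note w = less.prems
    have m: "mword V vs v ws \<in> carr C" by (simp add: V w)
    have Em: "E (mark_sum V q) = 0" if "q \<in> words" "length q \<le> length vs + length ws" for q
    proof -
      have "E (mark_sum V q) = letters (\<lambda>x a y. E (mword V x a y)) q"
        unfolding mark_sum_def by (rule linear_on_letters[OF _ _ E that(1)]) (simp_all add: V)
      also have "\<dots> = 0"
        by (rule letters_zero_strict[OF that(1)]) (use that(2) in \<open>simp add: less.hyps\<close>)
      finally show ?thesis .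
    qed
    have \<rho>c: "\<rho> y \<in> carr C" if "y \<in> carr C" for y using linear_onD(1)[OF \<rho> that] .
    have Ec: "E y \<in> carr C" if "y \<in> carr C" for y using linear_onD(1)[OF E that] .
    have 1: "tn (\<rho> (mword V vs v p)) (E (mark_sum V q)) = 0" "tn (E (mword V vs v p)) (mark_sum V q) = 0"
      if "p \<in> words" "q \<in> words" "ws = p @ q" for p q
    proof -
      show "tn (\<rho> (mword V vs v p)) (E (mark_sum V q)) = 0"
        using that w by (simp add: Em tns_zero[of C C _ 0] \<rho>c V carr_closed(1))
      show "tn (E (mword V vs v p)) (mark_sum V q) = 0"
      proof (cases "q = []")
        case True
        then show ?thesis
          using that w by (simp add: mark_sum_def tns_zero[of C C _ 0] Ec V carr_closed(1))
      next
        case False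
        then have "E (mword V vs v p) = 0" using that w by (intro less.hyps) auto
        then show ?thesis using that by (simp add: tns_zero[of C C 0] mark_sum_in_carr carr_closed(1))
      qed
    qed
    have 2: "tn (\<rho> (mark_sum V p)) (E (mword V q v ws)) = 0" "tn (E (mark_sum V p)) (mword V q v ws) = 0"
      if "p \<in> words" "q \<in> words" "vs = p @ q" for p q
    proof -
      show "tn (E (mark_sum V p)) (mword V q v ws) = 0"
        using that w by (simp add: Em tns_zero[of C C 0] V carr_closed(1))
      show "tn (\<rho> (mark_sum V p)) (E (mword V q v ws)) = 0"
      proof (cases "p = []")
        case True
        then have "\<rho> (mark_sum V p) = 0" using linear_on_0[OF _ _ \<rho>] by (simp add: mark_sum_def)
        then show ?thesis
          using that w by (simp add: tns_zero[of C C 0] Ec V carr_closed(1))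
      next
        case False
        then have "E (mword V q v ws) = 0" using that w by (intro less.hyps) auto
        then show ?thesis using that
          by (simp add: tns_zero[of C C _ 0] \<rho>c mark_sum_in_carr carr_closed(1))
      qed
    qed
    show ?case
    proof (rule coprod_kernel)
      show "E (mword V vs v ws) \<in> carr C" using m by (rule Ec)
      show "proj V (E (mword V vs v ws)) = 0" using w by (rule pr)
      show "coprod1 V (E (mword V vs v ws)) = 0"
        unfolding co1[OF m] tmap_coprod(1)[OF \<rho> E w] tmap_coprod(1)[OF E linear_on_id w]
        by (simp add: cuts_zero_strict[OF w(3) 1(1)] cuts_zero_strict[OF w(3) 1(2)])
      show "coprod2 V (E (mword V vs v ws)) = 0"
        unfolding co2[OF m] tmap_coprod(2)[OF \<rho> E w] tmap_coprod(2)[OF E linear_on_id w]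
        by (simp add: cuts_zero_strict[OF w(1) 2(1)] cuts_zero_strict[OF w(1) 2(2)])
    qed
  qed
  show ?thesis
    by (rule Diass_eqI[OF V _ E linear_on_zero _ x]) (simp_all add: *)
qed

end

section \<open>The parity operator\<close>

lemma sgnp_even: "even e \<Longrightarrow> sgnp e = 1" and sgnp_odd: "odd e \<Longrightarrow> sgnp e = -1"
  by (simp_all add: sgnp_def power_int_minus_left_even power_int_minus_left_odd)

lemma sgnp_eqI: "even (d - e) \<Longrightarrow> sgnp d = sgnp e"
  by (cases "even d") (auto simp: sgnp_even sgnp_odd)

lemma sgnp_add: "sgnp (d + e) = sgnp d * sgnp e"
  by (cases "even d"; cases "even e") (auto simp: sgnp_even sgnp_odd)

lemma sgnp_square [simp]: "sgnp d * sgnp d = 1"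
  by (cases "even d") (auto simp: sgnp_even sgnp_odd)

text \<open>Elements of the span of some homogeneous components are sums of homogeneous elements from these
  components.\<close>

lemma span_components:
  fixes V :: "('k::field, 'v::ab_group_add) gspace"
  assumes V: "graded_vector_space V" and x: "x \<in> module.span (smul V) (\<Union>i\<in>I. gr V i)"
  shows "\<exists>F y. finite F \<and> F \<subseteq> I \<and> (\<forall>i\<in>F. y i \<in> gr V i) \<and> x = sum y F"
proof -
  interpret vector_space "smul V" using V by (simp add: graded_vector_space_def)
  have sub: "subspace (gr V i)" for i using V by (simp add: graded_vector_space_def)
  show ?thesis using x
  proof (induction rule: span_induct_alt)
    case base
    show ?case by (intro exI[of _ "{}"]) simp
  next
    case (step c a t)
    obtain i where i: "i \<in> I" "a \<in> gr V i" using step(1) by blast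
    obtain F y where F: "finite F" "F \<subseteq> I" "\<forall>i\<in>F. y i \<in> gr V i" "t = sum y F" using step(2) by blast
    define y' where "y' j = (if j = i then smul V c a else 0) + (if j \<in> F then y j else 0)" for j
    have "sum y' (insert i F) = smul V c a + t"
      using F(1) unfolding y'_def F(4)
      by (simp only: sum.distrib) (simp add: sum.inter_restrict[symmetric] Int_absorb1 subset_insertI)
    moreover have "\<forall>j\<in>insert i F. y' j \<in> gr V j"
      using F(3) i sub by (auto simp: y'_def intro!: subspace_add subspace_scale subspace_0)
    ultimately show ?case using F(1,2) i(1)
      by (intro exI[of _ "insert i F"] exI[of _ y']) auto
  qed
qed

text \<open>The carrier is the direct sum of its even and its odd part, and the map is \<open>e + d \<mapsto> e - d\<close>.\<close>

lemma parity_exists: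
  fixes V :: "('k::field, 'v::ab_group_add) gspace"
  assumes V: "graded_vector_space V"
  shows "\<exists>t. linear_on V V t \<and> (\<forall>i. \<forall>x\<in>gr V i. t x = smul V (sgnp i) x)"
proof -
  interpret vector_space "smul V" using V by (simp add: graded_vector_space_def)
  let ?E = "span (\<Union>i\<in>{i. even i}. gr V i)" and ?O = "span (\<Union>i\<in>{i. odd i}. gr V i)"
  have EO: "x = 0" if "x \<in> ?E" "x \<in> ?O" for x
  proof -
    obtain F y where F: "finite F" "F \<subseteq> {i. even i}" "\<forall>i\<in>F. y i \<in> gr V i" "x = sum y F"
      using span_components[OF V \<open>x \<in> ?E\<close>] by blast
    obtain G z where G: "finite G" "G \<subseteq> {i. odd i}" "\<forall>i\<in>G. z i \<in> gr V i" "x = sum z G"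
      using span_components[OF V \<open>x \<in> ?O\<close>] by blast
    define w where "w i = (if i \<in> F then y i else - z i)" for i
    have "F \<inter> G = {}" using F(2) G(2) by auto
    then have "sum w (F \<union> G) = sum y F + sum (\<lambda>i. - z i) G"
      using F(1) G(1) by (subst sum.union_disjoint) (auto simp: w_def intro!: arg_cong2[where f = "(+)"] sum.cong)
    then have "sum w (F \<union> G) = 0" using F(4) G(4) by (simp add: sum_negf)
    moreover have "\<forall>i\<in>F \<union> G. w i \<in> gr V i"
      using F(3) G(3) V by (auto simp: w_def graded_vector_space_def intro: subspace_neg)
    moreover have "finite (F \<union> G)" using F(1) G(1) by simp
    ultimately have "\<forall>i\<in>F \<union> G. w i = 0" using V unfolding graded_vector_space_def by blast
    then have "\<forall>i\<in>F. y i = 0" by (auto simp: w_def split: if_splits)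
    then show "x = 0" using F(4) by simp
  qed
  have carr: "\<exists>e\<in>?E. \<exists>d\<in>?O. x = e + d" if "x \<in> carr V" for x
  proof -
    have "(\<Union>i. gr V i) = (\<Union>i\<in>{i. even i}. gr V i) \<union> (\<Union>i\<in>{i. odd i}. gr V i)" by auto
    then show ?thesis using that unfolding carr_def by (auto simp: span_Un)
  qed
  have sub: "?E \<subseteq> carr V" "?O \<subseteq> carr V" unfolding carr_def by (intro span_mono; auto)+
  define t where "t x = (THE y. \<exists>e\<in>?E. \<exists>d\<in>?O. x = e + d \<and> y = e - d)" for x
  have t: "t (e + d) = e - d" if eo: "e \<in> ?E" "d \<in> ?O" for e d
    unfolding t_def
  proof (rule the_equality)
    fix y assume "\<exists>e'\<in>?E. \<exists>d'\<in>?O. e + d = e' + d' \<and> y = e' - d'"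
    then obtain e' d' where *: "e' \<in> ?E" "d' \<in> ?O" "e + d = e' + d'" "y = e' - d'" by blast
    have "e - e' = d' - d" using *(3) by (simp add: algebra_simps)
    moreover have "e - e' \<in> ?E" "d' - d \<in> ?O" using eo *(1,2) by (auto intro: span_diff)
    ultimately have "e - e' = 0" "d' - d = 0" using EO by metis+
    then show "y = e - d" using *(4) by simp
  qed (use eo in blast)
  have "linear_on V V t"
  proof (rule linear_onI)
    fix x y c assume "x \<in> carr V"
    then obtain e d where x: "e \<in> ?E" "d \<in> ?O" "x = e + d" using carr by blast
    show "t x \<in> carr V" using x sub by (auto simp: t carr_def intro: span_diff)
    have "t (smul V c e + smul V c d) = smul V c e - smul V c d"
      using x by (intro t span_scale)
    then show "t (smul V c x) = smul V c (t x)"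
      using x t by (simp add: scale_right_distrib scale_right_diff_distrib)
    assume "y \<in> carr V"
    then obtain e' d' where y: "e' \<in> ?E" "d' \<in> ?O" "y = e' + d'" using carr by blast
    have "t ((e + e') + (d + d')) = (e + e') - (d + d')"
      using x y by (intro t span_add)
    moreover have eq: "x + y = (e + e') + (d + d')" by (simp add: x(3) y(3) algebra_simps)
    moreover have "t x = e - d" "t y = e' - d'" using t x y by simp_all
    ultimately show "t (x + y) = t x + t y" unfolding eq by simp
  qed
  moreover have "t x = smul V (sgnp i) x" if x: "x \<in> gr V i" for x i
  proof (cases "even i")
    case True
    then have "x \<in> ?E" using x by (auto intro!: span_base)
    then show ?thesis using t[of x 0] True by (simp add: sgnp_even span_zero)
  next
    case False
    then have "x \<in> ?O" using x by (auto intro!: span_base)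
    then show ?thesis using t[of 0 x] False by (simp add: sgnp_odd span_zero)
  qed
  ultimately show ?thesis by blast
qed

text \<open>A linear map that multiplies homogeneous elements of degree \<open>i\<close> by \<open>(-1)\<^sup>i\<close>.  It is determined on the
  carrier, and only its values there matter.\<close>

definition parity :: "('k::field, 'v::ab_group_add) gspace \<Rightarrow> 'v \<Rightarrow> 'v" where
  "parity V = (SOME t. linear_on V V t \<and> (\<forall>i. \<forall>x\<in>gr V i. t x = smul V (sgnp i) x))"

section \<open>Coderivations from operations\<close>

lemma cuts_cong: "(\<And>x y. F x y = G x y) \<Longrightarrow> cuts F w = cuts G w"
  by (simp add: cuts_def)

lemma cuts3_assoc_right: "cuts3 (\<lambda>x y z. cuts (F x y) z) w = cuts (\<lambda>u q. cuts3 (\<lambda>x y z. F x y z q) u) w"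
proof -
  have "cuts3 (\<lambda>x y z. cuts (F x y) z) w =
      cuts (\<lambda>x u. cuts (\<lambda>v q. cuts (\<lambda>y z. F x y z q) v) u) w"
    unfolding cuts3_def by (rule cuts_cong) (rule cuts_assoc)
  also have "\<dots> = cuts (\<lambda>u q. cuts3 (\<lambda>x y z. F x y z q) u) w"
    unfolding cuts3_def by (rule cuts_assoc)
  finally show ?thesis .
qed

lemma cuts3_assoc_left:
  "cuts3 (\<lambda>x y z. cuts (\<lambda>p q. F p q y z) x) w = cuts (\<lambda>p u. cuts3 (F p) u) w"
proof -
  have "cuts3 (\<lambda>x y z. cuts (\<lambda>p q. F p q y z) x) w =
      cuts (\<lambda>x u. cuts (\<lambda>p q. cuts (\<lambda>y z. F p q y z) u) x) w"
    unfolding cuts3_def by (rule cuts_cong) (rule cuts_swap)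
  also have "\<dots> = cuts (\<lambda>p u. cuts3 (F p) u) w"
    unfolding cuts3_def by (rule cuts_assoc[symmetric])
  finally show ?thesis .
qed

lemma cuts3_swap:
  "cuts3 (\<lambda>x y z. cuts (\<lambda>p q. F x y z p q) w') w = cuts (\<lambda>p q. cuts3 (\<lambda>x y z. F x y z p q) w) w'"
proof -
  have "cuts3 (\<lambda>x y z. cuts (\<lambda>p q. F x y z p q) w') w =
      cuts (\<lambda>x u. cuts (\<lambda>p q. cuts (\<lambda>y z. F x y z p q) u) w') w"
    unfolding cuts3_def by (rule cuts_cong) (rule cuts_swap)
  also have "\<dots> = cuts (\<lambda>p q. cuts3 (\<lambda>x y z. F x y z p q) w) w'"
    unfolding cuts3_def by (rule cuts_swap)
  finally show ?thesis .
qed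

lemma cuts_cuts_assoc_right:
  "cuts (\<lambda>x y. cuts (\<lambda>y' z. cuts (\<lambda>p q. F x y y' p q) z) w') w =
    cuts (\<lambda>u q. cuts (\<lambda>x y. cuts (\<lambda>y' z. F x y y' z q) u) w) w'"
proof -
  have "cuts (\<lambda>x y. cuts (\<lambda>y' z. cuts (\<lambda>p q. F x y y' p q) z) w') w =
      cuts (\<lambda>x y. cuts (\<lambda>u q. cuts (\<lambda>y' z. F x y y' z q) u) w') w"
    by (rule cuts_cong) (rule cuts_assoc)
  also have "\<dots> = cuts (\<lambda>u q. cuts (\<lambda>x y. cuts (\<lambda>y' z. F x y y' z q) u) w) w'"
    by (rule cuts_swap)
  finally show ?thesis .
qed

lemma cuts_cuts_assoc_left:
  "cuts (\<lambda>x y. cuts (\<lambda>y' z. cuts (\<lambda>p q. F p q y y' z) x) w') w =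
    cuts (\<lambda>p u. cuts (\<lambda>q y. cuts (\<lambda>y' z. F p q y y' z) w') u) w"
proof -
  have "cuts (\<lambda>x y. cuts (\<lambda>y' z. cuts (\<lambda>p q. F p q y y' z) x) w') w =
     cuts (\<lambda>x y. cuts (\<lambda>p q. cuts (\<lambda>y' z. F p q y y' z) w') x) w"
    by (rule cuts_cong) (rule cuts_swap)
  also have "\<dots> = cuts (\<lambda>p u. cuts (\<lambda>q y. cuts (\<lambda>y' z. F p q y y' z) w') u) w"
    by (rule cuts_assoc[symmetric])
  finally show ?thesis .
qed

lemma letters_cuts3_left:
  "letters (\<lambda>u a v. cuts3 (\<lambda>x y z. F x y z a v) u) w = cuts3 (\<lambda>x y z. letters (F x y) z) w"
  by (simp only: cuts3_def letters_cuts_left)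

lemma letters_cuts3_right:
  "letters (\<lambda>p a u. cuts3 (\<lambda>x y z. F p a x y z) u) w =
    cuts3 (\<lambda>x y z. letters (\<lambda>p a x. F p a x y z) x) w"
proof -
  have "letters (\<lambda>p a u. cuts3 (\<lambda>x y z. F p a x y z) u) w =
      cuts (\<lambda>v u. letters (\<lambda>p a x. cuts (\<lambda>y z. F p a x y z) u) v) w"
    unfolding cuts3_def by (rule letters_cuts_right)
  also have "\<dots> = cuts (\<lambda>v u. cuts (\<lambda>y z. letters (\<lambda>p a x. F p a x y z) v) u) w"
    by (intro arg_cong[where f = "\<lambda>F. cuts F w"] ext) (simp only: letters_def cuts_def sum.swap[of _ "{..<_}"])
  finally show ?thesis by (simp only: cuts3_def)
qed

lemma letters_cuts_cuts:
  "letters (\<lambda>u a v. cuts (\<lambda>x y. cuts (\<lambda>y' z. F x y a y' z) v) u) w =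
    cuts3 (\<lambda>x y z. letters (\<lambda>y1 a y2. F x y1 a y2 z) y) w"
  by (simp only: cuts3_def letters_cuts_left letters_cuts_right)

lemma cuts3_in_carr:
  assumes "vector_space (smul Z)" "w \<in> lists X"
    and "\<And>x y z. x \<in> lists X \<Longrightarrow> y \<in> lists X \<Longrightarrow> z \<in> lists X \<Longrightarrow> F x y z \<in> carr Z"
  shows "cuts3 F w \<in> carr Z"
  unfolding cuts3_def by (intro cuts_in_carr[where X = X] assms)

lemma linear_on_cuts3_fun:
  assumes "vector_space (smul Z)" "w \<in> lists X"
    and "\<And>x y z. x \<in> lists X \<Longrightarrow> y \<in> lists X \<Longrightarrow> z \<in> lists X \<Longrightarrow> linear_on V Z (\<lambda>a. F a x y z)"
  shows "linear_on V Z (\<lambda>a. cuts3 (F a) w)"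
  unfolding cuts3_def by (intro linear_on_cuts_fun[where X = X] assms)

lemma linear_on_cuts3:
  assumes "vector_space (smul W)" "vector_space (smul Z)" "linear_on W Z h" "w \<in> lists X"
    and "\<And>x y z. x \<in> lists X \<Longrightarrow> y \<in> lists X \<Longrightarrow> z \<in> lists X \<Longrightarrow> F x y z \<in> carr W"
  shows "h (cuts3 F w) = cuts3 (\<lambda>x y z. h (F x y z)) w"
proof -
  have "h (cuts3 F w) = cuts (\<lambda>x u. h (cuts (F x) u)) w"
    unfolding cuts3_def
    by (rule linear_on_cuts[OF assms(1-4)]) (intro cuts_in_carr[where X = X] assms)
  also have "\<dots> = cuts (\<lambda>x u. cuts (\<lambda>y z. h (F x y z)) u) w"
    by (rule cuts_cong_lists[OF assms(4)]) (intro linear_on_cuts[OF assms(1-3), where X = X] assms(5))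
  finally show ?thesis by (simp only: cuts3_def)
qed


lemma cuts_subspace:
  assumes "module.subspace s U" "module s" and "\<And>x y. w = x @ y \<Longrightarrow> F x y \<in> U"
  shows "cuts F w \<in> U"
  unfolding cuts_def by (intro module.subspace_sum[OF assms(2,1)] assms(3)) simp

lemma cuts3_subspace:
  assumes "module.subspace s U" "module s" and "\<And>x y z. w = x @ y @ z \<Longrightarrow> F x y z \<in> U"
  shows "cuts3 F w \<in> U"
  unfolding cuts3_def by (intro cuts_subspace[OF assms(1,2)] assms(3)) simp

lemma letters_subspace:
  assumes "module.subspace s U" "module s" and "\<And>x a y. w = x @ a # y \<Longrightarrow> F x a y \<in> U"
  shows "letters F w \<in> U"
  unfolding letters_def by (intro module.subspace_sum[OF assms(2,1)] assms(3)) (simp add: id_take_nth_drop)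

text \<open>\<open>w\<close> is a word of homogeneous letters whose degrees add up to \<open>d\<close>.\<close>

definition word_degree :: "('k, 'v) gspace \<Rightarrow> 'v list \<Rightarrow> int \<Rightarrow> bool" where
  "word_degree V w d \<longleftrightarrow> (\<exists>ds. homog V w ds \<and> sum_list ds = d)"

lemma word_degree_Nil [simp]: "word_degree V [] d \<longleftrightarrow> d = 0"
  by (auto simp: word_degree_def homog_def)

lemma word_degreeI: "homog V w ds \<Longrightarrow> word_degree V w (sum_list ds)"
  unfolding word_degree_def by blast

lemma word_degreeE:
  assumes "word_degree V w d" obtains ds where "homog V w ds" "d = sum_list ds"
  using assms unfolding word_degree_def by blast

lemma word_degree_append:
  "word_degree V (u @ w) d \<longleftrightarrow> (\<exists>d1 d2. word_degree V u d1 \<and> word_degree V w d2 \<and> d = d1 + d2)"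
    (is "?l \<longleftrightarrow> ?r")
proof
  assume ?l
  then obtain ds where ds: "homog V (u @ w) ds" "d = sum_list ds" by (rule word_degreeE)
  have "\<exists>as bs. ds = as @ bs \<and> homog V u as \<and> homog V w bs"
    using list_all2_append1[THEN iffD1, OF ds(1)[unfolded homog_def]] unfolding homog_def by metis
  then obtain as bs where "ds = as @ bs" "homog V u as" "homog V w bs" by (elim exE conjE)
  then show ?r
    using ds(2) word_degreeI[of V u as] word_degreeI[of V w bs]
    by (intro exI[of _ "sum_list as"] exI[of _ "sum_list bs"]) simp
next
  assume ?r
  then obtain d1 d2 where *: "word_degree V u d1" "word_degree V w d2" "d = d1 + d2" by (elim exE conjE)
  obtain as where as: "homog V u as" "d1 = sum_list as" using *(1) by (rule word_degreeE)
  obtain bs where bs: "homog V w bs" "d2 = sum_list bs" using *(2) by (rule word_degreeE)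
  have "homog V (u @ w) (as @ bs)" using as bs unfolding homog_def by (simp add: list_all2_appendI)
  from word_degreeI[OF this] show ?l by (simp add: *(3) as(2) bs(2))
qed

lemma word_degree_single: "word_degree V [a] d \<longleftrightarrow> a \<in> gr V d"
  unfolding word_degree_def homog_def by (auto simp: list_all2_Cons1 intro!: exI[of _ "[d]"])

lemma word_degree_Cons: "word_degree V (a # w) d \<longleftrightarrow> (\<exists>e d'. a \<in> gr V e \<and> word_degree V w d' \<and> d = e + d')"
  using word_degree_append[of V "[a]" w d] by (simp add: word_degree_single)

locale graded_gspace = vector_gspace V
  for V :: "('k::field, 'v::ab_group_add) gspace" +
  assumes graded: "graded_vector_space V"
begin

abbreviation (input) "\<tau> \<equiv> parity V"

lemma module_V: "module (smul V)"
  using V by (simp add: module_iff_vector_space)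

lemma subspace_gr: "module.subspace (smul V) (gr V i)"
  using graded by (simp add: graded_vector_space_def)

lemma parity: "linear_on V V \<tau>" "x \<in> gr V i \<Longrightarrow> \<tau> x = smul V (sgnp i) x"
  using someI_ex[OF parity_exists[OF graded]] unfolding parity_def by blast+

lemma parity_in_carr [simp]: "a \<in> carr V \<Longrightarrow> \<tau> a \<in> carr V"
  by (rule linear_onD(1)[OF parity(1)])

lemma map_parity_in_lists [simp]: "w \<in> words \<Longrightarrow> map \<tau> w \<in> words"
  by (induction w) auto

lemma parity_parity:
  assumes "x \<in> carr V" shows "\<tau> (\<tau> x) = x"
proof (rule linear_on_eq_span[where S = "\<Union>i. gr V i", OF V V _ linear_on_id _ _ assms])
  interpret vector_space "smul V" by (rule V)
  show "linear_on V V (\<lambda>x. \<tau> (\<tau> x))" by (intro linear_on_compose[OF parity(1)] parity(1))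
  show "\<tau> (\<tau> x) = x" if x: "x \<in> (\<Union>i. gr V i)" for x
  proof -
    obtain i where "x \<in> gr V i" using x by (rule UN_E)
    then show ?thesis using linear_onD(3)[OF parity(1)] carr_closed(6)[OF V] by (simp add: parity(2))
  qed
qed (simp add: carr_def)

lemma parity_gr: "x \<in> gr V i \<Longrightarrow> \<tau> x \<in> gr V i"
  using module.subspace_scale[OF module_V subspace_gr] by (simp add: parity(2))

lemma word_degree_map_parity: "word_degree V w d \<Longrightarrow> word_degree V (map \<tau> w) d"
proof (induction w arbitrary: d)
  case (Cons a w)
  then obtain e d' where "a \<in> gr V e" "word_degree V w d'" "d = e + d'"
    unfolding word_degree_Cons by (elim exE conjE)
  then show ?case
    using Cons.IH[of d'] parity_gr[of a e] unfolding list.map word_degree_Cons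
    by (intro exI[of _ e] exI[of _ d']) simp
qed simp

lemma word_degree_lists: "word_degree V w d \<Longrightarrow> w \<in> words"
  using homog_lists[OF V] unfolding word_degree_def by blast

lemma gr_Diass': "gr C d = module.span fscale {mword V vs v ws |vs v ws. word_degree V (vs @ v # ws) d}"
  unfolding gr_Diass[OF V] word_degree_def by (rule arg_cong[where f = "module.span fscale"]) blast

lemma mword_gr:
  assumes "word_degree V (vs @ v # ws) d" shows "mword V vs v ws \<in> gr C d"
proof -
  interpret D: vector_space "fscale :: 'k \<Rightarrow> ('k, 'v) diass \<Rightarrow> _" by simp
  show ?thesis unfolding gr_Diass' by (rule D.span_base) (use assms in blast)
qed

lemma subspace_gr_Diass: "module.subspace fscale (gr C d)"
proof -
  interpret D: vector_space "fscale :: 'k \<Rightarrow> ('k, 'v) diass \<Rightarrow> _" by simp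
  show ?thesis unfolding gr_Diass' by simp
qed

lemma linear_on_gr_Diass:
  assumes Z: "vector_space (smul Z)" and f: "linear_on C Z f" and U: "module.subspace (smul Z) U"
    and "\<And>vs v ws. word_degree V (vs @ v # ws) d \<Longrightarrow> f (mword V vs v ws) \<in> U" "x \<in> gr C d"
  shows "f x \<in> U"
proof (rule linear_on_span_subset[OF _ Z f U])
  show "x \<in> module.span (smul C) {mword V vs v ws |vs v ws. word_degree V (vs @ v # ws) d}"
    using assms(5) by (simp add: gr_Diass')
  show "{mword V vs v ws |vs v ws. word_degree V (vs @ v # ws) d} \<subseteq> carr C"
  proof (intro subsetI, elim CollectE exE conjE)
    fix y vs v ws assume "y = mword V vs v ws" "word_degree V (vs @ v # ws) d"
    then show "y \<in> carr C" using carr_closed(6)[OF _ mword_gr] by simp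
  qed
qed (use assms(4) in auto)

text \<open>The parity operator of the coalgebra.\<close>

definition "\<sigma> = Diass_lift V C (\<lambda>vs v ws. mword V (map \<tau> vs) (\<tau> v) (map \<tau> ws))"

lemma \<sigma>:
  "linear_on C C \<sigma>"
  "vs \<in> words \<Longrightarrow> v \<in> carr V \<Longrightarrow> ws \<in> words \<Longrightarrow>
    \<sigma> (mword V vs v ws) = mword V (map \<tau> vs) (\<tau> v) (map \<tau> ws)"
proof -
  have "marked_multilinear V C (\<lambda>vs v ws. mword V (map \<tau> vs) (\<tau> v) (map \<tau> ws))"
    by (rule marked_multilinearI)
      (intro linear_on_mword V linear_word_map parity linear_word_intros; simp)+
  from Diass_lift[OF V _ this] show "linear_on C C \<sigma>"
    "vs \<in> words \<Longrightarrow> v \<in> carr V \<Longrightarrow> ws \<in> words \<Longrightarrow>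
      \<sigma> (mword V vs v ws) = mword V (map \<tau> vs) (\<tau> v) (map \<tau> ws)"
    by (simp_all add: \<sigma>_def lin_linear_on)
qed

lemma \<sigma>_gr:
  assumes "x \<in> gr C d" shows "\<sigma> x = fscale (sgnp d) x"
proof -
  interpret D: vector_space "fscale :: 'k \<Rightarrow> ('k, 'v) diass \<Rightarrow> _" by simp
  have L: "G (us @ map \<tau> w) = smul Z (sgnp e) (G (us @ w))"
    if G: "\<And>us a ws. us \<in> words \<Longrightarrow> ws \<in> words \<Longrightarrow> linear_on V Z (\<lambda>a. G (us @ a # ws))"
      and "vector_space (smul Z)" "word_degree V w e" "us \<in> words"
    for G :: "'v list \<Rightarrow> 'z::ab_group_add" and Z us w e
    using that(3,4)
  proof (induction w arbitrary: us e)
    case Nil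
    interpret Z: vector_space "smul Z" by fact
    show ?case using Nil by (simp add: sgnp_even)
  next
    case (Cons a w)
    interpret Z: vector_space "smul Z" by fact
    obtain i d' where a: "a \<in> gr V i" "word_degree V w d'" "e = i + d'"
      using Cons.prems(1) by (auto simp: word_degree_Cons)
    have ac: "a \<in> carr V" and w: "w \<in> words"
      using a carr_closed(6)[OF V] word_degree_lists by auto
    have "G (us @ map \<tau> (a # w)) = G ((us @ [\<tau> a]) @ map \<tau> w)" by simp
    also have "\<dots> = smul Z (sgnp d') (G ((us @ [\<tau> a]) @ w))"
      using Cons.prems(2) ac by (intro Cons.IH a(2)) simp
    also have "G ((us @ [\<tau> a]) @ w) = smul Z (sgnp i) (G (us @ a # w))"
      using linear_onD(3)[OF G[OF Cons.prems(2) w] ac] by (simp add: parity(2)[OF a(1)])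
    finally show ?case by (simp add: a(3) sgnp_add mult.commute)
  qed
  have "\<sigma> x - fscale (sgnp d) x \<in> {0}"
  proof (rule linear_on_gr_Diass[where Z = C and d = d, OF _ _ _ _ assms])
    show "linear_on C C (\<lambda>x. \<sigma> x - fscale (sgnp d) x)"
      using linear_on_add[OF _ \<sigma>(1) linear_on_scale[OF _ linear_on_id, of C "- sgnp d"]] by simp
    show "\<sigma> (mword V vs v ws) - fscale (sgnp d) (mword V vs v ws) \<in> {0}"
      if deg: "word_degree V (vs @ v # ws) d" for vs v ws
    proof -
      obtain d1 i d2 where w: "word_degree V vs d1" "v \<in> gr V i" "word_degree V ws d2" "d = d1 + (i + d2)"
        using deg unfolding word_degree_append word_degree_Cons by (elim exE conjE) simp
      note c = word_degree_lists[OF w(1)] carr_closed(6)[OF V w(2)] word_degree_lists[OF w(3)]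
      have 1: "mword V (map \<tau> vs) (\<tau> v) (map \<tau> ws) = fscale (sgnp d1) (mword V vs (\<tau> v) (map \<tau> ws))"
        using L[of C "\<lambda>u. mword V u (\<tau> v) (map \<tau> ws)" vs d1 "[]"] w(1) c
          mword_multilinear[OF V] by (simp add: marked_multilinear_def)
      have 2: "mword V vs (\<tau> v) (map \<tau> ws) = fscale (sgnp d2) (mword V vs (\<tau> v) ws)"
        using L[of C "\<lambda>u. mword V vs (\<tau> v) u" ws d2 "[]"] w(3) c
          mword_multilinear[OF V] by (simp add: marked_multilinear_def)
      have 3: "mword V vs (\<tau> v) ws = fscale (sgnp i) (mword V vs v ws)"
        using linear_onD(3)[OF linear_on_mword(1)[OF V linear_on_id c(1,3)] c(2)]
        by (simp add: parity(2)[OF w(2)])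
      show ?thesis by (simp add: \<sigma> c 1 2 3 w(4) sgnp_add mult_ac)
    qed
    show "module.subspace (smul C) {0}" by simp
  qed simp
  then show ?thesis by simp
qed

text \<open>Koszul signs of maps of degree \<open>-1\<close> are given by the parity operator on the first factor.\<close>

lemma tensor_map_koszul:
  assumes d: "linear_on C C d" and t: "t \<in> carr CC"
  shows "tensor_map C C C C (\<lambda>z. z) (- 1) d t = tmap \<sigma> d t"
proof (rule tensor_eqI[where f = "tensor_map C C C C (\<lambda>z. z) (- 1) d" and g = "tmap \<sigma> d", OF _ _ _ _ _ _ t])
  have *: "\<sigma> x = smul C (sgnp (- 1 * i)) x" if "x \<in> gr C i" for i x
    using \<sigma>_gr[OF that] sgnp_eqI[of i "- i", where 'a = 'k] by simp
  note tm = tensor_map[OF _ _ _ _ linear_on_id d \<sigma>(1) *]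
  show "linear_on CC CC (tensor_map C C C C (\<lambda>z. z) (- 1) d)" by (rule tm(1)) simp_all
  show "linear_on CC CC (tmap \<sigma> d)" by (rule tmap(1)[OF \<sigma>(1) d])
  show "tensor_map C C C C (\<lambda>z. z) (- 1) d (tn x y) = tmap \<sigma> d (tn x y)"
    if "x \<in> carr C" "y \<in> carr C" for x y
    using that by (subst tm(2)) (simp_all add: tmap(2)[OF \<sigma>(1) d])
qed simp_all

lemma Coder_iff:
  "d \<in> Coder (- 1) C (coprod1 V) (coprod2 V) \<longleftrightarrow> d \<in> lin_deg (- 1) C C \<and>
    (\<forall>x\<in>carr C. coprod1 V (d x) = tmap \<sigma> d (coprod1 V x) + tmap d (\<lambda>z. z) (coprod1 V x) \<and>
      coprod2 V (d x) = tmap \<sigma> d (coprod2 V x) + tmap d (\<lambda>z. z) (coprod2 V x))"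
proof -
  have "tensor_map C C C C (\<lambda>z. z) (- 1) d (coprod1 V x) = tmap \<sigma> d (coprod1 V x)"
    "tensor_map C C C C (\<lambda>z. z) (- 1) d (coprod2 V x) = tmap \<sigma> d (coprod2 V x)"
    if "d \<in> lin_deg (- 1) C C" "x \<in> carr C" for x
    using that linear_onD(1)[OF coprod1(1)] linear_onD(1)[OF coprod2(1)]
    by (auto intro!: tensor_map_koszul simp: lin_deg_def lin_linear_on)
  then show ?thesis unfolding Coder_def by auto
qed

text \<open>The coderivation with a given projection \<open>b\<close> to the cogenerators.  It is the sum over all subwords \<open>y\<close> of
  a marked word; each summand replaces \<open>y\<close> by one letter and applies the parity operator to every letter
  to the left of \<open>y\<close>.  If \<open>y\<close> contains the marked letter, the new letter is the value of \<open>b\<close> and is marked;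
  otherwise it is the sum of the values of \<open>b\<close> over all marks of \<open>y\<close>.  Empty subwords contribute zero,
  because \<open>letters b []\<close> is zero.\<close>

definition coder_value :: "('v list \<Rightarrow> 'v \<Rightarrow> 'v list \<Rightarrow> 'v) \<Rightarrow> 'v list \<Rightarrow> 'v \<Rightarrow> 'v list \<Rightarrow> ('k, 'v) diass" where
  "coder_value b vs v ws =
     cuts3 (\<lambda>x y z. mword V (map \<tau> x @ letters b y # z) v ws) vs +
     cuts3 (\<lambda>x y z. mword V (map \<tau> vs) (\<tau> v) (map \<tau> x @ letters b y # z)) ws +
     cuts (\<lambda>x y. cuts (\<lambda>y' z. mword V (map \<tau> x) (b y v y') z) ws) vs"

definition coder_of :: "('v list \<Rightarrow> 'v \<Rightarrow> 'v list \<Rightarrow> 'v) \<Rightarrow> ('k, 'v) diass \<Rightarrow> ('k, 'v) diass" where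
  "coder_of b = Diass_lift V C (coder_value b)"

context
  fixes b :: "'v list \<Rightarrow> 'v \<Rightarrow> 'v list \<Rightarrow> 'v"
  assumes b: "marked_multilinear V V b"
begin

lemma b_in_carr [simp]:
  "vs \<in> words \<Longrightarrow> v \<in> carr V \<Longrightarrow> ws \<in> words \<Longrightarrow> b vs v ws \<in> carr V"
  by (rule marked_multilinear_carr[OF b])

lemma letters_b_in_carr [simp]: "w \<in> words \<Longrightarrow> letters b w \<in> carr V"
  by (rule letters_in_carr[OF V, where X = "carr V"]) simp_all

lemma coder_value_multilinear: "marked_multilinear V C (coder_value b)"
proof -
  note intros = linear_on_add linear_on_cuts3_fun[where X = "carr V"] linear_on_cuts_fun[where X = "carr V"]
    linear_on_mword linear_word_map parity linear_on_letters_word[OF _ b] marked_multilinearD[OF b]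
    linear_word_intros
  show ?thesis
    unfolding coder_value_def
    by (rule marked_multilinearI; (unfold cuts3_append_Cons cuts_append_Cons)?)
      (intro intros V | simp)+
qed

lemma coder_of_lin: "coder_of b \<in> lin C C"
  using Diass_lift[OF V _ coder_value_multilinear] by (simp add: coder_of_def)

lemma coder_of_mword:
  "vs \<in> words \<Longrightarrow> v \<in> carr V \<Longrightarrow> ws \<in> words \<Longrightarrow>
    coder_of b (mword V vs v ws) = coder_value b vs v ws"
  using Diass_lift[OF V _ coder_value_multilinear] by (simp add: coder_of_def)

lemma coder_of_linear_on: "linear_on C C (coder_of b)"
  using coder_of_lin by (rule lin_linear_on)

end



lemma tns_cuts3:
  assumes x: "x \<in> carr C" and w: "w \<in> lists X"
    and F: "\<And>p q r. p \<in> lists X \<Longrightarrow> q \<in> lists X \<Longrightarrow> r \<in> lists X \<Longrightarrow> F p q r \<in> carr C"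
  shows "tn (cuts3 F w) x = cuts3 (\<lambda>p q r. tn (F p q r) x) w"
    "tn x (cuts3 F w) = cuts3 (\<lambda>p q r. tn x (F p q r)) w"
  by (rule linear_on_cuts3[OF _ _ linear_on_tns(1)[OF _ _ x] w F]; simp)
    (rule linear_on_cuts3[OF _ _ linear_on_tns(2)[OF _ _ x] w F]; simp)

lemma linear_on_cuts_cuts:
  assumes "vector_space (smul W)" "vector_space (smul Z)" "linear_on W Z h" "w \<in> lists X" "w' \<in> lists X"
    and "\<And>x y y' z. x \<in> lists X \<Longrightarrow> y \<in> lists X \<Longrightarrow> y' \<in> lists X \<Longrightarrow> z \<in> lists X \<Longrightarrow> F x y y' z \<in> carr W"
  shows "h (cuts (\<lambda>x y. cuts (F x y) w') w) = cuts (\<lambda>x y. cuts (\<lambda>y' z. h (F x y y' z)) w') w"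
proof -
  have "h (cuts (\<lambda>x y. cuts (F x y) w') w) = cuts (\<lambda>x y. h (cuts (F x y) w')) w"
    by (rule linear_on_cuts[OF assms(1-4)]) (intro cuts_in_carr[where X = X] assms)
  also have "\<dots> = cuts (\<lambda>x y. cuts (\<lambda>y' z. h (F x y y' z)) w') w"
    by (rule cuts_cong_lists[OF assms(4)]) (intro linear_on_cuts[OF assms(1-3,5)] assms(6))
  finally show ?thesis .
qed

lemma word_degree_replace:
  assumes xyz: "word_degree V (u @ x @ y @ z) d"
    and c: "\<And>e. word_degree V y e \<Longrightarrow> c \<in> gr V (e - 1)"
  shows "word_degree V (u @ map \<tau> x @ c # z) (d - 1)"
proof -
  obtain d0 d1 d2 d3 where d: "word_degree V u d0" "word_degree V x d1" "word_degree V y d2"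
    "word_degree V z d3" "d = d0 + (d1 + (d2 + d3))"
    using xyz unfolding word_degree_append by (elim exE conjE) simp
  have "word_degree V (c # z) ((d2 - 1) + d3)"
    unfolding word_degree_Cons using c[OF d(3)] d(4) by (intro exI[of _ "d2 - 1"] exI[of _ d3]) simp
  moreover have "word_degree V (map \<tau> x) d1" using d(2) by (rule word_degree_map_parity)
  ultimately have "word_degree V (map \<tau> x @ c # z) (d1 + ((d2 - 1) + d3))"
    unfolding word_degree_append[of V "map \<tau> x"] by blast
  then have "word_degree V (u @ map \<tau> x @ c # z) (d0 + (d1 + ((d2 - 1) + d3)))"
    unfolding word_degree_append[of V u] using d(1) by blast
  then show ?thesis by (simp add: d(5) algebra_simps)
qed

lemma \<sigma>_mark_sum:
  assumes "w \<in> words" shows "\<sigma> (mark_sum V w) = mark_sum V (map \<tau> w)"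
proof -
  have "\<sigma> (mark_sum V w) = letters (\<lambda>x a y. \<sigma> (mword V x a y)) w"
    unfolding mark_sum_def by (rule linear_on_letters[OF _ _ \<sigma>(1) assms]) (simp_all add: V)
  also have "\<dots> = letters (\<lambda>x a y. mword V (map \<tau> x) (\<tau> a) (map \<tau> y)) w"
    by (rule letters_cong_lists[OF assms]) (simp add: \<sigma>)
  finally show ?thesis by (simp add: mark_sum_def letters_map)
qed

context
  fixes b :: "'v list \<Rightarrow> 'v \<Rightarrow> 'v list \<Rightarrow> 'v"
  assumes b: "marked_multilinear V V b"
begin

abbreviation (input) "D\<^sub>b \<equiv> coder_of b"
abbreviation (input) "\<beta> \<equiv> letters b"

lemmas b_carr [simp] = b_in_carr[OF b] letters_b_in_carr[OF b]
lemmas D_linear_on = coder_of_linear_on[OF b]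
lemmas D_mword = coder_of_mword[OF b]

lemma linear_on_D_mword:
  assumes Z: "vector_space (smul Z)" and h: "linear_on C Z h"
    and w: "vs \<in> words" "v \<in> carr V" "ws \<in> words"
  shows "h (D\<^sub>b (mword V vs v ws)) =
    cuts3 (\<lambda>x y z. h (mword V (map \<tau> x @ \<beta> y # z) v ws)) vs +
    cuts3 (\<lambda>x y z. h (mword V (map \<tau> vs) (\<tau> v) (map \<tau> x @ \<beta> y # z))) ws +
    cuts (\<lambda>x y. cuts (\<lambda>y' z. h (mword V (map \<tau> x) (b y v y') z)) ws) vs"
proof -
  note [simp] = V w
  have "h (D\<^sub>b (mword V vs v ws)) = h (cuts3 (\<lambda>x y z. mword V (map \<tau> x @ \<beta> y # z) v ws) vs) +
      h (cuts3 (\<lambda>x y z. mword V (map \<tau> vs) (\<tau> v) (map \<tau> x @ \<beta> y # z)) ws) +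
      h (cuts (\<lambda>x y. cuts (\<lambda>y' z. mword V (map \<tau> x) (b y v y') z) ws) vs)"
    unfolding D_mword[OF w] coder_value_def
    by (subst linear_onD(2)[OF h], (intro carr_closed(2) cuts3_in_carr[where X = "carr V"]
          cuts_in_carr[where X = "carr V"]; simp)+)+ simp
  also have "\<dots> = cuts3 (\<lambda>x y z. h (mword V (map \<tau> x @ \<beta> y # z) v ws)) vs +
      cuts3 (\<lambda>x y z. h (mword V (map \<tau> vs) (\<tau> v) (map \<tau> x @ \<beta> y # z))) ws +
      cuts (\<lambda>x y. cuts (\<lambda>y' z. h (mword V (map \<tau> x) (b y v y') z)) ws) vs"
    by (intro arg_cong2[where f = "(+)"] linear_on_cuts3[OF _ Z h w(1)] linear_on_cuts3[OF _ Z h w(3)]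
        linear_on_cuts_cuts[OF _ Z h w(1,3)]) simp_all
  finally show ?thesis .
qed

text \<open>On sums over all marks, \<open>coder_of b\<close> replaces each subword by the sum of \<open>b\<close> over all marks of it, and sums
  over all marks of the result.\<close>

lemma coder_of_mark_sum:
  assumes q: "q \<in> words"
  shows "D\<^sub>b (mark_sum V q) = cuts3 (\<lambda>x y z. mark_sum V (map \<tau> x @ \<beta> y # z)) q"
proof -
  have "D\<^sub>b (mark_sum V q) = letters (\<lambda>vs v ws. D\<^sub>b (mword V vs v ws)) q"
    unfolding mark_sum_def by (rule linear_on_letters[OF _ _ D_linear_on q]) (simp_all add: V)
  also have "\<dots> = letters (\<lambda>vs v ws. coder_value b vs v ws) q"
    by (rule letters_cong_lists[OF q]) (simp add: D_mword)
  also have "\<dots> = letters (\<lambda>vs v ws. cuts3 (\<lambda>x y z. mword V (map \<tau> x @ \<beta> y # z) v ws) vs) q +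
      letters (\<lambda>vs v ws. cuts3 (\<lambda>x y z. mword V (map \<tau> vs) (\<tau> v) (map \<tau> x @ \<beta> y # z)) ws) q +
      letters (\<lambda>vs v ws. cuts (\<lambda>x y. cuts (\<lambda>y' z. mword V (map \<tau> x) (b y v y') z) ws) vs) q"
    unfolding coder_value_def by (simp only: letters_add)
  also have "\<dots> = cuts3 (\<lambda>x y z. letters (\<lambda>p a p'. mword V (map \<tau> x @ \<beta> y # p) a p') z +
      letters (\<lambda>p a p'. mword V (map \<tau> p) (\<tau> a) (map \<tau> p' @ \<beta> y # z)) x +
      letters (\<lambda>y1 a y2. mword V (map \<tau> x) (b y1 a y2) z) y) q"
    by (simp only: letters_cuts3_left letters_cuts3_right letters_cuts_cuts cuts3_add)
  also have "\<dots> = cuts3 (\<lambda>x y z. mark_sum V (map \<tau> x @ \<beta> y # z)) q"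
  proof (rule cuts3_cong_lists[OF q])
    fix x y z assume w: "x \<in> words" "y \<in> words" "z \<in> words"
    have "mword V (map \<tau> x) (\<beta> y) z = letters (\<lambda>y1 a y2. mword V (map \<tau> x) (b y1 a y2) z) y"
      by (rule linear_on_letters[OF V _ linear_on_mword(1)[OF V linear_on_id] w(2)]) (simp_all add: w)
    then show "letters (\<lambda>p a p'. mword V (map \<tau> x @ \<beta> y # p) a p') z +
      letters (\<lambda>p a p'. mword V (map \<tau> p) (\<tau> a) (map \<tau> p' @ \<beta> y # z)) x +
      letters (\<lambda>y1 a y2. mword V (map \<tau> x) (b y1 a y2) z) y = mark_sum V (map \<tau> x @ \<beta> y # z)"
      by (simp add: mark_sum_def letters_append letters_Cons letters_map add_ac)
  qed
  finally show ?thesis .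
qed

text \<open>In the facts 1, 2 and 3, the subword that is replaced lies to the left of the mark, lies to the right of the
  mark, or contains it.  In fact 2, the cut made by the coproduct is on the left or on the right of the new
  letter; the first case is the term with the parity operator.\<close>

lemma coder_of_coprod1:
  assumes w: "vs \<in> words" "v \<in> carr V" "ws \<in> words"
  shows "coprod1 V (D\<^sub>b (mword V vs v ws)) =
    tmap \<sigma> D\<^sub>b (coprod1 V (mword V vs v ws)) + tmap D\<^sub>b (\<lambda>z. z) (coprod1 V (mword V vs v ws))"
proof -
  let ?M = "mark_sum V" and ?m = "mword V" and ?t = "map \<tau>"
  note [simp] = V w mark_sum_in_carr tns_in_carr
  have 1: "cuts3 (\<lambda>x y z. coprod1 V (?m (?t x @ \<beta> y # z) v ws)) vs =
      cuts (\<lambda>p q. cuts3 (\<lambda>x y z. tn (?m (?t x @ \<beta> y # z) v p) (?M q)) vs) ws"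
    by (simp add: cuts3_swap[symmetric] coprod1 cong: cuts3_cong_lists[OF w(1)])
  have 2: "cuts3 (\<lambda>x y z. coprod1 V (?m (?t vs) (\<tau> v) (?t x @ \<beta> y # z))) ws =
      cuts (\<lambda>p q. cuts3 (\<lambda>x y z. tn (?m (?t vs) (\<tau> v) (?t p)) (?M (?t x @ \<beta> y # z))) q) ws +
      cuts (\<lambda>p q. cuts3 (\<lambda>x y z. tn (?m (?t vs) (\<tau> v) (?t x @ \<beta> y # z)) (?M q)) p) ws"
    unfolding cuts3_assoc_left[symmetric] cuts3_assoc_right[symmetric] cuts3_add[symmetric]
    by (rule cuts3_cong_lists[OF w(3)]) (simp add: coprod1(2) cuts_append_Cons cuts_map)
  have 3: "cuts (\<lambda>x y. cuts (\<lambda>y' z. coprod1 V (?m (?t x) (b y v y') z)) ws) vs =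
      cuts (\<lambda>p q. cuts (\<lambda>x y. cuts (\<lambda>y' z. tn (?m (?t x) (b y v y') z) (?M q)) p) vs) ws"
    unfolding cuts_cuts_assoc_right[symmetric]
    by (intro cuts_cong_lists[OF w(1)] cuts_cong_lists[OF w(3)]) (simp add: coprod1(2))
  have R1: "tmap \<sigma> D\<^sub>b (coprod1 V (?m vs v ws)) =
      cuts (\<lambda>p q. cuts3 (\<lambda>x y z. tn (?m (?t vs) (\<tau> v) (?t p)) (?M (?t x @ \<beta> y # z))) q) ws"
    unfolding tmap_coprod(1)[OF \<sigma>(1) D_linear_on w]
    by (rule cuts_cong_lists[OF w(3)]) (simp add: \<sigma> coder_of_mark_sum tns_cuts3(2)[where X = "carr V"])
  have R2: "tmap D\<^sub>b (\<lambda>z. z) (coprod1 V (?m vs v ws)) =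
      cuts (\<lambda>p q. cuts3 (\<lambda>x y z. tn (?m (?t x @ \<beta> y # z) v p) (?M q)) vs) ws +
      cuts (\<lambda>p q. cuts3 (\<lambda>x y z. tn (?m (?t vs) (\<tau> v) (?t x @ \<beta> y # z)) (?M q)) p) ws +
      cuts (\<lambda>p q. cuts (\<lambda>x y. cuts (\<lambda>y' z. tn (?m (?t x) (b y v y') z) (?M q)) p) vs) ws"
    unfolding tmap_coprod(1)[OF D_linear_on linear_on_id w] cuts_add[symmetric]
  proof (rule cuts_cong_lists[OF w(3)])
    fix p q assume [simp]: "p \<in> words" "q \<in> words"
    show "tn (D\<^sub>b (?m vs v p)) (?M q) = cuts3 (\<lambda>x y z. tn (?m (?t x @ \<beta> y # z) v p) (?M q)) vs +
      cuts3 (\<lambda>x y z. tn (?m (?t vs) (\<tau> v) (?t x @ \<beta> y # z)) (?M q)) p +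
      cuts (\<lambda>x y. cuts (\<lambda>y' z. tn (?m (?t x) (b y v y') z) (?M q)) p) vs"
      by (rule linear_on_D_mword[OF _ linear_on_tns(1)]) simp_all
  qed
  show ?thesis
    unfolding linear_on_D_mword[OF vector_space_smul_tensors(1) coprod1(1) w] 1 2 3 R1 R2 by (simp only: add_ac)
qed

text \<open>This is the mirror image, except that now a cut to the left of the new letter occurs in all three cases;
  these cuts make up the term with the parity operator.\<close>

lemma coder_of_coprod2:
  assumes w: "vs \<in> words" "v \<in> carr V" "ws \<in> words"
  shows "coprod2 V (D\<^sub>b (mword V vs v ws)) =
    tmap \<sigma> D\<^sub>b (coprod2 V (mword V vs v ws)) + tmap D\<^sub>b (\<lambda>z. z) (coprod2 V (mword V vs v ws))"
proof -
  let ?M = "mark_sum V" and ?m = "mword V" and ?t = "map \<tau>"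
  note [simp] = V w mark_sum_in_carr tns_in_carr
  have 1: "cuts3 (\<lambda>x y z. coprod2 V (?m (?t x @ \<beta> y # z) v ws)) vs =
      cuts (\<lambda>p q. cuts3 (\<lambda>x y z. tn (?M (?t p)) (?m (?t x @ \<beta> y # z) v ws)) q) vs +
      cuts (\<lambda>p q. cuts3 (\<lambda>x y z. tn (?M (?t x @ \<beta> y # z)) (?m q v ws)) p) vs"
    unfolding cuts3_assoc_left[symmetric] cuts3_assoc_right[symmetric] cuts3_add[symmetric]
    by (rule cuts3_cong_lists[OF w(1)]) (simp add: coprod2(2) cuts_append_Cons cuts_map)
  have 2: "cuts3 (\<lambda>x y z. coprod2 V (?m (?t vs) (\<tau> v) (?t x @ \<beta> y # z))) ws =
      cuts (\<lambda>p q. cuts3 (\<lambda>x y z. tn (?M (?t p)) (?m (?t q) (\<tau> v) (?t x @ \<beta> y # z))) ws) vs"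
    unfolding cuts3_swap[symmetric]
    by (rule cuts3_cong_lists[OF w(3)]) (simp add: coprod2(2) cuts_map)
  have 3: "cuts (\<lambda>x y. cuts (\<lambda>y' z. coprod2 V (?m (?t x) (b y v y') z)) ws) vs =
      cuts (\<lambda>p q. cuts (\<lambda>x y. cuts (\<lambda>y' z. tn (?M (?t p)) (?m (?t x) (b y v y') z)) ws) q) vs"
    unfolding cuts_cuts_assoc_left[symmetric]
    by (intro cuts_cong_lists[OF w(1)] cuts_cong_lists[OF w(3)]) (simp add: coprod2(2) cuts_map)
  have R2: "tmap D\<^sub>b (\<lambda>z. z) (coprod2 V (?m vs v ws)) =
      cuts (\<lambda>p q. cuts3 (\<lambda>x y z. tn (?M (?t x @ \<beta> y # z)) (?m q v ws)) p) vs"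
    unfolding tmap_coprod(2)[OF D_linear_on linear_on_id w]
    by (rule cuts_cong_lists[OF w(1)]) (simp add: coder_of_mark_sum tns_cuts3(1)[where X = "carr V"])
  have R1: "tmap \<sigma> D\<^sub>b (coprod2 V (?m vs v ws)) =
      cuts (\<lambda>p q. cuts3 (\<lambda>x y z. tn (?M (?t p)) (?m (?t x @ \<beta> y # z) v ws)) q) vs +
      cuts (\<lambda>p q. cuts3 (\<lambda>x y z. tn (?M (?t p)) (?m (?t q) (\<tau> v) (?t x @ \<beta> y # z))) ws) vs +
      cuts (\<lambda>p q. cuts (\<lambda>x y. cuts (\<lambda>y' z. tn (?M (?t p)) (?m (?t x) (b y v y') z)) ws) q) vs"
    unfolding tmap_coprod(2)[OF \<sigma>(1) D_linear_on w] cuts_add[symmetric]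
  proof (rule cuts_cong_lists[OF w(1)])
    fix p q assume [simp]: "p \<in> words" "q \<in> words"
    show "tn (\<sigma> (?M p)) (D\<^sub>b (?m q v ws)) = cuts3 (\<lambda>x y z. tn (?M (?t p)) (?m (?t x @ \<beta> y # z) v ws)) q +
      cuts3 (\<lambda>x y z. tn (?M (?t p)) (?m (?t q) (\<tau> v) (?t x @ \<beta> y # z))) ws +
      cuts (\<lambda>x y. cuts (\<lambda>y' z. tn (?M (?t p)) (?m (?t x) (b y v y') z)) ws) q"
      unfolding \<sigma>_mark_sum[OF \<open>p \<in> words\<close>]
      by (rule linear_on_D_mword[OF _ linear_on_tns(2)]) simp_all
  qed
  show ?thesis
    unfolding linear_on_D_mword[OF vector_space_smul_tensors(1) coprod2(1) w] 1 2 3 R1 R2 by (simp only: add_ac)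
qed

lemma proj_coder_of:
  assumes w: "vs \<in> words" "v \<in> carr V" "ws \<in> words"
  shows "proj V (D\<^sub>b (mword V vs v ws)) = b vs v ws"
proof -
  note [simp] = V w proj
  have 1: "cuts3 (\<lambda>x y z. proj V (mword V (map \<tau> x @ \<beta> y # z) v ws)) vs = cuts3 (\<lambda>x y z. 0) vs"
    by (rule cuts3_cong_lists[OF w(1)]) simp
  have 2: "cuts3 (\<lambda>x y z. proj V (mword V (map \<tau> vs) (\<tau> v) (map \<tau> x @ \<beta> y # z))) ws = cuts3 (\<lambda>x y z. 0) ws"
    by (rule cuts3_cong_lists[OF w(3)]) simp
  have 3: "cuts (\<lambda>x y. cuts (\<lambda>y' z. proj V (mword V (map \<tau> x) (b y v y') z)) ws) vs =
      cuts (\<lambda>x y. if x = [] then cuts (\<lambda>y' z. if z = [] then b y v y' else 0) ws else 0) vs"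
  proof (rule cuts_cong_lists[OF w(1)])
    fix x y assume [simp]: "x \<in> words" "y \<in> words"
    have "cuts (\<lambda>y' z. proj V (mword V (map \<tau> x) (b y v y') z)) ws =
        cuts (\<lambda>y' z. if x = [] \<and> z = [] then b y v y' else 0) ws"
      by (rule cuts_cong_lists[OF w(3)]) simp
    then show "cuts (\<lambda>y' z. proj V (mword V (map \<tau> x) (b y v y') z)) ws =
        (if x = [] then cuts (\<lambda>y' z. if z = [] then b y v y' else 0) ws else 0)"
      by (simp add: cuts_zero)
  qed
  show ?thesis
    unfolding linear_on_D_mword[OF V proj(1) w] 1 2 3
    by (simp add: cuts_left_empty cuts_right_empty cuts3_def cuts_zero)
qed

lemma coder_value_degree:
  assumes deg: "\<And>vs v ws d. word_degree V (vs @ v # ws) d \<Longrightarrow> b vs v ws \<in> gr V (d - 1)"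
    and vw: "word_degree V (vs @ v # ws) d"
  shows "coder_value b vs v ws \<in> gr C (d - 1)"
proof -
  interpret M: vector_space "fscale :: 'k \<Rightarrow> ('k, 'v) diass \<Rightarrow> _" by simp
  note sub = subspace_gr_Diass M.module_axioms
  have beta: "\<beta> w \<in> gr V (e - 1)" if "word_degree V w e" for w e
    by (rule letters_subspace[OF subspace_gr module_V]) (use that deg in simp)
  obtain d1 d2 where "word_degree V (vs @ [v]) d1" "word_degree V ws d2" "d = d1 + d2"
    using vw word_degree_append[of V "vs @ [v]" ws d] by auto
  then have "word_degree V (map \<tau> (vs @ [v]) @ ws) d"
    unfolding word_degree_append[of V "map \<tau> (vs @ [v])"]
    using word_degree_map_parity by blast
  then have vw': "word_degree V (map \<tau> vs @ \<tau> v # ws) d" by simp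
  have "mword V (map \<tau> x @ \<beta> y # z) v ws \<in> gr C (d - 1)" if "vs = x @ y @ z" for x y z
    using word_degree_replace[of "[]" x y "z @ v # ws" d "\<beta> y"] vw beta that by (intro mword_gr) simp
  moreover have "mword V (map \<tau> vs) (\<tau> v) (map \<tau> x @ \<beta> y # z) \<in> gr C (d - 1)"
    if "ws = x @ y @ z" for x y z
    using word_degree_replace[of "map \<tau> vs @ [\<tau> v]" x y z d "\<beta> y"] vw' beta that by (intro mword_gr) simp
  moreover have "mword V (map \<tau> x) (b y v y') z \<in> gr C (d - 1)" if "vs = x @ y" "ws = y' @ z" for x y y' z
    using word_degree_replace[of "[]" x "y @ v # y'" z d "b y v y'"] vw deg that by (intro mword_gr) simp
  ultimately show ?thesis
    unfolding coder_value_def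
    by (intro M.subspace_add[OF subspace_gr_Diass] cuts3_subspace[OF sub] cuts_subspace[OF sub])
qed

lemma coder_of_degree:
  assumes deg: "\<And>vs v ws d. word_degree V (vs @ v # ws) d \<Longrightarrow> b vs v ws \<in> gr V (d - 1)"
  shows "D\<^sub>b \<in> lin_deg (- 1) C C"
proof -
  have "D\<^sub>b x \<in> gr C (d - 1)" if x: "x \<in> gr C d" for x d
  proof (rule linear_on_gr_Diass[OF _ D_linear_on _ _ x])
    fix vs v ws assume vw: "word_degree V (vs @ v # ws) d"
    then have "vs \<in> words" "v \<in> carr V" "ws \<in> words"
      using word_degree_lists[OF vw] by simp_all
    then show "D\<^sub>b (mword V vs v ws) \<in> gr C (d - 1)"
      using coder_value_degree[OF deg vw] by (simp add: D_mword)
  qed (simp_all add: subspace_gr_Diass)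
  then show ?thesis unfolding lin_deg_def using coder_of_lin[OF b] by simp
qed

lemma coder_of_Coder:
  assumes deg: "\<And>vs v ws d. word_degree V (vs @ v # ws) d \<Longrightarrow> b vs v ws \<in> gr V (d - 1)"
  shows "D\<^sub>b \<in> Coder (- 1) C (coprod1 V) (coprod2 V)"
proof -
  note tm = tmap(1)[OF \<sigma>(1) D_linear_on] tmap(1)[OF D_linear_on linear_on_id]
  have "\<Delta> (D\<^sub>b x) = tmap \<sigma> D\<^sub>b (\<Delta> x) + tmap D\<^sub>b (\<lambda>z. z) (\<Delta> x)"
    if \<Delta>: "linear_on C CC \<Delta>" and x: "x \<in> carr C" and eq: "\<And>vs v ws. vs \<in> words \<Longrightarrow> v \<in> carr V \<Longrightarrow>
      ws \<in> words \<Longrightarrow> \<Delta> (D\<^sub>b (mword V vs v ws)) =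
        tmap \<sigma> D\<^sub>b (\<Delta> (mword V vs v ws)) + tmap D\<^sub>b (\<lambda>z. z) (\<Delta> (mword V vs v ws))" for \<Delta> x
    by (rule Diass_eqI[where Z = CC and f = "\<lambda>x. \<Delta> (D\<^sub>b x)" and
          g = "\<lambda>x. tmap \<sigma> D\<^sub>b (\<Delta> x) + tmap D\<^sub>b (\<lambda>z. z) (\<Delta> x)", OF V _ _ _ _ x])
      (simp_all add: linear_on_compose[OF D_linear_on \<Delta>] eq
        linear_on_add linear_on_compose[OF \<Delta> tm(1)] linear_on_compose[OF \<Delta> tm(2)])
  from this[OF coprod1(1) _ coder_of_coprod1] this[OF coprod2(1) _ coder_of_coprod2]
  show ?thesis using coder_of_degree[OF deg] unfolding Coder_iff by blast
qed

end



lemma \<sigma>_\<sigma>: "x \<in> carr C \<Longrightarrow> \<sigma> (\<sigma> x) = x"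
proof (rule Diass_eqI[where f = "\<lambda>x. \<sigma> (\<sigma> x)" and g = "\<lambda>x. x" and Z = C, OF V])
  show "\<sigma> (\<sigma> (mword V vs v ws)) = mword V vs v ws"
    if "vs \<in> words" "v \<in> carr V" "ws \<in> words" for vs v ws
  proof -
    have "map (\<tau> \<circ> \<tau>) w = w" if "w \<in> words" for w
      using that by (induction w) (simp_all add: parity_parity)
    then show ?thesis using that by (simp add: \<sigma> parity_parity)
  qed
qed (simp_all add: linear_on_id linear_on_compose[OF \<sigma>(1) \<sigma>(1)])

lemma \<sigma>_anticommutes:
  assumes D: "D \<in> lin_deg (- 1) C C" and x: "x \<in> carr C"
  shows "\<sigma> (D x) = - D (\<sigma> x)"
proof -
  interpret M: vector_space "fscale :: 'k \<Rightarrow> ('k, 'v) diass \<Rightarrow> _" by simp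
  have lin: "linear_on C C D" using D by (simp add: lin_deg_def lin_linear_on)
  have 1: "linear_on C C (\<lambda>x. \<sigma> (D x))" by (rule linear_on_compose[OF lin \<sigma>(1)])
  have 2: "linear_on C C (\<lambda>x. - D (\<sigma> x))"
    by (rule linear_on_minus[OF _ linear_on_compose[OF \<sigma>(1) lin]]) simp
  show ?thesis
  proof (rule linear_on_eq_span[where S = "\<Union>i. gr C i", OF _ _ 1 2 _ _ x])
    fix y assume "y \<in> (\<Union>i. gr C i)"
    then obtain i where y: "y \<in> gr C i" by (rule UN_E)
    have "D y \<in> gr C (i - 1)" using D y by (simp add: lin_deg_def)
    then have "\<sigma> (D y) = fscale (sgnp (i - 1)) (D y)" by (rule \<sigma>_gr)
    also have "sgnp (i - 1) = - (sgnp i :: 'k)" by (cases "even i") (simp_all add: sgnp_even sgnp_odd)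
    also have "fscale (- sgnp i) (D y) = - D (fscale (sgnp i) y)"
      using linear_onD(3)[OF lin, of y "sgnp i"] carr_closed(6)[OF _ y] by simp
    finally show "\<sigma> (D y) = - D (\<sigma> y)" by (simp only: \<sigma>_gr[OF y])
  qed (simp_all add: carr_def)
qed

text \<open>The square of a coderivation of degree \<open>-1\<close> is a coderivation without signs: the two mixed
  terms cancel, because \<open>\<sigma>\<close> anticommutes with maps of odd degree.\<close>

lemma coderivation_square:
  assumes D: "D \<in> lin_deg (- 1) C C" and \<Delta>: "linear_on C CC \<Delta>"
    and co: "\<And>x. x \<in> carr C \<Longrightarrow> \<Delta> (D x) = tmap \<sigma> D (\<Delta> x) + tmap D (\<lambda>z. z) (\<Delta> x)" and x: "x \<in> carr C"
  shows "\<Delta> (D (D x)) = tmap (\<lambda>z. z) (\<lambda>z. D (D z)) (\<Delta> x) + tmap (\<lambda>z. D (D z)) (\<lambda>z. z) (\<Delta> x)"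
proof -
  have lin: "linear_on C C D" using D by (simp add: lin_deg_def lin_linear_on)
  note lin2 = linear_on_compose[OF lin lin]
  note Dc = linear_onD(1)[OF lin] and \<sigma>c = linear_onD(1)[OF \<sigma>(1)]
  note tm = tmap(1)[OF \<sigma>(1) lin] tmap(1)[OF lin linear_on_id]
    tmap(1)[OF linear_on_id lin2] tmap(1)[OF lin2 linear_on_id]
  let ?T = "\<lambda>t. tmap \<sigma> D t + tmap D (\<lambda>z. z) t"
  have T: "linear_on CC CC ?T" by (intro linear_on_add tm) simp
  have t: "\<Delta> x \<in> carr CC" using linear_onD(1)[OF \<Delta> x] .
  have "?T (?T (\<Delta> x)) = tmap (\<lambda>z. z) (\<lambda>z. D (D z)) (\<Delta> x) + tmap (\<lambda>z. D (D z)) (\<lambda>z. z) (\<Delta> x)"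
  proof (rule tensor_eqI[where f = "\<lambda>t. ?T (?T t)" and
        g = "\<lambda>t. tmap (\<lambda>z. z) (\<lambda>z. D (D z)) t + tmap (\<lambda>z. D (D z)) (\<lambda>z. z) t" and Z = CC, OF _ _ _ _ _ _ t])
    show "linear_on CC CC (\<lambda>t. ?T (?T t))" by (rule linear_on_compose[OF T T])
    show "linear_on CC CC (\<lambda>t. tmap (\<lambda>z. z) (\<lambda>z. D (D z)) t + tmap (\<lambda>z. D (D z)) (\<lambda>z. z) t)"
      by (intro linear_on_add tm) simp
    fix x y assume xy: "x \<in> carr C" "y \<in> carr C"
    note c = xy \<sigma>c[OF xy(1)] Dc[OF xy(1)] Dc[OF xy(2)] Dc[OF \<sigma>c[OF xy(1)]]
    note tD = tmap(2)[OF \<sigma>(1) lin] tmap(2)[OF lin linear_on_id]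
    have 1: "?T (tn (\<sigma> x) (D y) + tn (D x) y) = ?T (tn (\<sigma> x) (D y)) + ?T (tn (D x) y)"
      by (rule linear_onD(2)[OF T]) (intro tns_in_carr c vector_space_smul_tensors)+
    have 2: "tn (- D (\<sigma> x)) (D y) = - tn (D (\<sigma> x)) (D y)"
      by (rule linear_on_uminus[OF _ _ linear_on_tns(1)]) (intro c vector_space_smul_tensors)+
    show "?T (?T (tn x y)) =
        tmap (\<lambda>z. z) (\<lambda>z. D (D z)) (tn x y) + tmap (\<lambda>z. D (D z)) (\<lambda>z. z) (tn x y)"
      unfolding tD[OF xy] 1 tD[OF c(3,5)] tD[OF c(4,2)] \<sigma>_\<sigma>[OF xy(1)] \<sigma>_anticommutes[OF D xy(1)] 2
        tmap(2)[OF linear_on_id lin2 xy] tmap(2)[OF lin2 linear_on_id xy]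
      by (simp only: add.assoc add_minus_cancel)
  qed simp_all
  then show ?thesis unfolding co[OF Dc[OF x]] co[OF x] .
qed

text \<open>It suffices to consider homogeneous words, because the projection of the square is linear and
  homogeneous marked words span.\<close>

lemma Coder_square_zero_iff:
  assumes D: "D \<in> Coder (- 1) C (coprod1 V) (coprod2 V)"
  shows "(\<forall>x\<in>carr C. D (D x) = 0) \<longleftrightarrow>
    (\<forall>vs v ws d. word_degree V (vs @ v # ws) d \<longrightarrow> proj V (D (D (mword V vs v ws))) = 0)" (is "?l \<longleftrightarrow> ?r")
proof
  assume ?l
  show ?r
  proof (intro allI impI)
    fix vs v ws d assume "word_degree V (vs @ v # ws) d"
    then have "mword V vs v ws \<in> carr C" using carr_closed(6)[OF _ mword_gr] by simp
    then show "proj V (D (D (mword V vs v ws))) = 0"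
      using \<open>?l\<close> linear_on_0[OF _ V proj(1)] by simp
  qed
next
  assume r: ?r
  have deg: "D \<in> lin_deg (- 1) C C" using D by (simp add: Coder_iff)
  then have lin: "linear_on C C D" by (simp add: lin_deg_def lin_linear_on)
  note lin2 = linear_on_compose[OF lin lin]
  note pr = linear_on_compose[OF lin2 proj(1)]
  have "proj V (D (D x)) = 0" if x: "x \<in> carr C" for x
  proof (rule linear_on_eq_span[where S = "\<Union>i. gr C i" and f = "\<lambda>x. proj V (D (D x))" and g = "\<lambda>x. 0",
        OF _ V pr linear_on_zero[OF V] _ _ x])
    interpret vector_space "smul V" by (rule V)
    fix y assume "y \<in> (\<Union>i. gr C i)"
    then obtain i where y: "y \<in> gr C i" by (rule UN_E)
    have "proj V (D (D y)) \<in> {0}"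
      by (rule linear_on_gr_Diass[OF V pr _ _ y]) (use r in auto)
    then show "proj V (D (D y)) = 0" by simp
  qed (simp_all add: carr_def)
  note pr0 = this
  have co: "coprod1 V (D x) = tmap \<sigma> D (coprod1 V x) + tmap D (\<lambda>z. z) (coprod1 V x)"
    "coprod2 V (D x) = tmap \<sigma> D (coprod2 V x) + tmap D (\<lambda>z. z) (coprod2 V x)" if "x \<in> carr C" for x
    using D that unfolding Coder_iff by blast+
  have "D (D x) = 0" if "x \<in> carr C" for x
    by (rule coderivation_unique[OF lin2 linear_on_id coderivation_square[where D = D and \<Delta> = "coprod1 V", OF deg coprod1(1) co(1)]
          coderivation_square[where D = D and \<Delta> = "coprod2 V", OF deg coprod2(1) co(2)] pr0 that]) (simp_all add: V)
  then show ?l by blast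
qed

lemma Coder_eqI:
  assumes D: "D \<in> Coder (- 1) C (coprod1 V) (coprod2 V)" and D': "D' \<in> Coder (- 1) C (coprod1 V) (coprod2 V)"
    and pr: "\<And>vs v ws. vs \<in> words \<Longrightarrow> v \<in> carr V \<Longrightarrow> ws \<in> words \<Longrightarrow>
      proj V (D (mword V vs v ws)) = proj V (D' (mword V vs v ws))"
  shows "D = D'"
proof (rule extensionalityI)
  have l: "D \<in> lin C C" "D' \<in> lin C C" using D D' by (auto simp: Coder_iff lin_deg_def)
  then show "D \<in> extensional (carr C)" "D' \<in> extensional (carr C)" by (auto simp: lin_iff)
  note lin = l[THEN lin_linear_on]
  define E where "E x = D x - D' x" for x
  have E: "linear_on C C E" unfolding E_def by (rule linear_on_diff[OF _ lin]) simp
  have Dc [simp]: "D y \<in> carr C" "D' y \<in> carr C" if "y \<in> carr C" for y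
    using linear_onD(1)[OF lin(1) that] linear_onD(1)[OF lin(2) that] by simp_all
  have diff: "h (E x) = h (D x) - h (D' x)"
    if h: "linear_on C Z h" and Z: "vector_space (smul Z)" and x: "x \<in> carr C"
    for h :: "_ \<Rightarrow> 'z::ab_group_add" and Z x
  proof -
    have 1: "h (D x + - D' x) = h (D x) + h (- D' x)"
      by (rule linear_onD(2)[OF h]) (simp_all add: x carr_closed(4)[of C])
    have 2: "h (- D' x) = - h (D' x)"
      by (rule linear_on_uminus[OF _ Z h]) (simp_all add: x)
    show ?thesis using 1 unfolding 2 by (simp add: E_def)
  qed
  have tm: "tmap f E t = tmap f D t - tmap f D' t" "tmap E f t = tmap D f t - tmap D' f t"
    if f: "linear_on C C f" and t: "t \<in> carr CC" for f t
  proof -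
    have fc: "f y \<in> carr C" if "y \<in> carr C" for y using linear_onD(1)[OF f that] .
    have 1: "linear_on CC CC (\<lambda>t. tmap f D t - tmap f D' t)"
      by (intro linear_on_diff tmap(1) f lin) simp
    have 2: "linear_on CC CC (\<lambda>t. tmap D f t - tmap D' f t)"
      by (intro linear_on_diff tmap(1) f lin) simp
    show "tmap f E t = tmap f D t - tmap f D' t"
    proof (rule tensor_eqI[OF _ _ _ tmap(1)[OF f E] 1 _ t])
      fix x y assume xy: "x \<in> carr C" "y \<in> carr C"
      show "tmap f E (tn x y) = tmap f D (tn x y) - tmap f D' (tn x y)"
        unfolding tmap(2)[OF f E xy] tmap(2)[OF f lin(1) xy] tmap(2)[OF f lin(2) xy]
        by (rule diff[OF linear_on_tns(2)[OF _ _ fc[OF xy(1)]] _ xy(2)]) simp_all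
    qed simp_all
    show "tmap E f t = tmap D f t - tmap D' f t"
    proof (rule tensor_eqI[OF _ _ _ tmap(1)[OF E f] 2 _ t])
      fix x y assume xy: "x \<in> carr C" "y \<in> carr C"
      show "tmap E f (tn x y) = tmap D f (tn x y) - tmap D' f (tn x y)"
        unfolding tmap(2)[OF E f xy] tmap(2)[OF lin(1) f xy] tmap(2)[OF lin(2) f xy]
        by (rule diff[OF linear_on_tns(1)[OF _ _ fc[OF xy(2)]] _ xy(1)]) simp_all
    qed simp_all
  qed
  fix x assume x: "x \<in> carr C"
  have "E x = 0"
  proof (rule coderivation_unique[OF E \<sigma>(1) _ _ _ x])
    fix y assume y: "y \<in> carr C"
    have t: "coprod1 V y \<in> carr CC" "coprod2 V y \<in> carr CC"
      using linear_onD(1)[OF coprod1(1) y] linear_onD(1)[OF coprod2(1) y] .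
    show "coprod1 V (E y) = tmap \<sigma> E (coprod1 V y) + tmap E (\<lambda>x. x) (coprod1 V y)"
      using D D' y t
      by (simp add: diff[OF coprod1(1)] algebra_simps tm[OF \<sigma>(1)] tm[OF linear_on_id] Coder_iff)
    show "coprod2 V (E y) = tmap \<sigma> E (coprod2 V y) + tmap E (\<lambda>x. x) (coprod2 V y)"
      using D D' y t
      by (simp add: diff[OF coprod2(1)] algebra_simps tm[OF \<sigma>(1)] tm[OF linear_on_id] Coder_iff)
  next
    fix vs v ws assume "vs \<in> words" "v \<in> carr V" "ws \<in> words"
    then show "proj V (E (mword V vs v ws)) = 0"
      by (simp add: diff[OF proj(1) V] V pr)
  qed
  then show "D x = D' x" by (simp add: E_def)
qed

text \<open>The projection of the square of \<open>coder_of b\<close> to the cogenerators.\<close>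

definition square_proj :: "('v list \<Rightarrow> 'v \<Rightarrow> 'v list \<Rightarrow> 'v) \<Rightarrow> 'v list \<Rightarrow> 'v \<Rightarrow> 'v list \<Rightarrow> 'v" where
  "square_proj b vs v ws =
     cuts3 (\<lambda>x y z. b (map \<tau> x @ letters b y # z) v ws) vs +
     cuts3 (\<lambda>x y z. b (map \<tau> vs) (\<tau> v) (map \<tau> x @ letters b y # z)) ws +
     cuts (\<lambda>x y. cuts (\<lambda>y' z. b (map \<tau> x) (b y v y') z) ws) vs"

lemma proj_square:
  assumes b: "marked_multilinear V V b"
    and w: "vs \<in> words" "v \<in> carr V" "ws \<in> words"
  shows "proj V (coder_of b (coder_of b (mword V vs v ws))) = square_proj b vs v ws"
proof -
  note [simp] = V w b_in_carr[OF b] letters_b_in_carr[OF b] proj_coder_of[OF b]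
  have h: "linear_on C V (\<lambda>x. proj V (coder_of b x))"
    by (rule linear_on_compose[OF coder_of_linear_on[OF b] proj(1)])
  show ?thesis
    unfolding linear_on_D_mword[OF b V h w] square_proj_def
    by (intro arg_cong2[where f = "(+)"] cuts3_cong_lists[OF w(1)] cuts3_cong_lists[OF w(3)]
        cuts_cong_lists[OF w(1)] cuts_cong_lists[OF w(3)]) simp_all
qed

end

section \<open>Signs and the relations of operations\<close>

text \<open>The exponent of the Koszul sign of \<open>(s\<inverse>)\<^sup>\<otimes>\<^sup>k\<close> on letters whose degrees in the suspension are \<open>ds\<close>.\<close>

primrec desusp_exp :: "int list \<Rightarrow> int" where
  "desusp_exp [] = 0"
| "desusp_exp (d # ds) = int (length ds) * d + desusp_exp ds"

lemma desusp_exp_append: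
  "desusp_exp (ds @ es) = desusp_exp ds + int (length es) * sum_list ds + desusp_exp es"
  by (induction ds) (auto simp: algebra_simps)

lemma desusp_exp_sum: "desusp_exp ds = (\<Sum>p<length ds. int (length ds - 1 - p) * ds ! p)"
  by (induction ds) (auto simp: sum.lessThan_Suc_shift simp del: sum.lessThan_Suc)

text \<open>If the terms with empty middle part vanish, a sum over \<open>w = xyz\<close> is a sum over the length \<open>i\<close> of \<open>y\<close>, the
  length \<open>j\<close> of the word in which \<open>y\<close> is replaced by a letter, and the position \<open>l\<close> of this letter.\<close>

lemma cuts3_eq_sum:
  assumes "\<And>x z. w = x @ z \<Longrightarrow> F x [] z = 0"
  shows "cuts3 F w = (\<Sum>(i, j)\<in>{(i, j). 1 \<le> i \<and> 1 \<le> j \<and> i + j = length w + 1}.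
    \<Sum>l=1..j. F (take (l - 1) w) (take i (drop (l - 1) w)) (drop (l + i - 1) w))"
proof -
  let ?n = "length w"
  let ?F = "\<lambda>k m. F (take k w) (take m (drop k w)) (drop (k + m) w)"
  let ?I = "{(i, j). 1 \<le> i \<and> 1 \<le> j \<and> i + j = ?n + 1}"
  have fin: "finite ?I" by (rule finite_subset[of _ "{..?n + 1} \<times> {..?n + 1}"]) auto
  have "cuts3 F w = (\<Sum>k\<le>?n. \<Sum>m\<le>?n - k. ?F k m)"
    by (simp add: cuts3_def cuts_def add.commute)
  also have "\<dots> = (\<Sum>(k, m)\<in>Sigma {..?n} (\<lambda>k. {..?n - k}). ?F k m)"
    by (simp add: sum.Sigma)
  also have "\<dots> = (\<Sum>(k, m)\<in>Sigma {..?n} (\<lambda>k. {1..?n - k}). ?F k m)"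
    by (rule sum.mono_neutral_right) (auto simp: assms[of "take _ w" "drop _ w"] Suc_le_eq intro!: gr0I)
  also have "\<dots> = (\<Sum>(p, l)\<in>Sigma ?I (\<lambda>p. {1..snd p}). ?F (l - 1) (fst p))"
    by (rule sum.reindex_bij_witness[where j = "\<lambda>(k, m). ((m, ?n + 1 - m), k + 1)" and
          i = "\<lambda>(p, l). (l - 1, fst p)"]) auto
  also have "\<dots> = (\<Sum>p\<in>?I. \<Sum>l=1..snd p. ?F (l - 1) (fst p))"
    by (rule sum.Sigma[symmetric]) (use fin in auto)
  also have "\<dots> = (\<Sum>p\<in>?I. \<Sum>l=1..snd p. F (take (l - 1) w) (take (fst p) (drop (l - 1) w)) (drop (l + fst p - 1) w))"
    by (intro sum.cong refl) simp
  finally show ?thesis by (simp only: case_prod_unfold)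
qed

lemma sum_symb_apply: "(\<Sum>t=1..i. symb t) r = (if 1 \<le> r \<and> r \<le> i then 1 else 0)"
proof -
  have "(\<Sum>t\<in>T. symb t) r = (\<Sum>t\<in>T. symb t r)" if "finite T" for T
    using that by (induction T) simp_all
  from this[of "{1..i}"] show ?thesis by (simp add: symb_def)
qed

context graded_gspace
begin

text \<open>\<open>sign_scaled w e w'\<close>: the word \<open>w'\<close> arises from \<open>w\<close> by multiplying each letter by a sign, the product of
  these signs being \<open>(-1)\<^sup>e\<close>.\<close>

inductive sign_scaled :: "'v list \<Rightarrow> int \<Rightarrow> 'v list \<Rightarrow> bool" where
  Nil: "sign_scaled [] 0 []"
| Cons: "sign_scaled w e w' \<Longrightarrow> b = smul V (sgnp d) a \<Longrightarrow> f = d + e \<Longrightarrow> sign_scaled (a # w) f (b # w')"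

lemma sign_scaled_refl: "sign_scaled w 0 w"
proof (induction w)
  case (Cons a w)
  interpret vector_space "smul V" by (rule V)
  show ?case by (rule sign_scaled.Cons[OF Cons, where d = 0]) (simp_all add: sgnp_even)
qed (rule sign_scaled.Nil)

lemma sign_scaled_append: "sign_scaled u d u' \<Longrightarrow> sign_scaled w e w' \<Longrightarrow> sign_scaled (u @ w) (d + e) (u' @ w')"
proof (induction rule: sign_scaled.induct)
  case (Cons u e1 u' b d a f)
  have "f + e = d + (e1 + e)" using Cons.hyps by simp
  from sign_scaled.Cons[OF Cons.IH[OF Cons.prems] Cons.hyps(2) this] show ?case by simp
qed simp

inductive_cases sign_scaled_ConsE: "sign_scaled (a # w) e w''"

lemma sign_scaled_trans: "sign_scaled w d w' \<Longrightarrow> sign_scaled w' e w'' \<Longrightarrow> sign_scaled w (d + e) w''"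
proof (induction arbitrary: e w'' rule: sign_scaled.induct)
  case (Cons w e1 w' b d a f)
  interpret vector_space "smul V" by (rule V)
  from Cons.prems show ?case
  proof (rule sign_scaled_ConsE)
    fix w2 e2 d2
    assume *: "w'' = smul V (sgnp d2) b # w2" "sign_scaled w' e2 w2" "e = d2 + e2"
    show "sign_scaled (a # w) (f + e) w''"
      unfolding *(1)
      by (rule sign_scaled.Cons[where d = "d + d2", OF Cons.IH[OF *(2)]])
        (simp_all add: * Cons.hyps sgnp_add mult.commute)
  qed
qed simp

lemma sign_scaled_homog: "sign_scaled w e w' \<Longrightarrow> homog V w ds \<Longrightarrow> homog V w' ds"
  unfolding homog_def
  by (induction arbitrary: ds rule: sign_scaled.induct)
    (auto simp: list_all2_Cons1 intro: module.subspace_scale[OF module_V subspace_gr])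

lemma sign_scaled_apply:
  assumes "sign_scaled w e w'" "us \<in> words" "w \<in> words" "length us + length w = n"
    and G: "\<And>us a ws. us \<in> words \<Longrightarrow> ws \<in> words \<Longrightarrow> length us + 1 + length ws = n \<Longrightarrow>
      linear_on V V (\<lambda>a. G (us @ a # ws))"
  shows "G (us @ w') = smul V (sgnp e) (G (us @ w))"
  using assms(1-4)
proof (induction arbitrary: us rule: sign_scaled.induct)
  case Nil
  interpret vector_space "smul V" by (rule V)
  show ?case by (simp add: sgnp_even)
next
  case (Cons w e w' b d a f)
  interpret vector_space "smul V" by (rule V)
  have c: "a \<in> carr V" "w \<in> words" using Cons.prems by simp_all
  have "G ((us @ [b]) @ w') = smul V (sgnp e) (G ((us @ [b]) @ w))"
    by (rule Cons.IH) (use Cons.prems Cons.hyps carr_closed(3)[OF V] in simp_all)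
  also have "G ((us @ [b]) @ w) = smul V (sgnp d) (G (us @ a # w))"
    using linear_onD(3)[OF G[OF Cons.prems(1) c(2)] c(1)] Cons.prems Cons.hyps by simp
  finally show ?case using Cons.hyps by (simp add: sgnp_add mult.commute)
qed

lemma sign_scaled_map_parity: "homog V w ds \<Longrightarrow> sign_scaled w (sum_list ds) (map \<tau> w)"
  unfolding homog_def
  by (induction rule: list_all2_induct) (auto intro!: sign_scaled.intros simp: parity)

lemma parity_pow_in_carr [simp]: "a \<in> carr V \<Longrightarrow> (\<tau> ^^ n) a \<in> carr V"
  by (induction n) simp_all

lemma linear_on_parity_pow: "linear_on V V (\<tau> ^^ n)"
proof (induction n)
  case (Suc n)
  then show ?case using linear_on_compose[OF Suc parity(1)] by (simp add: comp_def)
qed (simp add: id_def linear_on_id)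

lemma parity_pow_gr: "a \<in> gr V d \<Longrightarrow> (\<tau> ^^ n) a = smul V (sgnp (int n * d)) a"
proof (induction n)
  case 0
  interpret vector_space "smul V" by (rule V)
  show ?case by (simp add: sgnp_even)
next
  case (Suc n)
  interpret vector_space "smul V" by (rule V)
  have e: "sgnp (int (Suc n) * d) = sgnp (int n * d) * (sgnp d :: 'k)"
    by (simp add: sgnp_add[symmetric] algebra_simps)
  show ?case
    unfolding e
    using Suc carr_closed(6)[OF V Suc.prems] linear_onD(3)[OF parity(1)] by (simp add: parity(2))
qed

lemma parity_pow_twice: "a \<in> carr V \<Longrightarrow> (\<tau> ^^ n) ((\<tau> ^^ n) a) = a"
proof (induction n)
  case (Suc n)
  then show ?case by (simp add: funpow_swap1[symmetric] parity_parity)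
qed simp

text \<open>The map \<open>(s\<inverse>)\<^sup>\<otimes>\<^sup>k\<close> with its Koszul sign, for letters that need not be homogeneous: the parity
  operator is applied to each letter as often as there are letters to its right.\<close>

primrec desusp :: "'v list \<Rightarrow> 'v list" where
  "desusp [] = []"
| "desusp (a # w) = (\<tau> ^^ length w) a # desusp w"

lemma length_desusp [simp]: "length (desusp w) = length w"
  by (induction w) simp_all

lemma desusp_in_lists [simp]: "w \<in> words \<Longrightarrow> desusp w \<in> words"
  by (induction w) simp_all

lemma desusp_desusp: "w \<in> words \<Longrightarrow> desusp (desusp w) = w"
  by (induction w) (simp_all add: parity_pow_twice)

lemma desusp_append: "desusp (u @ w) = map (\<tau> ^^ length w) (desusp u) @ desusp w"
  by (induction u) (simp_all add: funpow_add add.commute[of _ "length w"])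

lemma linear_word_desusp:
  assumes "linear_word V L" shows "linear_word V (\<lambda>a. desusp (L a))"
proof -
  obtain us ws h where L: "us \<in> words" "ws \<in> words" "linear_on V V h"
    "\<And>a. L a = us @ h a # ws" using assms unfolding linear_word_def by blast
  have m: "map (\<tau> ^^ n) w \<in> words" if "w \<in> words" for w n
    using that by (induction w) simp_all
  show ?thesis
    by (rule linear_wordI[where us = "map (\<tau> ^^ Suc (length ws)) (desusp us)" and ws = "desusp ws" and
          h = "\<lambda>a. (\<tau> ^^ length ws) (h a)"])
      (simp_all only: L(4) desusp_append desusp.simps list.size add_0_right add_Suc_right m desusp_in_lists L(1,2)
        linear_on_compose[OF L(3) linear_on_parity_pow])
qed

lemma sign_scaled_desusp: "homog V w ds \<Longrightarrow> sign_scaled w (desusp_exp ds) (desusp w)"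
  unfolding homog_def
  by (induction rule: list_all2_induct)
    (auto intro!: sign_scaled.intros simp: parity_pow_gr dest: list_all2_lengthD)

text \<open>The function of marked words that corresponds to a family \<open>\<mu>\<close> of operations.  The mark is in position
  \<open>length vs + 1\<close>, since symbols are counted from 1.\<close>

definition marked_op :: "(nat \<Rightarrow> nat \<Rightarrow> 'v list \<Rightarrow> 'v) \<Rightarrow> 'v list \<Rightarrow> 'v \<Rightarrow> 'v list \<Rightarrow> 'v" where
  "marked_op \<mu> vs v ws = \<mu> (length vs + 1 + length ws) (length vs + 1) (desusp (vs @ v # ws))"

context
  fixes \<mu> :: "nat \<Rightarrow> nat \<Rightarrow> 'v list \<Rightarrow> 'v"
  assumes \<mu>: "\<And>k r. r \<in> {1..k} \<Longrightarrow> multilinear_map k V V (\<mu> k r)"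
begin

lemma op_in_carr: "w \<in> words \<Longrightarrow> r \<in> {1..length w} \<Longrightarrow> \<mu> (length w) r w \<in> carr V"
  using \<mu>[of r "length w"] by (auto simp: multilinear_map_def)

lemma op_linear:
  assumes "us \<in> words" "ws \<in> words" "length us + 1 + length ws = k" "r \<in> {1..k}"
  shows "linear_on V V (\<lambda>a. \<mu> k r (us @ a # ws))"
proof (rule linear_onI)
  show "\<mu> k r (us @ x # ws) \<in> carr V" if "x \<in> carr V" for x
    using op_in_carr[of "us @ x # ws" r] assms that by simp
qed (use \<mu>[OF assms(4)] assms in \<open>auto simp: multilinear_map_def\<close>)

lemma op_linear_word:
  assumes "linear_word V L" "length (L 0) = k" "r \<in> {1..k}"
  shows "linear_on V V (\<lambda>a. \<mu> k r (L a))"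
proof -
  obtain us ws h where L: "us \<in> words" "ws \<in> words" "linear_on V V h"
    "\<And>a. L a = us @ h a # ws" using assms(1) unfolding linear_word_def by blast
  have "linear_on V V (\<lambda>a. \<mu> k r (us @ a # ws))"
    by (rule op_linear[OF L(1,2)]) (use assms L(4) in auto)
  from linear_on_compose[OF L(3) this] show ?thesis by (simp add: L(4))
qed

lemma marked_op_multilinear: "marked_multilinear V V (marked_op \<mu>)"
  unfolding marked_op_def
  by (rule marked_multilinearI; (simp only: length_append list.size)?)
    (intro op_linear_word linear_word_desusp linear_word_intros; simp)+

lemma extend_lin_all:
  "extend_lin V \<mu> i (\<Sum>t=1..i. symb t) w = (\<Sum>r=1..i. \<mu> i r w)"
proof -
  interpret vector_space "smul V" by (rule V)
  show ?thesis unfolding extend_lin_def by (intro sum.cong refl, subst sum_symb_apply) simp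
qed

lemma extend_lin_symb:
  assumes "r \<in> {1..i}" shows "extend_lin V \<mu> i (symb r) w = \<mu> i r w"
proof -
  interpret vector_space "smul V" by (rule V)
  have "extend_lin V \<mu> i (symb r) w = (\<Sum>t=1..i. if t = r then \<mu> i r w else 0)"
    unfolding extend_lin_def by (intro sum.cong refl) (simp add: symb_def)
  then show ?thesis using assms by simp
qed

lemma letters_marked_op: "letters (marked_op \<mu>) y = extend_lin V \<mu> (length y) (\<Sum>t=1..length y. symb t) (desusp y)"
proof -
  have "letters (marked_op \<mu>) y = (\<Sum>k<length y. \<mu> (length y) (k + 1) (desusp y))"
    unfolding letters_def marked_op_def
  proof (intro sum.cong refl)
    fix k assume "k \<in> {..<length y}"
    then have k: "k < length y" "Suc (length y - Suc 0) = length y" by auto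
    then show "\<mu> (length (take k y) + 1 + length (drop (Suc k) y)) (length (take k y) + 1)
        (desusp (take k y @ y ! k # drop (Suc k) y)) = \<mu> (length y) (k + 1) (desusp y)"
      by (subst id_take_nth_drop[symmetric]) (simp_all add: Suc_diff_Suc)
  qed
  also have "\<dots> = (\<Sum>r=1..length y. \<mu> (length y) r (desusp y))"
    by (rule sum.reindex_bij_witness[where i = "\<lambda>r. r - 1" and j = "\<lambda>k. k + 1"]) auto
  finally show ?thesis by (simp only: extend_lin_all)
qed

text \<open>The operation indexed by \<open>R0\<close>, applied to a word in which the operation indexed by \<open>R\<close> has
  been applied to the subword \<open>y\<close>.\<close>

definition dend_term :: "nat \<Rightarrow> 'v list \<Rightarrow> 'v list \<Rightarrow> 'v list \<Rightarrow> 'v" where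
  "dend_term r x y z = \<mu> (length x + 1 + length z) (R0 (length x + 1 + length z) (length y) (length x + 1) r)
     (desusp (map \<tau> x @ extend_lin V \<mu> (length y) (R (length x + 1 + length z) (length y) (length x + 1) r) (desusp y) # z))"

text \<open>The three sums in \<open>square_proj\<close> are those over the subwords to the left of the mark, to the right of it, and
  around it.  In the first two cases \<open>R\<close> is the sum of all symbols, in the last case it is the position of the
  mark in the subword.\<close>

lemma square_proj_marked_op:
  "square_proj (marked_op \<mu>) vs v ws = cuts3 (dend_term (length vs + 1)) (vs @ v # ws)"
proof -
  have 1: "marked_op \<mu> (map \<tau> x @ letters (marked_op \<mu>) y # z) v ws = dend_term (length vs + 1) x y (z @ v # ws)"
    if "vs = x @ y @ z" for x y z
    unfolding dend_term_def letters_marked_op using that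
    by (simp add: marked_op_def R0_def R_def add.assoc)
  have 2: "marked_op \<mu> (map \<tau> x) (marked_op \<mu> y v y') z = dend_term (length vs + 1) x (y @ v # y') z"
    if "vs = x @ y" for x y y' z
    unfolding dend_term_def using that
    by (simp add: marked_op_def R0_def R_def extend_lin_symb)
  have 3: "marked_op \<mu> (map \<tau> vs) (\<tau> v) (map \<tau> x @ letters (marked_op \<mu>) y # z) =
      dend_term (length vs + 1) (vs @ v # x) y z" for x y z
    unfolding dend_term_def letters_marked_op by (simp add: marked_op_def R0_def R_def add.assoc)
  have "cuts3 (\<lambda>x y z. marked_op \<mu> (map \<tau> x @ letters (marked_op \<mu>) y # z) v ws) vs =
      cuts3 (\<lambda>x y z. dend_term (length vs + 1) x y (z @ v # ws)) vs"
    unfolding cuts3_def cuts_def by (intro sum.cong refl 1) (simp del: drop_drop)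
  moreover have "cuts (\<lambda>x y. cuts (\<lambda>y' z. marked_op \<mu> (map \<tau> x) (marked_op \<mu> y v y') z) ws) vs =
      cuts (\<lambda>x y. cuts (\<lambda>y' z. dend_term (length vs + 1) x (y @ v # y') z) ws) vs"
    unfolding cuts_def by (intro sum.cong refl 2) simp
  ultimately show ?thesis
    unfolding square_proj_def cuts3_append_Cons 3 by (simp only: add_ac)
qed

lemma extend_lin_sign:
  assumes "sign_scaled y e y'" "y \<in> words"
  shows "extend_lin V \<mu> (length y) c y' = smul V (sgnp e) (extend_lin V \<mu> (length y) c y)"
proof -
  interpret vector_space "smul V" by (rule V)
  have "\<mu> (length y) r y' = smul V (sgnp e) (\<mu> (length y) r y)" if "r \<in> {1..length y}" for r
    using sign_scaled_apply[OF assms(1), of "[]" "length y" "\<mu> (length y) r"] op_linear that assms(2) by simp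
  then show ?thesis
    by (simp add: extend_lin_def scale_sum_right mult.commute)
qed

lemma dend_term_empty:
  assumes "x \<in> words" "z \<in> words" "r \<in> {1..length x + length z}"
  shows "dend_term r x [] z = 0"
proof -
  let ?j = "length x + 1 + length z" and ?r = "R0 (length x + 1 + length z) 0 (length x + 1) r"
  have "linear_on V V (\<lambda>a. \<mu> ?j ?r (desusp (map \<tau> x @ a # z)))"
    by (rule op_linear_word)
      (use assms in \<open>auto intro!: linear_word_desusp linear_word_intros simp: R0_def\<close>)
  from linear_on_0[OF V V this] show ?thesis by (simp add: dend_term_def extend_lin_def)
qed

context
  assumes \<mu>_gr: "\<And>r w ds. r \<in> {1..length w} \<Longrightarrow> homog V w ds \<Longrightarrow> \<mu> (length w) r w \<in> gr V (sum_list ds - 1)"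
begin

lemma marked_op_gr:
  assumes "word_degree V (vs @ v # ws) d" shows "marked_op \<mu> vs v ws \<in> gr V (d - 1)"
proof -
  obtain ds where ds: "homog V (vs @ v # ws) ds" "d = sum_list ds" using assms by (rule word_degreeE)
  have "homog V (desusp (vs @ v # ws)) ds"
    by (rule sign_scaled_homog[OF sign_scaled_desusp]) (rule ds)+
  then show ?thesis
    using \<mu>_gr[of "length vs + 1" "desusp (vs @ v # ws)" ds] by (simp add: marked_op_def ds(2))
qed

lemma extend_lin_gr:
  assumes "homog V y ds" shows "extend_lin V \<mu> (length y) c y \<in> gr V (sum_list ds - 1)"
  unfolding extend_lin_def
  by (intro module.subspace_sum[OF module_V subspace_gr] module.subspace_scale[OF module_V subspace_gr]
      \<mu>_gr assms)

text \<open>The sign of each summand is the one in the definition of a \<open>Dend\<^sub>\<infinity>\<close>-algebra, up to a factor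
  that depends only on the whole word.  The degrees \<open>dx\<close>, \<open>dy\<close>, \<open>dz\<close> are those in the suspension, so that
  \<open>sum_list dx - int (length x)\<close> is the sum of the original degrees of \<open>x\<close>.\<close>

lemma dend_term_sign:
  assumes h: "homog V x dx" "homog V y dy" "homog V z dz" and y: "y \<noteq> []"
    and r: "r \<in> {1..length x + length y + length z}"
  shows "dend_term r x y z =
    smul V (sgnp (desusp_exp (dx @ dy @ dz) + int (length x + length y + length z) + 1))
     (smul V (sgnp (int (length x + 1) * (int (length y) + 1) + int (length y) * (sum_list dx - int (length x))))
       (\<mu> (length x + 1 + length z) (R0 (length x + 1 + length z) (length y) (length x + 1) r)
         (x @ extend_lin V \<mu> (length y) (R (length x + 1 + length z) (length y) (length x + 1) r) y # z)))"
proof -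
  interpret vector_space "smul V" by (rule V)
  let ?j = "length x + 1 + length z"
  let ?r = "R0 ?j (length y) (length x + 1) r"
  let ?e = "extend_lin V \<mu> (length y) (R ?j (length y) (length x + 1) r)"
  have l: "x \<in> words" "y \<in> words" "z \<in> words"
    using h homog_lists[OF V] by blast+
  have len: "length dx = length x" "length dy = length y" "length dz = length z"
    using h by (simp_all add: homog_def list_all2_lengthD)
  have r': "?r \<in> {1..?j}" using r y by (cases y) (auto simp: R0_def)
  have e: "?e y \<in> gr V (sum_list dy - 1)" using h(2) by (rule extend_lin_gr)
  have 1: "sign_scaled (x @ ?e y # z) (sum_list dx + desusp_exp dy) (map \<tau> x @ ?e (desusp y) # z)"
    by (intro sign_scaled_append sign_scaled_map_parity h(1)
        sign_scaled.Cons[OF sign_scaled_refl extend_lin_sign[OF sign_scaled_desusp[OF h(2)] l(2)]]) simp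
  have h': "homog V (x @ ?e y # z) (dx @ (sum_list dy - 1) # dz)"
    using h e by (simp add: homog_def list_all2_appendI)
  note 2 = sign_scaled_trans[OF 1 sign_scaled_desusp[OF sign_scaled_homog[OF 1 h']]]
  let ?c = "sum_list dx + desusp_exp dy + desusp_exp (dx @ (sum_list dy - 1) # dz)"
  let ?d = "desusp_exp (dx @ dy @ dz) + int (length x + length y + length z) + 1 +
    (int (length x + 1) * (int (length y) + 1) + int (length y) * (sum_list dx - int (length x)))"
  have "dend_term r x y z = smul V (sgnp ?c) (\<mu> ?j ?r (x @ ?e y # z))"
    unfolding dend_term_def
    using sign_scaled_apply[OF 2, of "[]" ?j "\<mu> ?j ?r"] op_linear r' homog_lists[OF V h'] by simp
  also have "sgnp ?c = (sgnp ?d :: 'k)"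
  proof (rule sgnp_eqI)
    have "?c - ?d = 2 * - ((int (length y) - 1) * sum_list dx + int (length x) + int (length y) + int (length z) + 1)"
      by (simp add: desusp_exp_append len algebra_simps)
    then show "even (?c - ?d)" by (metis dvd_triv_left)
  qed
  finally show ?thesis by (simp only: sgnp_add scale_scale)
qed

lemma square_proj_sign:
  assumes h: "homog V (vs @ v # ws) ds"
  shows "square_proj (marked_op \<mu>) vs v ws = smul V (sgnp (desusp_exp ds + int (length ds) + 1))
    (\<Sum>(i, j)\<in>{(i, j). 1 \<le> i \<and> 1 \<le> j \<and> i + j = length ds + 1}. \<Sum>l=1..j.
       smul V (sgnp (int l * (int i + 1) + int i * (sum_list (take (l - 1) ds) - int (l - 1))))
        (\<mu> j (R0 j i l (length vs + 1))
          (take (l - 1) (vs @ v # ws) @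
           [extend_lin V \<mu> i (R j i l (length vs + 1)) (take i (drop (l - 1) (vs @ v # ws)))] @
           drop (l + i - 1) (vs @ v # ws))))"
proof -
  interpret vector_space "smul V" by (rule V)
  define w where "w = vs @ v # ws"
  define r where "r = length vs + 1"
  have r: "r \<in> {1..length w}" by (simp add: r_def w_def)
  have h: "homog V w ds" using h by (simp add: w_def)
  have len: "length ds = length w" using h by (simp add: homog_def list_all2_lengthD)
  have l: "w \<in> words" by (rule homog_lists[OF V h])
  define t where "t i j l = smul V (sgnp (int l * (int i + 1) + int i * (sum_list (take (l - 1) ds) - int (l - 1))))
    (\<mu> j (R0 j i l r) (take (l - 1) w @ [extend_lin V \<mu> i (R j i l r) (take i (drop (l - 1) w))] @
      drop (l + i - 1) w))" for i j l
  let ?I = "{(i, j). 1 \<le> i \<and> 1 \<le> j \<and> i + j = length w + 1}"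
  let ?c = "sgnp (desusp_exp ds + int (length ds) + 1)"
  have "square_proj (marked_op \<mu>) vs v ws = cuts3 (dend_term r) w"
    by (simp only: square_proj_marked_op r_def w_def)
  also have "\<dots> = (\<Sum>(i, j)\<in>?I. \<Sum>l=1..j. dend_term r (take (l - 1) w) (take i (drop (l - 1) w)) (drop (l + i - 1) w))"
    by (rule cuts3_eq_sum) (use l r in \<open>auto intro!: dend_term_empty\<close>)
  also have "\<dots> = (\<Sum>(i, j)\<in>?I. \<Sum>l=1..j. smul V ?c (t i j l))"
  proof (intro sum.cong refl, clarify, intro sum.cong refl)
    fix i j l assume ij: "1 \<le> i" "1 \<le> j" "i + j = length w + 1" "l \<in> {1..j}"
    define x y z where "x = take (l - 1) w" and "y = take i (drop (l - 1) w)" and "z = drop (l + i - 1) w"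
    define dx dy dz where "dx = take (l - 1) ds" and "dy = take i (drop (l - 1) ds)" and "dz = drop (l + i - 1) ds"
    have lens: "length x = l - 1" "length y = i" "length z = j - l" "length x + 1 = l"
      "length x + 1 + length z = j" "length x + length y + length z = length w"
      using ij by (auto simp: x_def y_def z_def)
    have hh: "homog V x dx" "homog V y dy" "homog V z dz"
      using h unfolding homog_def x_def y_def z_def dx_def dy_def dz_def
      by (auto intro: list_all2_takeI list_all2_dropI)
    have "dx @ dy @ dz = ds"
      using ij unfolding dx_def dy_def dz_def
      by (metis (no_types) append_take_drop_id atLeastAtMost_iff drop_drop add.commute
          Nat.add_diff_assoc2)
    moreover have "dend_term r x y z = smul V (sgnp (desusp_exp (dx @ dy @ dz) + int (length w) + 1))
     (smul V (sgnp (int l * (int i + 1) + int i * (sum_list dx - int (l - 1))))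
       (\<mu> j (R0 j i l r) (x @ [extend_lin V \<mu> i (R j i l r) y] @ z)))"
    proof -
      have "y \<noteq> []" using lens(2) ij(1) by auto
      from dend_term_sign[OF hh this, of r, unfolded lens(6), unfolded lens(5), unfolded lens(4),
          unfolded lens(1,2), OF r]
      show ?thesis by (simp only: append_Cons append_Nil)
    qed
    ultimately show "dend_term r (take (l - 1) w) (take i (drop (l - 1) w)) (drop (l + i - 1) w) = smul V ?c (t i j l)"
      by (simp only: t_def x_def y_def z_def dx_def len)
  qed
  also have "\<dots> = smul V ?c (\<Sum>(i, j)\<in>?I. \<Sum>l=1..j. t i j l)"
    by (simp only: scale_sum_right case_prod_unfold)
  finally show ?thesis unfolding t_def len w_def r_def .
qed

end

end

end

section \<open>Operations from coderivations\<close>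

context graded_gspace
begin

lemma linear_on_split_word:
  assumes F: "marked_multilinear V Z F" and "linear_word V L" "1 \<le> r" "r \<le> length (L 0)"
  shows "linear_on V Z (\<lambda>a. F (take (r - 1) (L a)) (L a ! (r - 1)) (drop r (L a)))"
proof -
  obtain us ws h where L: "us \<in> words" "ws \<in> words" "linear_on V V h"
    "\<And>a. L a = us @ h a # ws" using assms(2) unfolding linear_word_def by blast
  consider (left) "r - 1 < length us" | (mid) "r - 1 = length us" | (right) "length us < r - 1" by linarith
  then show ?thesis
  proof cases
    case left
    define u1 c u2 where "u1 = take (r - 1) us" and "c = us ! (r - 1)" and "u2 = drop r us"
    have us: "us = u1 @ c # u2"
      using id_take_nth_drop[OF left] assms(3) by (simp add: u1_def c_def u2_def)
    have "linear_on V Z (\<lambda>a. F u1 c (u2 @ h a # ws))"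
      by (rule marked_multilinearD(3)[OF F]) (use L us in \<open>auto intro!: linear_word_intros\<close>)
    moreover have "take (r - 1) (us @ w) = u1" "(us @ w) ! (r - 1) = c" "drop r (us @ w) = u2 @ w" for w
      using left by (simp_all add: u1_def c_def u2_def nth_append)
    ultimately show ?thesis by (simp only: L(4))
  next
    case mid
    have "linear_on V Z (\<lambda>a. F us (h a) ws)"
      by (rule marked_multilinearD(1)[OF F L(3) L(1,2)])
    moreover have "r = Suc (length us)" using mid assms(3) by simp
    ultimately show ?thesis by (simp add: L(4) nth_append)
  next
    case right
    define m where "m = r - 2 - length us"
    have m: "m < length ws" and r: "r = Suc (Suc (length us + m))"
      using right assms(3,4) by (auto simp: m_def L(4))
    define w1 c w2 where "w1 = take m ws" and "c = ws ! m" and "w2 = drop (Suc m) ws"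
    have ws: "ws = w1 @ c # w2" and l: "length w1 = m"
      using id_take_nth_drop[OF m] m by (simp_all add: w1_def c_def w2_def)
    have "linear_on V Z (\<lambda>a. F (us @ h a # w1) c w2)"
      by (rule marked_multilinearD(2)[OF F]) (use L ws in \<open>auto intro!: linear_word_intros\<close>)
    then show ?thesis using l by (simp add: L(4) ws r nth_append)
  qed
qed

text \<open>The inverse of \<open>marked_op\<close>, as \<open>desusp\<close> is an involution.  Its values are \<open>undefined\<close> at irrelevant
  arguments.\<close>

definition op_of :: "('v list \<Rightarrow> 'v \<Rightarrow> 'v list \<Rightarrow> 'v) \<Rightarrow> nat \<Rightarrow> nat \<Rightarrow> 'v list \<Rightarrow> 'v" where
  "op_of b k r = restrict (\<lambda>w. b (take (r - 1) (desusp w)) (desusp w ! (r - 1)) (drop r (desusp w)))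
     {w \<in> words. r \<in> {1..k} \<and> length w = k}"

lemma marked_op_op_of:
  assumes "vs \<in> words" "v \<in> carr V" "ws \<in> words"
  shows "marked_op (op_of b) vs v ws = b vs v ws"
proof -
  have "vs @ v # ws \<in> words" using assms by simp
  then show ?thesis by (simp add: marked_op_def op_of_def desusp_desusp)
qed

lemma op_of_multilinear:
  assumes b: "marked_multilinear V V b" and r: "r \<in> {1..k}"
  shows "multilinear_map k V V (op_of b k r)"
proof -
  let ?f = "\<lambda>w. b (take (r - 1) (desusp w)) (desusp w ! (r - 1)) (drop r (desusp w))"
  have lin: "linear_on V V (\<lambda>a. op_of b k r (us @ a # ws))"
    if "us \<in> words" "ws \<in> words" "length us + 1 + length ws = k" for us ws
  proof -
    have "linear_on V V (\<lambda>a. ?f (us @ a # ws))"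
      by (rule linear_on_split_word[OF b]) (use that r in \<open>auto intro!: linear_word_desusp linear_word_intros\<close>)
    then show ?thesis
      by (subst linear_on_cong[where g = "\<lambda>a. ?f (us @ a # ws)"]) (use that r V in \<open>auto simp: op_of_def\<close>)
  qed
  have "op_of b k r w \<in> carr V" if w: "w \<in> words" "length w = k" for w
  proof -
    obtain a w' where "w = a # w'" using w r by (cases w) auto
    then show ?thesis using linear_onD(1)[OF lin[of "[]" w'], of a] w by simp
  qed
  then show ?thesis
    using linear_onD(2,3)[OF lin] by (simp add: multilinear_map_def)
qed

lemma marked_op_split:
  assumes "r \<in> {1..length w}"
  shows "marked_op \<mu> (take (r - 1) w) (w ! (r - 1)) (drop r w) = \<mu> (length w) r (desusp w)"
proof -
  have l: "r - 1 < length w" and r: "Suc (r - 1) = r" using assms by auto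
  have "length (take (r - 1) w) + 1 + length (drop r w) = length w" "length (take (r - 1) w) + 1 = r"
    using assms by auto
  then show ?thesis unfolding marked_op_def by (simp only: id_take_nth_drop[OF l, unfolded r, symmetric])
qed

lemma op_of_degree:
  assumes b: "\<And>vs v ws d. word_degree V (vs @ v # ws) d \<Longrightarrow> b vs v ws \<in> gr V (d - 1)"
    and w: "r \<in> {1..length w}" "homog V w ds"
  shows "op_of b (length w) r w \<in> gr V (sum_list ds - 1)"
proof -
  let ?u = "desusp w"
  have l: "r - 1 < length ?u" and r: "Suc (r - 1) = r" using w(1) by auto
  have "homog V ?u ds" by (rule sign_scaled_homog[OF sign_scaled_desusp]) (rule w(2))+
  then have "word_degree V (take (r - 1) ?u @ ?u ! (r - 1) # drop r ?u) (sum_list ds)"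
    unfolding id_take_nth_drop[OF l, unfolded r, symmetric] by (rule word_degreeI)
  from b[OF this] show ?thesis using w(1) homog_lists[OF V w(2)] by (simp add: op_of_def)
qed

lemma proj_gr:
  assumes "x \<in> gr C d" shows "proj V x \<in> gr V d"
proof (rule linear_on_gr_Diass[OF V proj(1) subspace_gr _ assms])
  fix vs v ws assume *: "word_degree V (vs @ v # ws) d"
  then have "vs \<in> words" "v \<in> carr V" "ws \<in> words" using word_degree_lists[OF *] by simp_all
  then show "proj V (mword V vs v ws) \<in> gr V d"
    using * module.subspace_0[OF module_V subspace_gr] by (auto simp: proj word_degree_single)
qed

lemma proj_Coder_multilinear:
  assumes D: "linear_on C C D"
  shows "marked_multilinear V V (\<lambda>vs v ws. proj V (D (mword V vs v ws)))"
proof -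
  have h: "linear_on C V (\<lambda>x. proj V (D x))" by (rule linear_on_compose[OF D proj(1)])
  show ?thesis
    by (rule marked_multilinearI; rule linear_on_compose[OF _ h])
      (intro linear_on_mword V linear_word_intros; simp)+
qed

end

lemma susp_simps [simp]:
  "smul (susp A) = smul A" "gr (susp A) i = gr A (i - 1)"
  by (simp_all add: susp_def)

lemma carr_susp [simp]: "carr (susp A) = carr A"
proof -
  have "(\<Union>i. gr A (i - 1)) = (\<Union>i. gr A i)"
  proof (rule equalityI)
    show "(\<Union>i. gr A i) \<subseteq> (\<Union>i. gr A (i - 1))"
    proof (rule subsetI, elim UN_E)
      fix x i assume "x \<in> gr A i"
      then show "x \<in> (\<Union>i. gr A (i - 1))" by (intro UN_I[of "i + 1"]) simp_all
    qed
  qed blast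
  then show ?thesis by (simp add: carr_def)
qed

lemma graded_vector_space_susp:
  assumes "graded_vector_space A" shows "graded_vector_space (susp A)"
  unfolding graded_vector_space_def susp_simps
proof (intro conjI allI impI)
  show "vector_space (smul A)" using assms unfolding graded_vector_space_def by (rule conjunct1)
  show "module.subspace (smul A) (gr A (i - 1))" for i
    using assms unfolding graded_vector_space_def by simp
  have A: "\<forall>i\<in>I. x i = 0" if "finite I" "\<forall>i\<in>I. x i \<in> gr A i" "sum x I = 0" for I x
    using assms that unfolding graded_vector_space_def by simp
  fix I x assume x: "finite I" "\<forall>i\<in>I. x i \<in> gr A (i - 1)" "(\<Sum>i\<in>I. x i) = 0"
  have "\<forall>i\<in>(\<lambda>i. i - 1) ` I. x (i + 1) = 0"
  proof (rule A)
    show "(\<Sum>i\<in>(\<lambda>i. i - 1) ` I. x (i + 1)) = 0"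
      using x(3) by (simp add: sum.reindex inj_on_def)
  qed (use x(1,2) in simp_all)
  then show "\<forall>i\<in>I. x i = 0" by simp
qed

lemma graded_gspace_susp:
  assumes "graded_vector_space A" shows "graded_gspace (susp A)"
proof (intro graded_gspace.intro vector_gspace.intro graded_gspace_axioms.intro)
  show "graded_vector_space (susp A)" using assms by (rule graded_vector_space_susp)
  then show "vector_space (smul (susp A))" unfolding graded_vector_space_def by (rule conjunct1)
qed

lemma homog_susp: "homog (susp A) w ds \<longleftrightarrow> homog A w (map (\<lambda>d. d - 1) ds)"
  by (simp add: homog_def list_all2_map2)

lemma homog_susp': "homog A w ds \<longleftrightarrow> homog (susp A) w (map (\<lambda>d. d + 1) ds)"
  by (simp add: homog_susp comp_def)

lemma multilinear_map_susp: "multilinear_map k (susp A) (susp A) f \<longleftrightarrow> multilinear_map k A A f"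
  by (simp add: multilinear_map_def)

lemma sum_list_minus_1: "(\<Sum>d\<leftarrow>ds. d - 1 :: int) = sum_list ds - int (length ds)"
  by (induction ds) simp_all

lemma sum_list_plus_1: "(\<Sum>d\<leftarrow>ds. d + 1 :: int) = sum_list ds + int (length ds)"
  by (induction ds) simp_all

text \<open>The definition of a \<open>Dend\<^sub>\<infinity>\<close>-algebra in terms of the suspension, the relations being expressed by the
  square of the corresponding coderivation.\<close>

lemma Dend_infinity_iff:
  fixes A :: "('k::field, 'v::ab_group_add) gspace"
  assumes A: "graded_vector_space A"
  shows "Dend_infinity A \<mu> \<longleftrightarrow>
    (\<forall>k r. \<mu> k r \<in> extensional {w \<in> lists (carr A). r \<in> {1..k} \<and> length w = k}) \<and>
    (\<forall>k r. r \<in> {1..k} \<longrightarrow> multilinear_map k (susp A) (susp A) (\<mu> k r)) \<and>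
    (\<forall>r w ds. r \<in> {1..length w} \<longrightarrow> homog (susp A) w ds \<longrightarrow> \<mu> (length w) r w \<in> gr (susp A) (sum_list ds - 1)) \<and>
    (\<forall>vs v ws d. word_degree (susp A) (vs @ v # ws) d \<longrightarrow>
       graded_gspace.square_proj (susp A) (graded_gspace.marked_op (susp A) \<mu>) vs v ws = 0)"
    (is "_ \<longleftrightarrow> ?ext \<and> ?mult \<and> ?deg \<and> ?rel")
proof -
  interpret graded_gspace "susp A" using A by (rule graded_gspace_susp)
  interpret vector_space "smul A" using A by (simp add: graded_vector_space_def)
  let ?S = "\<lambda>r w ds. (\<Sum>(i, j)\<in>{(i, j). 1 \<le> i \<and> 1 \<le> j \<and> i + j = length w + 1}. \<Sum>l=1..j.
           smul A (sgnp (int l * (int i + 1) + int i * sum_list (take (l - 1) ds)))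
             (\<mu> j (R0 j i l r) (take (l - 1) w @
                 [extend_lin A \<mu> i (R j i l r) (take i (drop (l - 1) w))] @ drop (l + i - 1) w)))"
  have Dend: "Dend_infinity A \<mu> \<longleftrightarrow> ?ext \<and>
     (\<forall>k\<ge>1. \<forall>r\<in>{1..k}. multilinear_map k A A (\<mu> k r) \<and>
        (\<forall>as ds. length as = k \<and> homog A as ds \<longrightarrow> \<mu> k r as \<in> gr A (sum_list ds + int k - 2))) \<and>
     (\<forall>n\<ge>1. \<forall>r\<in>{1..n}. \<forall>as ds. length as = n \<and> homog A as ds \<longrightarrow> ?S r as ds = 0)"
    unfolding Dend_infinity_def
    by (intro conj_cong all_cong imp_cong refl ball_cong) auto
  have mult_deg: "(\<forall>k\<ge>1. \<forall>r\<in>{1..k}. multilinear_map k A A (\<mu> k r) \<and>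
        (\<forall>as ds. length as = k \<and> homog A as ds \<longrightarrow> \<mu> k r as \<in> gr A (sum_list ds + int k - 2))) \<longleftrightarrow> ?mult \<and> ?deg"
    (is "?l \<longleftrightarrow> _")
  proof (intro iffI conjI allI impI ballI)
    fix k r :: nat assume "?l" "r \<in> {1..k}"
    then show "multilinear_map k (susp A) (susp A) (\<mu> k r)" by (simp add: multilinear_map_susp)
  next
    fix r :: nat and w ds assume l: "?l" and r: "r \<in> {1..length w}" and h: "homog (susp A) w ds"
    have "\<mu> (length w) r w \<in> gr A (sum_list (map (\<lambda>d. d - 1) ds) + int (length w) - 2)"
      using l r h by (simp add: homog_susp)
    moreover have "length ds = length w" using h by (simp add: homog_def list_all2_lengthD)
    ultimately show "\<mu> (length w) r w \<in> gr (susp A) (sum_list ds - 1)"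
      by (simp add: sum_list_minus_1)
  next
    fix k r :: nat assume "?mult \<and> ?deg" "r \<in> {1..k}"
    then show "multilinear_map k A A (\<mu> k r)" by (simp add: multilinear_map_susp)
  next
    fix k r :: nat and as ds assume *: "?mult \<and> ?deg" "r \<in> {1..k}" "length as = k \<and> homog A as ds"
    then have "\<mu> (length as) r as \<in> gr (susp A) (sum_list (map (\<lambda>d. d + 1) ds) - 1)"
      by (intro conjunct2[OF *(1), rule_format]) (simp_all only: homog_susp'[symmetric])
    moreover have "length ds = k" using *(3) by (auto simp: homog_def list_all2_lengthD)
    ultimately show "\<mu> k r as \<in> gr A (sum_list ds + int k - 2)"
      using *(3) by (simp add: sum_list_plus_1)
  qed
  have rel: "square_proj (marked_op \<mu>) vs v ws = 0 \<longleftrightarrow> ?S (length vs + 1) (vs @ v # ws) ds = 0"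
    if m: "?mult" and d: "?deg" and h: "homog A (vs @ v # ws) ds" for vs v ws ds
  proof -
    let ?ds = "map (\<lambda>d. d + 1) ds"
    have h': "homog (susp A) (vs @ v # ws) ?ds" by (rule homog_susp'[THEN iffD1, OF h])
    have len: "length ds = length (vs @ v # ws)"
      using list_all2_lengthD[OF h[unfolded homog_def]] by simp
    have e: "sum_list (take (l - 1) ?ds) - int (l - 1) = sum_list (take (l - 1) ds)" if "l - 1 \<le> length ds" for l
      using that by (simp add: take_map sum_list_plus_1)
    let ?t = "\<lambda>i j l. smul A (sgnp (int l * (int i + 1) + int i * (sum_list (take (l - 1) ?ds) - int (l - 1))))
        (\<mu> j (R0 j i l (length vs + 1))
          (take (l - 1) (vs @ v # ws) @
           [extend_lin (susp A) \<mu> i (R j i l (length vs + 1)) (take i (drop (l - 1) (vs @ v # ws)))] @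
           drop (l + i - 1) (vs @ v # ws)))"
    have "square_proj (marked_op \<mu>) vs v ws = smul A (sgnp (desusp_exp ?ds + int (length ?ds) + 1))
      (\<Sum>(i, j)\<in>{(i, j). 1 \<le> i \<and> 1 \<le> j \<and> i + j = length ?ds + 1}. \<Sum>l=1..j. ?t i j l)"
      using square_proj_sign[of \<mu>, OF m[rule_format] d[rule_format] h'] by (simp only: susp_simps)
    also have "(\<Sum>(i, j)\<in>{(i, j). 1 \<le> i \<and> 1 \<le> j \<and> i + j = length ?ds + 1}. \<Sum>l=1..j. ?t i j l) =
        ?S (length vs + 1) (vs @ v # ws) ds"
    proof (intro sum.cong, goal_cases)
      case 1
      then show ?case by (simp add: len)
    next
      case (2 p)
      then show ?case
        by (clarsimp simp only: split_paired_all case_prod_conv mem_Collect_eq)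
          (intro sum.cong refl, subst e, auto simp: len extend_lin_def)
    qed
    finally have "square_proj (marked_op \<mu>) vs v ws =
      smul A (sgnp (desusp_exp ?ds + int (length ?ds) + 1)) (?S (length vs + 1) (vs @ v # ws) ds)" .
    moreover have "sgnp e \<noteq> (0 :: 'k)" for e :: int by (simp add: sgnp_def)
    ultimately show ?thesis by simp
  qed
  have "(\<forall>n\<ge>1. \<forall>r\<in>{1..n}. \<forall>as ds. length as = n \<and> homog A as ds \<longrightarrow> ?S r as ds = 0) \<longleftrightarrow> ?rel"
    if m: "?mult" and d: "?deg"
  proof (intro iffI allI impI ballI)
    fix vs v ws e
    assume l: "\<forall>n\<ge>1. \<forall>r\<in>{1..n}. \<forall>as ds. length as = n \<and> homog A as ds \<longrightarrow> ?S r as ds = 0"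
      and "word_degree (susp A) (vs @ v # ws) e"
    from this(2) obtain ds where ds: "homog (susp A) (vs @ v # ws) ds" by (rule word_degreeE)
    have h: "homog A (vs @ v # ws) (map (\<lambda>d. d - 1) ds)" using ds by (simp only: homog_susp)
    show "square_proj (marked_op \<mu>) vs v ws = 0"
      unfolding rel[OF m d h]
      by (rule l[rule_format, of "length (vs @ v # ws)", OF _ _ conjI[OF refl h]]) simp_all
  next
    fix n r :: nat and as ds
    assume r: "?rel" "r \<in> {1..n}" and as: "length as = n \<and> homog A as ds"
    have l: "r - 1 < length as" and r': "Suc (r - 1) = r" using r(2) as by auto
    note eq = id_take_nth_drop[OF l, unfolded r', symmetric]
    have h: "homog A (take (r - 1) as @ as ! (r - 1) # drop r as) ds" unfolding eq using as by (rule conjunct2)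
    have "square_proj (marked_op \<mu>) (take (r - 1) as) (as ! (r - 1)) (drop r as) = 0"
      by (rule r(1)[rule_format, OF word_degreeI[OF homog_susp'[THEN iffD1, OF h]]])
    moreover have "length (take (r - 1) as) + 1 = r" using r(2) as by auto
    ultimately show "?S r as ds = 0"
      using rel[OF m d h] unfolding eq by (simp only:)
  qed
  note S_rel = this
  have "(E \<and> (M \<and> G) \<and> S) = (E \<and> M \<and> G \<and> Q)" if "M \<Longrightarrow> G \<Longrightarrow> S = Q" for E M G S Q
    using that by blast
  from this[OF S_rel] show ?thesis unfolding Dend mult_deg .
qed

section \<open>The equivalence\<close>

theorem theorem4p7:
  fixes A :: "('k::field_char_0, 'a::ab_group_add) gspace"
  assumes "graded_vector_space A"
  defines "V \<equiv> susp A"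
  shows "\<exists>\<Phi>. bij_betw \<Phi> {\<mu>. Dend_infinity A \<mu>}
           {D \<in> Coder (-1) (Diass V) (coprod1 V) (coprod2 V). \<forall>x\<in>carr (Diass V). D (D x) = 0} \<and>
         (\<forall>\<mu>. Dend_infinity A \<mu> \<longrightarrow> corresponds A \<mu> (\<Phi> \<mu>))"
proof -
  interpret graded_gspace V unfolding V_def using assms(1) by (rule graded_gspace_susp)
  have V_simps: "smul V = smul A" "carr V = carr A" by (simp_all add: V_def)
  note Dend = Dend_infinity_iff[OF assms(1), folded V_def]
  let ?Coder = "Coder (-1) (Diass V) (coprod1 V) (coprod2 V)"
  define \<Phi> where "\<Phi> \<mu> = coder_of (marked_op \<mu>)" for \<mu>
  have extens: "\<mu> k r \<in> extensional {w \<in> lists (carr A). r \<in> {1..k} \<and> length w = k}"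
    if "Dend_infinity A \<mu>" for \<mu> k r
    by (rule Dend[THEN iffD1, OF that, THEN conjunct1, rule_format])
  \<comment> \<open>Families of multilinear operations of the right degrees, without the relations.\<close>
  define Op where "Op \<mu> \<longleftrightarrow> (\<forall>k r. r \<in> {1..k} \<longrightarrow> multilinear_map k V V (\<mu> k r)) \<and>
    (\<forall>r w ds. r \<in> {1..length w} \<longrightarrow> homog V w ds \<longrightarrow> \<mu> (length w) r w \<in> gr V (sum_list ds - 1))" for \<mu>
  have mult: "multilinear_map k V V (\<mu> k r)" if "Op \<mu>" "r \<in> {1..k}" for \<mu> k r
    using that by (simp add: Op_def)
  have deg: "\<mu> (length w) r w \<in> gr V (sum_list ds - 1)"
    if "Op \<mu>" "r \<in> {1..length w}" "homog V w ds" for \<mu> r w ds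
    using that by (simp add: Op_def)
  have Dend_iff: "Dend_infinity A \<mu> \<longleftrightarrow>
      (\<forall>k r. \<mu> k r \<in> extensional {w \<in> lists (carr A). r \<in> {1..k} \<and> length w = k}) \<and> Op \<mu> \<and>
      (\<forall>vs v ws d. word_degree V (vs @ v # ws) d \<longrightarrow> square_proj (marked_op \<mu>) vs v ws = 0)" for \<mu>
    unfolding Dend Op_def by (simp only: conj_assoc)
  have Op: "Op \<mu>" if "Dend_infinity A \<mu>" for \<mu>
    by (rule Dend_iff[THEN iffD1, OF that, THEN conjunct2, THEN conjunct1])
  note rel = Dend_iff[THEN iffD1, THEN conjunct2, THEN conjunct2]
  have \<Phi>_Coder: "\<Phi> \<mu> \<in> ?Coder" if "Op \<mu>" for \<mu>
    unfolding \<Phi>_def by (rule coder_of_Coder[OF marked_op_multilinear marked_op_gr]) (rule mult[OF that] deg[OF that]; assumption)+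
  have proj_\<Phi>: "proj V (\<Phi> \<mu> (mword V vs v ws)) = marked_op \<mu> vs v ws"
    if "Op \<mu>" and w: "vs \<in> lists (carr V)" "v \<in> carr V" "ws \<in> lists (carr V)" for \<mu> vs v ws
    unfolding \<Phi>_def by (rule proj_coder_of[OF marked_op_multilinear[OF mult[OF that(1)]] w])
  have \<Phi>_square: "(\<forall>x\<in>carr C. \<Phi> \<mu> (\<Phi> \<mu> x) = 0) \<longleftrightarrow>
      (\<forall>vs v ws d. word_degree V (vs @ v # ws) d \<longrightarrow> square_proj (marked_op \<mu>) vs v ws = 0)"
    if \<mu>: "Op \<mu>" for \<mu>
  proof -
    have "proj V (\<Phi> \<mu> (\<Phi> \<mu> (mword V vs v ws))) = square_proj (marked_op \<mu>) vs v ws"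
      if "word_degree V (vs @ v # ws) d" for vs v ws d
      unfolding \<Phi>_def
      by (rule proj_square[OF marked_op_multilinear[OF mult[OF \<mu>]]]) (use word_degree_lists[OF that] in simp_all)
    then have "(\<forall>vs v ws d. word_degree V (vs @ v # ws) d \<longrightarrow> proj V (\<Phi> \<mu> (\<Phi> \<mu> (mword V vs v ws))) = 0) \<longleftrightarrow>
        (\<forall>vs v ws d. word_degree V (vs @ v # ws) d \<longrightarrow> square_proj (marked_op \<mu>) vs v ws = 0)"
      by (simp cong: imp_cong)
    with Coder_square_zero_iff[OF \<Phi>_Coder[OF \<mu>]] show ?thesis by (rule trans)
  qed
  have split: "take (r - 1) w \<in> lists (carr V)" "w ! (r - 1) \<in> carr V" "drop r w \<in> lists (carr V)"
    if "w \<in> lists (carr V)" "r \<in> {1..length w}" for w r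
    using that by (auto simp: take_drop_in_lists)
  have proj_split: "proj V (\<Phi> \<mu> (mword V (take (r - 1) w) (w ! (r - 1)) (drop r w))) = \<mu> (length w) r (desusp w)"
    if "Dend_infinity A \<mu>" "w \<in> lists (carr V)" "r \<in> {1..length w}" for \<mu> w r
    by (rule trans[OF proj_\<Phi>[OF Op[OF that(1)] split[OF that(2,3)]] marked_op_split[OF that(3)]])

  have into: "\<Phi> \<mu> \<in> {D \<in> ?Coder. \<forall>x\<in>carr (Diass V). D (D x) = 0}" if \<mu>: "Dend_infinity A \<mu>" for \<mu>
    using \<Phi>_Coder[OF Op[OF \<mu>]] \<Phi>_square[OF Op[OF \<mu>], THEN iffD2, OF rel[OF \<mu>]]
    by blast
  have inj: "\<mu> = \<mu>'" if \<mu>: "Dend_infinity A \<mu>" and \<mu>': "Dend_infinity A \<mu>'" and eq: "\<Phi> \<mu> = \<Phi> \<mu>'" for \<mu> \<mu>'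
  proof (intro ext)
    fix k r w
    show "\<mu> k r w = \<mu>' k r w"
    proof (cases "w \<in> lists (carr A) \<and> r \<in> {1..k} \<and> length w = k")
      case True
      then have w: "desusp w \<in> lists (carr V)" "r \<in> {1..length (desusp w)}" "length (desusp w) = k"
        and ww: "desusp (desusp w) = w"
        by (simp_all add: V_simps desusp_desusp flip: V_simps(2))
      show ?thesis
        using proj_split[OF \<mu> w(1,2)] proj_split[OF \<mu>' w(1,2)] unfolding eq ww w(3) by (simp only:)
    next
      case False
      then show ?thesis using extens[OF \<mu>, THEN extensional_arb, of w] extens[OF \<mu>', THEN extensional_arb, of w] by simp
    qed
  qed
  have surj: "\<exists>\<mu>. Dend_infinity A \<mu> \<and> \<Phi> \<mu> = D"
    if D: "D \<in> ?Coder" and sq: "\<forall>x\<in>carr (Diass V). D (D x) = 0" for D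
  proof -
    \<comment> \<open>The operations are read off from the projection of \<open>D\<close> to the cogenerators.\<close>
    define b where "b = (\<lambda>vs v ws. proj V (D (mword V vs v ws)))"
    have Dl: "D \<in> lin_deg (- 1) C C" using D by (simp add: Coder_iff)
    have b: "marked_multilinear V V b"
      unfolding b_def by (rule proj_Coder_multilinear) (use Dl in \<open>simp add: lin_deg_def lin_linear_on\<close>)
    have b_gr: "b vs v ws \<in> gr V (d - 1)" if "word_degree V (vs @ v # ws) d" for vs v ws d
      unfolding b_def
      by (rule proj_gr) (use Dl mword_gr[OF that] in \<open>simp add: lin_deg_def\<close>)
    have Opb: "Op (op_of b)"
      unfolding Op_def using op_of_multilinear[OF b] op_of_degree[OF b_gr] by (intro conjI allI impI)
    have \<Phi>D: "\<Phi> (op_of b) = D"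
    proof (rule Coder_eqI[OF \<Phi>_Coder[OF Opb] D])
      fix vs v ws assume w: "vs \<in> lists (carr V)" "v \<in> carr V" "ws \<in> lists (carr V)"
      show "proj V (\<Phi> (op_of b) (mword V vs v ws)) = proj V (D (mword V vs v ws))"
        using trans[OF proj_\<Phi>[OF Opb w] marked_op_op_of[OF w]] by (simp only: b_def)
    qed
    have "\<forall>k r. op_of b k r \<in> extensional {w \<in> lists (carr A). r \<in> {1..k} \<and> length w = k}"
      by (simp add: op_of_def V_simps)
    then have "Dend_infinity A (op_of b)"
      unfolding Dend_iff using Opb \<Phi>_square[OF Opb, unfolded \<Phi>D, THEN iffD1, OF sq] by (intro conjI)
    then show ?thesis using \<Phi>D by blast
  qed
  have "bij_betw \<Phi> {\<mu>. Dend_infinity A \<mu>} {D \<in> ?Coder. \<forall>x\<in>carr (Diass V). D (D x) = 0}"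
  proof (rule bij_betw_imageI)
    show "inj_on \<Phi> {\<mu>. Dend_infinity A \<mu>}" by (rule inj_onI) (simp add: inj)
    show "\<Phi> ` {\<mu>. Dend_infinity A \<mu>} = {D \<in> ?Coder. \<forall>x\<in>carr (Diass V). D (D x) = 0}"
    proof (intro equalityI subsetI)
      fix D assume "D \<in> {D \<in> ?Coder. \<forall>x\<in>carr (Diass V). D (D x) = 0}"
      then obtain \<mu> where "Dend_infinity A \<mu>" "\<Phi> \<mu> = D" using surj by blast
      then show "D \<in> \<Phi> ` {\<mu>. Dend_infinity A \<mu>}" by blast
    qed (use into in blast)
  qed
  moreover have "corresponds A \<mu> (\<Phi> \<mu>)" if \<mu>: "Dend_infinity A \<mu>" for \<mu>
    unfolding corresponds_def V_def[symmetric]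
  proof (intro allI impI ballI)
    fix k r :: nat and as ds assume r: "r \<in> {1..k}" and as: "length as = k \<and> homog A as ds"
    have h: "homog V as (map (\<lambda>d. d + 1) ds)"
      unfolding V_def by (rule homog_susp'[THEN iffD1, OF conjunct2[OF as]])
    have l: "as \<in> lists (carr V)" by (rule homog_lists[OF V h])
    have len: "length as = k" "length ds = k"
      using as by (auto simp: homog_def list_all2_lengthD)
    have r': "r \<in> {1..length as}" using r len by simp
    have lin: "linear_on V V (\<lambda>a. \<mu> (length as) r (us @ a # ws))"
      if "us \<in> lists (carr V)" "ws \<in> lists (carr V)" "length us + 1 + length ws = length as" for us ws
      by (rule op_linear[OF _ that r']) (rule mult[OF Op[OF \<mu>]])
    have "proj V (\<Phi> \<mu> (mword V (take (r - 1) as) (as ! (r - 1)) (drop r as))) = \<mu> (length as) r (desusp as)"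
      by (rule proj_split[OF \<mu> l r'])
    also have "\<dots> = smul V (sgnp (desusp_exp (map (\<lambda>d. d + 1) ds))) (\<mu> (length as) r as)"
      using sign_scaled_apply[OF sign_scaled_desusp[OF h], of "[]" "length as" "\<mu> (length as) r"] lin l
      by simp
    also have "desusp_exp (map (\<lambda>d. d + 1) ds) = (\<Sum>p<k. int (k - 1 - p) * (ds ! p + 1))"
      unfolding desusp_exp_sum by (simp add: len)
    finally show "proj V (\<Phi> \<mu> (mword V (take (r - 1) as) (as ! (r - 1)) (drop r as))) =
        smul A (sgnp (\<Sum>p<k. int (k - 1 - p) * (ds ! p + 1))) (\<mu> k r as)"
      by (simp only: V_simps len)
  qed
  ultimately show ?thesis by blast
qed

end
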